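(* Let $D$ be a planar lattice diagram. Then $D$ is a slim semimodular lattice diagram if and only if (up to similarity) $D$ can be obtained from a slim distributive lattice diagram by a finite (possibly empty) sequence of resections.
   Context: All lattices are finite. A planar diagram is a planar Hasse diagram of a finite lattice; notions for lattices are applied to diagrams. Its boundary is the union of its left and right boundary chains. $\prec$ denotes covering and $C_n$ the $n$-element chain. A sublattice of $D$ is cover-preserving if its coverings are coverings of $D$. A lattice $L$ is slim if it is finite and the set $\mathrm{Ji}\,L$ of its join-irreducible elements contains no three-element antichain; slim lattices are planar. A slim semimodular (slim distributive) diagram is a planar diagram of a slim semimodular (slim distributive) lattice. Two planar diagrams are similar if there is a bijection between them that preserves the left-right order of the upper covers and of the lower covers of each element; diagrams are considered only up to similarity. $C_3$-trajectories. Let $D$ be a slim semimodular diagram. Two cover-preserving $C_3$-chains $a_0\prec a_1\prec a_2$ and $b_0\prec b_1\prec b_2$ of $D$ are consecutive if they are opposite sides of a cover-preserving $C_3\times C_2$ in $D$. A class of the reflexive transitive closure of this relation is a $C_3$-trajectory; it is a sequence of chains, listed from left to right, and it does not branch out. For a cover-preserving $C_3$-chain $A$, the chains of the trajectory through $A$ that are to the left of $A$, including $A$, form the left wing of $A$; those to the right of $A$, including $A$, form the right wing of $A$. $C_3$-schemes. Let $B$ be a cover-preserving sublattice $C_3\times C_3$ of $D$. Let $W_l$ be the left wing of the upper left boundary of $B$ (the three-element chain from the left corner of $B$ to its top) and let $W_r$ be the right wing of the upper right boundary of $B$. If both wings terminate on the boundary of $D$ (the last $C_3$-chain of $W_l$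 and the last $C_3$-chain of $W_r$ are on the boundary of $D$), then the set $S$ of elements of $B\cup W_l\cup W_r$ is a $C_3$-scheme of $D$, and the middle element of $B$ is its anchor. The interior elements of $S$ are the anchor and the middle elements of the $C_3$-chains belonging to $W_l$ and $W_r$ (including the middle elements of the last chains). Resection. Given a $C_3$-scheme $S$ of a slim semimodular diagram $D$, the resection at its anchor produces the diagram obtained from $D$ by deleting all interior elements of $S$ except its anchor (with the inherited order and drawing). *)

theory Defs
  imports "HOL-Analysis.Analysis" "HOL-Algebra.Lattice"
begin

section \<open>Order-theoretic notions\<close>

definition covers :: "'a gorder \<Rightarrow> 'a \<Rightarrow> 'a \<Rightarrow> bool" where
  "covers L a b \<longleftrightarrow> a \<in> carrier L \<and> b \<in> carrier L \<and> a \<sqsubset>\<^bsub>L\<^esub> b \<and>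
     \<not> (\<exists>c\<in>carrier L. a \<sqsubset>\<^bsub>L\<^esub> c \<and> c \<sqsubset>\<^bsub>L\<^esub> b)"

definition Ji :: "'a gorder \<Rightarrow> 'a set" where
  "Ji L = {x \<in> carrier L. x \<noteq> \<bottom>\<^bsub>L\<^esub> \<and>
     (\<forall>a\<in>carrier L. \<forall>b\<in>carrier L. x = a \<squnion>\<^bsub>L\<^esub> b \<longrightarrow> x = a \<or> x = b)}"

definition antichain :: "'a gorder \<Rightarrow> 'a set \<Rightarrow> bool" where
  "antichain L X \<longleftrightarrow> X \<subseteq> carrier L \<and> (\<forall>x\<in>X. \<forall>y\<in>X. x \<sqsubseteq>\<^bsub>L\<^esub> y \<longrightarrow> x = y)"

text \<open>The library's lattices may have an empty carrier; this is excluded here.\<close>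

definition finite_lattice :: "'a gorder \<Rightarrow> bool" where
  "finite_lattice L \<longleftrightarrow> lattice L \<and> finite (carrier L) \<and> carrier L \<noteq> {}"

definition slim :: "'a gorder \<Rightarrow> bool" where
  "slim L \<longleftrightarrow> finite_lattice L \<and> \<not> (\<exists>X \<subseteq> Ji L. card X = 3 \<and> antichain L X)"

definition semimodular :: "'a gorder \<Rightarrow> bool" where
  "semimodular L \<longleftrightarrow>
     (\<forall>a b c. covers L a b \<and> c \<in> carrier L \<longrightarrow>
        covers L (a \<squnion>\<^bsub>L\<^esub> c) (b \<squnion>\<^bsub>L\<^esub> c) \<or> a \<squnion>\<^bsub>L\<^esub> c = b \<squnion>\<^bsub>L\<^esub> c)"

definition distributive :: "'a gorder \<Rightarrow> bool" where
  "distributive L \<longleftrightarrow>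
     (\<forall>a\<in>carrier L. \<forall>b\<in>carrier L. \<forall>c\<in>carrier L.
        a \<sqinter>\<^bsub>L\<^esub> (b \<squnion>\<^bsub>L\<^esub> c) = (a \<sqinter>\<^bsub>L\<^esub> b) \<squnion>\<^bsub>L\<^esub> (a \<sqinter>\<^bsub>L\<^esub> c))"

definition cover_preserving_sublattice :: "'a gorder \<Rightarrow> 'a set \<Rightarrow> bool" where
  "cover_preserving_sublattice L X \<longleftrightarrow>
     X \<noteq> {} \<and> X \<subseteq> carrier L \<and>
     (\<forall>x\<in>X. \<forall>y\<in>X. x \<squnion>\<^bsub>L\<^esub> y \<in> X \<and> x \<sqinter>\<^bsub>L\<^esub> y \<in> X) \<and>
     (\<forall>x y. covers (L\<lparr>carrier := X\<rparr>) x y \<longrightarrow> covers L x y)"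

text \<open>
  The map \<open>g\<close> is an order isomorphism from \<open>C\<^sub>m \<times> C\<^sub>n\<close>, whose elements are the pairs
  \<open>(i, j)\<close> with \<open>i < m\<close> and \<open>j < n\<close>, onto a cover-preserving sublattice of \<open>L\<close>.
\<close>

definition cp_grid :: "'a gorder \<Rightarrow> nat \<Rightarrow> nat \<Rightarrow> (nat \<times> nat \<Rightarrow> 'a) \<Rightarrow> bool" where
  "cp_grid L m n g \<longleftrightarrow>
     cover_preserving_sublattice L (g ` ({..<m} \<times> {..<n})) \<and>
     (\<forall>i<m. \<forall>j<n. \<forall>k<m. \<forall>l<n. g (i, j) \<sqsubseteq>\<^bsub>L\<^esub> g (k, l) \<longleftrightarrow> i \<le> k \<and> j \<le> l)"


section \<open>Planar diagrams\<close>

text \<open>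
  A diagram is an order whose elements are points of the plane. Its edges are the straight line
  segments between the points \<open>a\<close> and \<open>b\<close> with \<open>a \<prec> b\<close>; so the order determines the drawing.
\<close>

type_synonym point = "real \<times> real"
type_synonym diagram = "point gorder"

definition planar_hasse_diagram :: "diagram \<Rightarrow> bool" where
  "planar_hasse_diagram D \<longleftrightarrow>
     partial_order D \<and> finite (carrier D) \<and> carrier D \<noteq> {} \<and>
     (\<forall>a b. covers D a b \<longrightarrow> snd a < snd b) \<and>
     (\<forall>a b. covers D a b \<longrightarrow> open_segment a b \<inter> carrier D = {}) \<and>
     (\<forall>a b c d. covers D a b \<and> covers D c d \<and> (a, b) \<noteq> (c, d) \<longrightarrow>
        open_segment a b \<inter> open_segment c d = {})"

definition planar_lattice_diagram :: "diagram \<Rightarrow> bool" where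
  "planar_lattice_diagram D \<longleftrightarrow> planar_hasse_diagram D \<and> finite_lattice D"

definition slim_semimodular_diagram :: "diagram \<Rightarrow> bool" where
  "slim_semimodular_diagram D \<longleftrightarrow> planar_lattice_diagram D \<and> slim D \<and> semimodular D"

definition slim_distributive_diagram :: "diagram \<Rightarrow> bool" where
  "slim_distributive_diagram D \<longleftrightarrow> planar_lattice_diagram D \<and> slim D \<and> distributive D"

text \<open>
  For \<open>a\<close> below \<open>b\<close> (that is, \<open>snd a < snd b\<close>), the point \<open>p\<close> is strictly to the left of the line
  through \<open>a\<close> and \<open>b\<close>. Hence, if \<open>b\<close> and \<open>c\<close> are upper covers of \<open>a\<close>, then \<open>b\<close> is to the left of \<open>c\<close>
  iff \<open>left_of_line b a c\<close>; and if \<open>b\<close> and \<open>c\<close> are lower covers of \<open>a\<close>, then \<open>b\<close> is to the left of \<open>c\<close>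
  iff \<open>left_of_line b c a\<close>.
\<close>

definition left_of_line :: "point \<Rightarrow> point \<Rightarrow> point \<Rightarrow> bool" where
  "left_of_line p a b \<longleftrightarrow>
     (fst p - fst a) * (snd b - snd a) < (fst b - fst a) * (snd p - snd a)"

definition right_of_line :: "point \<Rightarrow> point \<Rightarrow> point \<Rightarrow> bool" where
  "right_of_line p a b \<longleftrightarrow>
     (fst b - fst a) * (snd p - snd a) < (fst p - fst a) * (snd b - snd a)"

definition similar :: "diagram \<Rightarrow> diagram \<Rightarrow> bool" where
  "similar D E \<longleftrightarrow>
     (\<exists>f. bij_betw f (carrier D) (carrier E) \<and>
        (\<forall>x\<in>carrier D. \<forall>y\<in>carrier D. x \<sqsubseteq>\<^bsub>D\<^esub> y \<longleftrightarrow> f x \<sqsubseteq>\<^bsub>E\<^esub> f y) \<and>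
        (\<forall>a b c. covers D a b \<and> covers D a c \<longrightarrow>
           (left_of_line b a c \<longleftrightarrow> left_of_line (f b) (f a) (f c))) \<and>
        (\<forall>a b c. covers D b a \<and> covers D c a \<longrightarrow>
           (left_of_line b c a \<longleftrightarrow> left_of_line (f b) (f c) (f a))))"

text \<open>
  The left (right) boundary chain is the maximal chain such that no element of the diagram is
  strictly to the left (right) of the polygonal path formed by its edges.
\<close>

definition left_boundary_chain :: "diagram \<Rightarrow> point set \<Rightarrow> bool" where
  "left_boundary_chain D C \<longleftrightarrow> pred_on.maxchain (carrier D) (le D) C \<and>
     \<not> (\<exists>p\<in>carrier D. \<exists>a\<in>C. \<exists>b\<in>C.
          covers D a b \<and> snd a \<le> snd p \<and> snd p \<le> snd b \<and> left_of_line p a b)"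

definition right_boundary_chain :: "diagram \<Rightarrow> point set \<Rightarrow> bool" where
  "right_boundary_chain D C \<longleftrightarrow> pred_on.maxchain (carrier D) (le D) C \<and>
     \<not> (\<exists>p\<in>carrier D. \<exists>a\<in>C. \<exists>b\<in>C.
          covers D a b \<and> snd a \<le> snd p \<and> snd p \<le> snd b \<and> right_of_line p a b)"

definition boundary :: "diagram \<Rightarrow> point set" where
  "boundary D = \<Union>{C. left_boundary_chain D C} \<union> \<Union>{C. right_boundary_chain D C}"


section \<open>Trajectories and schemes\<close>

text \<open>A three-element chain \<open>a\<^sub>0 \<prec> a\<^sub>1 \<prec> a\<^sub>2\<close> is represented by the triple of its elements.\<close>

type_synonym triple = "point \<times> point \<times> point"

definition bot_elem :: "triple \<Rightarrow> point" where "bot_elem A = fst A"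
definition mid_elem :: "triple \<Rightarrow> point" where "mid_elem A = fst (snd A)"
definition top_elem :: "triple \<Rightarrow> point" where "top_elem A = snd (snd A)"

definition elems :: "triple \<Rightarrow> point set" where
  "elems A = {bot_elem A, mid_elem A, top_elem A}"

text \<open>
  \<open>A\<close> and \<open>X\<close> are the lower and the upper of the two opposite \<open>C\<^sub>3\<close>-sides of a cover-preserving
  \<open>C\<^sub>3 \<times> C\<^sub>2\<close>.
\<close>

definition opposite_sides :: "diagram \<Rightarrow> triple \<Rightarrow> triple \<Rightarrow> bool" where
  "opposite_sides D A X \<longleftrightarrow>
     (\<exists>g. cp_grid D 3 2 g \<and> A = (g (0, 0), g (1, 0), g (2, 0)) \<and> X = (g (0, 1), g (1, 1), g (2, 1)))"

definition consecutive :: "diagram \<Rightarrow> triple \<Rightarrow> triple \<Rightarrow> bool" where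
  "consecutive D A X \<longleftrightarrow> opposite_sides D A X \<or> opposite_sides D X A"

definition trajectory :: "diagram \<Rightarrow> triple \<Rightarrow> triple set" where
  "trajectory D A = {X. (consecutive D)\<^sup>*\<^sup>* A X}"

text \<open>
  \<open>X\<close> and \<open>A\<close> are consecutive and \<open>X\<close> is the left one: the two upper covers of the bottom of the
  \<open>C\<^sub>3 \<times> C\<^sub>2\<close> are the middle element of the lower side and the least element of the upper side, and
  the one belonging to \<open>X\<close> is to the left of the one belonging to \<open>A\<close>.
\<close>

definition next_left :: "diagram \<Rightarrow> triple \<Rightarrow> triple \<Rightarrow> bool" where
  "next_left D X A \<longleftrightarrow>
     opposite_sides D A X \<and> left_of_line (bot_elem X) (bot_elem A) (mid_elem A) \<or>
     opposite_sides D X A \<and> left_of_line (mid_elem X) (bot_elem X) (bot_elem A)"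

definition left_wing :: "diagram \<Rightarrow> triple \<Rightarrow> triple set" where
  "left_wing D A = {X \<in> trajectory D A. (next_left D)\<^sup>*\<^sup>* X A}"

definition right_wing :: "diagram \<Rightarrow> triple \<Rightarrow> triple set" where
  "right_wing D A = {X \<in> trajectory D A. (next_left D)\<^sup>*\<^sup>* A X}"

definition left_wing_terminates_on_boundary :: "diagram \<Rightarrow> triple \<Rightarrow> bool" where
  "left_wing_terminates_on_boundary D A \<longleftrightarrow>
     (\<exists>X \<in> left_wing D A. \<not> (\<exists>Y. next_left D Y X) \<and> elems X \<subseteq> boundary D)"

definition right_wing_terminates_on_boundary :: "diagram \<Rightarrow> triple \<Rightarrow> bool" where
  "right_wing_terminates_on_boundary D A \<longleftrightarrow>
     (\<exists>X \<in> right_wing D A. \<not> (\<exists>Y. next_left D X Y) \<and> elems X \<subseteq> boundary D)"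

text \<open>
  A scheme is given by its \<open>C\<^sub>3 \<times> C\<^sub>3\<close>, coordinatized so that \<open>(1, 0)\<close> is to the left of \<open>(0, 1)\<close>.
  Then \<open>(2, 0)\<close> is the left corner and \<open>(0, 2)\<close> is the right corner.
\<close>

definition upper_left :: "(nat \<times> nat \<Rightarrow> point) \<Rightarrow> triple" where
  "upper_left g = (g (2, 0), g (2, 1), g (2, 2))"

definition upper_right :: "(nat \<times> nat \<Rightarrow> point) \<Rightarrow> triple" where
  "upper_right g = (g (0, 2), g (1, 2), g (2, 2))"

definition C3_scheme :: "diagram \<Rightarrow> (nat \<times> nat \<Rightarrow> point) \<Rightarrow> bool" where
  "C3_scheme D g \<longleftrightarrow>
     cp_grid D 3 3 g \<and> left_of_line (g (1, 0)) (g (0, 0)) (g (0, 1)) \<and>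
     left_wing_terminates_on_boundary D (upper_left g) \<and>
     right_wing_terminates_on_boundary D (upper_right g)"

definition anchor :: "(nat \<times> nat \<Rightarrow> point) \<Rightarrow> point" where
  "anchor g = g (1, 1)"

definition interior_elements :: "diagram \<Rightarrow> (nat \<times> nat \<Rightarrow> point) \<Rightarrow> point set" where
  "interior_elements D g =
     insert (anchor g) (mid_elem ` (left_wing D (upper_left g) \<union> right_wing D (upper_right g)))"


section \<open>Resections\<close>

definition resect :: "diagram \<Rightarrow> (nat \<times> nat \<Rightarrow> point) \<Rightarrow> diagram" where
  "resect D g = D\<lparr>carrier := carrier D - (interior_elements D g - {anchor g})\<rparr>"

text \<open>
  The remaining elements keep their places in the plane. A deleted element may have been a bend of
  a path that is now a single edge, so straightening could create crossings in a badly drawn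
  diagram. Hence the drawing of \<open>D\<close> may first be replaced by a similar one for which the remaining
  points, with straight edges, form a planar Hasse diagram. (That the result is a lattice is not
  required.)
\<close>

definition resection_step :: "diagram \<Rightarrow> diagram \<Rightarrow> bool" where
  "resection_step D D' \<longleftrightarrow>
     (\<exists>E g. similar D E \<and> slim_semimodular_diagram E \<and> C3_scheme E g \<and>
        D' = resect E g \<and> planar_hasse_diagram D')"

definition obtained_by_resections :: "diagram \<Rightarrow> diagram \<Rightarrow> bool" where
  "obtained_by_resections D\<^sub>0 D \<longleftrightarrow> (\<exists>E. resection_step\<^sup>*\<^sup>* D\<^sub>0 E \<and> similar E D)"

end

theory Submission
  imports Defs
begin

text \<open>
  In a slim semimodular diagram the join-irreducible elements lie on the left and the right boundary
  chain, so an element is determined by the numbers of elements below it in the two chains. Meets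
  become componentwise minima, and the meet-irreducible elements become a finite set \<open>P\<close> of points
  with distinct abscissas, distinct ordinates and a greatest point; the diagram is the closure of \<open>P\<close>
  under minima. Conversely, drawing this closure by dominance, turned by 45 degrees, is planar. The
  lattice is distributive if no point of \<open>P\<close> has one point of \<open>P\<close> to its upper left and another to
  its lower right.

  The interior of a \<open>C\<^sub>3\<close>-scheme with anchor \<open>a\<close> consists of \<open>a\<close>, the row of \<open>a\<close> beyond \<open>a\<close>, the
  column of the point \<open>k\<close> of \<open>P\<close> in that row, the column of \<open>a\<close> above \<open>a\<close>, and the row of the point
  \<open>b\<close> of \<open>P\<close> in that column. The resection replaces \<open>k\<close> and \<open>b\<close> by the single point \<open>a\<close>, so the result
  is again of this form. Conversely, a point of \<open>P\<close> violating distributivity can be split into such a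
  pair \<open>k, b\<close>. If it is taken with least abscissa, the splitting decreases the sum, over all
  violating points, of the longest descending chain of \<open>P\<close> below and to the right of the point; so
  distributivity is reached.
\<close>

section \<open>The lattice of a set of plane points\<close>

text \<open>From the plane only a left-right order of incomparable elements and the two boundary
  chains are extracted: polygonal paths of a planar diagram can meet only at vertices or along
  common edges, so the intermediate value theorem yields common vertices and thereby
  comparabilities. Semimodularity enters the coordinatization at one place, where it forces distinct
  meet-irreducible elements to have distinct abscissas and distinct ordinates. Diagrams with the
  same set \<open>P\<close> are similar; hence resections can be realized in the drawing by
  dominance, where deleting elements and straightening edges never creates a crossing.

  Two obstacles shape the proof. A wing may reach the boundary without having turned at a point of
  \<open>P\<close>; that case must be excluded by planarity of the result, before the result is
  known to be a lattice. And splitting \<open>a\<close> may turn the new point \<open>k\<close> into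
  a violation of distributivity, so the number of violations need not drop; the weight works because
  \<open>k\<close> has smaller depth than \<open>a\<close>, while the least abscissa of
  \<open>a\<close> prevents \<open>b\<close> from being a violation and from entering the chains of
  other violating points.\<close>

definition pmin :: "point \<Rightarrow> point \<Rightarrow> point" where
  "pmin x y = (min (fst x) (fst y), min (snd x) (snd y))"

definition pinf :: "point set \<Rightarrow> point" where
  "pinf Q = (Min (fst ` Q), Min (snd ` Q))"

text \<open>
  For a set \<open>P\<close> as in \<open>perm_set\<close> below, this is the closure of \<open>P\<close> under componentwise minimum.
  The first coordinate is drawn growing to the upper left and the second one to the upper right:
  \<open>upl\<close> and \<open>upr\<close> give the left and the right upper cover, which coincide exactly on \<open>P\<close>.
\<close>

definition grid :: "point set \<Rightarrow> point set" where
  "grid P = {z. (\<exists>u\<in>P. fst u = fst z \<and> snd z \<le> snd u) \<and> (\<exists>v\<in>P. snd v = snd z \<and> fst z \<le> fst v)}"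

definition upl :: "point set \<Rightarrow> point \<Rightarrow> point" where
  "upl P z = pinf {u\<in>P. fst z < fst u \<and> snd z \<le> snd u}"

definition upr :: "point set \<Rightarrow> point \<Rightarrow> point" where
  "upr P z = pinf {u\<in>P. fst z \<le> fst u \<and> snd z < snd u}"

lemma le_point: "(x::point) \<le> y \<longleftrightarrow> fst x \<le> fst y \<and> snd x \<le> snd y"
  by (simp add: less_eq_prod_def)

lemma pmin_le [simp]: "pmin x y \<le> x" "pmin x y \<le> y"
  by (auto simp: pmin_def le_point)

lemma le_pmin [simp]: "z \<le> pmin x y \<longleftrightarrow> z \<le> x \<and> z \<le> y"
  by (auto simp: pmin_def le_point)

text \<open>The two minima are in general attained at different points, hence two witnesses.\<close>

lemma pinf_attained:
  assumes "finite Q" "Q \<noteq> {}"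
  obtains u v where "u \<in> Q" "v \<in> Q" "fst (pinf Q) = fst u" "snd (pinf Q) = snd v"
proof -
  have "Min (fst ` Q) \<in> fst ` Q" "Min (snd ` Q) \<in> snd ` Q" using assms by auto
  then show thesis using that by (auto simp: pinf_def)
qed

lemma pinf_le: "finite Q \<Longrightarrow> u \<in> Q \<Longrightarrow> pinf Q \<le> u"
  by (auto simp: pinf_def le_point)

text \<open>Distinct abscissas and ordinates make \<open>P\<close> the graph of a permutation after
  relabelling the coordinates. The greatest point \<open>T\<close> is the top of the lattice and
  keeps the sets in \<open>upl\<close> and \<open>upr\<close> nonempty at every other element of the
  grid.\<close>

locale perm_set =
  fixes P :: "point set" and T :: point
  assumes fin: "finite P" and inj_fst: "inj_on fst P" and inj_snd: "inj_on snd P"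
    and T_in: "T \<in> P" and T_ge: "u \<in> P \<Longrightarrow> u \<le> T"
begin

lemma eq_fst: "u \<in> P \<Longrightarrow> v \<in> P \<Longrightarrow> fst u = fst v \<Longrightarrow> u = v"
  using inj_fst by (auto dest: inj_onD)

lemma eq_snd: "u \<in> P \<Longrightarrow> v \<in> P \<Longrightarrow> snd u = snd v \<Longrightarrow> u = v"
  using inj_snd by (auto dest: inj_onD)

lemma P_grid: "u \<in> P \<Longrightarrow> u \<in> grid P"
  by (auto simp: grid_def)

lemma T_grid: "T \<in> grid P"
  using P_grid T_in by blast

lemma col_point:
  assumes "z \<in> grid P" obtains u where "u \<in> P" "fst u = fst z" "snd z \<le> snd u"
  using assms by (auto simp: grid_def)

lemma row_point:
  assumes "z \<in> grid P" obtains v where "v \<in> P" "snd v = snd z" "fst z \<le> fst v"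
  using assms by (auto simp: grid_def)

lemma grid_le_T: "z \<in> grid P \<Longrightarrow> z \<le> T"
  using T_ge by (force simp: grid_def le_point)

lemma grid_fst_T: assumes "z \<in> grid P" "z \<noteq> T" shows "fst z < fst T"
proof (rule ccontr)
  assume "\<not> ?thesis"
  then have e: "fst z = fst T" using grid_le_T[OF assms(1)] by (auto simp: le_point)
  obtain v where v: "v \<in> P" "snd v = snd z" "fst z \<le> fst v" using row_point[OF assms(1)] .
  then have "v = T" using e T_ge[OF v(1)] T_in by (intro eq_fst) (auto simp: le_point)
  then show False using v e assms(2) by (auto simp: prod_eq_iff)
qed

lemma grid_snd_T: assumes "z \<in> grid P" "z \<noteq> T" shows "snd z < snd T"
proof (rule ccontr)
  assume "\<not> ?thesis"
  then have e: "snd z = snd T" using grid_le_T[OF assms(1)] by (auto simp: le_point)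
  obtain v where v: "v \<in> P" "fst v = fst z" "snd z \<le> snd v" using col_point[OF assms(1)] .
  then have "v = T" using e T_ge[OF v(1)] T_in by (intro eq_snd) (auto simp: le_point)
  then show False using v e assms(2) by (auto simp: prod_eq_iff)
qed

lemma finite_grid: "finite (grid P)"
proof (rule finite_subset)
  show "grid P \<subseteq> fst ` P \<times> snd ` P"
  proof
    fix z assume "z \<in> grid P"
    then obtain u v where "u \<in> P" "v \<in> P" "fst u = fst z" "snd v = snd z"
      by (auto simp: grid_def)
    then show "z \<in> fst ` P \<times> snd ` P" by (metis SigmaI imageI prod.collapse)
  qed
qed (use fin in auto)

lemma grid_pmin: assumes "x \<in> grid P" "y \<in> grid P" shows "pmin x y \<in> grid P"
proof -
  obtain a where a: "a \<in> P" "fst a = fst x" "snd x \<le> snd a" using col_point[OF assms(1)] .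
  obtain b where b: "b \<in> P" "fst b = fst y" "snd y \<le> snd b" using col_point[OF assms(2)] .
  obtain c where c: "c \<in> P" "snd c = snd x" "fst x \<le> fst c" using row_point[OF assms(1)] .
  obtain d where d: "d \<in> P" "snd d = snd y" "fst y \<le> fst d" using row_point[OF assms(2)] .
  show ?thesis
    unfolding grid_def pmin_def mem_Collect_eq fst_conv snd_conv
  proof
    show "\<exists>u\<in>P. fst u = min (fst x) (fst y) \<and> min (snd x) (snd y) \<le> snd u"
      using a b by (cases "fst x \<le> fst y") (force intro: bexI[of _ a], force intro: bexI[of _ b])
    show "\<exists>v\<in>P. snd v = min (snd x) (snd y) \<and> min (fst x) (fst y) \<le> fst v"
      using c d by (cases "snd x \<le> snd y") (force intro: bexI[of _ c], force intro: bexI[of _ d])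
  qed
qed

lemma pinf_grid:
  assumes "Q \<subseteq> P" "Q \<noteq> {}" shows "pinf Q \<in> grid P"
proof -
  have f: "finite Q" using assms fin finite_subset by blast
  obtain u v where uv: "u \<in> Q" "v \<in> Q" "fst (pinf Q) = fst u" "snd (pinf Q) = snd v"
    using pinf_attained[OF f assms(2)] .
  then have "pinf Q \<le> u" "pinf Q \<le> v" using pinf_le f by auto
  then show ?thesis using uv assms(1) unfolding grid_def le_point by auto
qed

text \<open>A grid element takes its abscissa from one point of \<open>P\<close> and its ordinate
  from another, both above it; these two points in \<open>Q\<close> already force the
  inequality.\<close>

lemma le_pinf_grid:
  assumes w: "w \<in> grid P" and Q: "Q \<subseteq> P" "\<And>u. u \<in> P \<Longrightarrow> w \<le> u \<Longrightarrow> u \<in> Q"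
  shows "pinf Q \<le> w"
proof -
  have f: "finite Q" using Q fin finite_subset by blast
  obtain u where u: "u \<in> P" "fst u = fst w" "snd w \<le> snd u" using col_point[OF w] .
  obtain v where v: "v \<in> P" "snd v = snd w" "fst w \<le> fst v" using row_point[OF w] .
  have "pinf Q \<le> u" "pinf Q \<le> v" using u v by (intro pinf_le f Q(2); simp add: le_point)+
  then show ?thesis using u v by (auto simp: le_point)
qed

text \<open>A grid element is the infimum of the points of \<open>P\<close> above it, so a join is
  the infimum of the common upper points. In general it is not the componentwise maximum.\<close>

definition pjoin :: "point \<Rightarrow> point \<Rightarrow> point" where
  "pjoin x y = pinf {u\<in>P. x \<le> u \<and> y \<le> u}"

lemma pjoin_grid: "x \<in> grid P \<Longrightarrow> y \<in> grid P \<Longrightarrow> pjoin x y \<in> grid P"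
  unfolding pjoin_def by (intro pinf_grid) (use T_in grid_le_T in blast)+

lemma pjoin_ge:
  assumes "x \<in> grid P" "y \<in> grid P" shows "x \<le> pjoin x y" "y \<le> pjoin x y"
proof -
  let ?Q = "{u\<in>P. x \<le> u \<and> y \<le> u}"
  have "finite ?Q" "?Q \<noteq> {}" using fin T_in grid_le_T assms by (simp, blast)
  then obtain u v where "u \<in> ?Q" "v \<in> ?Q" "fst (pinf ?Q) = fst u" "snd (pinf ?Q) = snd v"
    by (rule pinf_attained)
  then show "x \<le> pjoin x y" "y \<le> pjoin x y" by (auto simp: pjoin_def le_point)
qed

lemma pjoin_least: "w \<in> grid P \<Longrightarrow> x \<le> w \<Longrightarrow> y \<le> w \<Longrightarrow> pjoin x y \<le> w"
  unfolding pjoin_def by (rule le_pinf_grid) auto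

lemma pjoin_le_iff:
  "x \<in> grid P \<Longrightarrow> y \<in> grid P \<Longrightarrow> w \<in> grid P \<Longrightarrow> pjoin x y \<le> w \<longleftrightarrow> x \<le> w \<and> y \<le> w"
  using pjoin_ge pjoin_least order_trans by meson

lemma upl_nonempty:
  "z \<in> grid P \<Longrightarrow> z \<noteq> T \<Longrightarrow> {u\<in>P. fst z < fst u \<and> snd z \<le> snd u} \<noteq> {}"
  using T_in grid_fst_T grid_snd_T by fastforce

lemma upr_nonempty:
  "z \<in> grid P \<Longrightarrow> z \<noteq> T \<Longrightarrow> {u\<in>P. fst z \<le> fst u \<and> snd z < snd u} \<noteq> {}"
  using T_in grid_fst_T grid_snd_T by fastforce

lemma upl_grid: "z \<in> grid P \<Longrightarrow> z \<noteq> T \<Longrightarrow> upl P z \<in> grid P"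
  unfolding upl_def by (rule pinf_grid) (use upl_nonempty in auto)

lemma upr_grid: "z \<in> grid P \<Longrightarrow> z \<noteq> T \<Longrightarrow> upr P z \<in> grid P"
  unfolding upr_def by (rule pinf_grid) (use upr_nonempty in auto)

lemma upl_gt:
  assumes "z \<in> grid P" "z \<noteq> T" shows "fst z < fst (upl P z)" "snd z \<le> snd (upl P z)"
proof -
  have "finite {u\<in>P. fst z < fst u \<and> snd z \<le> snd u}" using fin by auto
  from pinf_attained[OF this upl_nonempty[OF assms]]
  show "fst z < fst (upl P z)" "snd z \<le> snd (upl P z)" unfolding upl_def by (smt (verit) mem_Collect_eq)+
qed

lemma upr_gt:
  assumes "z \<in> grid P" "z \<noteq> T" shows "fst z \<le> fst (upr P z)" "snd z < snd (upr P z)"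
proof -
  have "finite {u\<in>P. fst z \<le> fst u \<and> snd z < snd u}" using fin by auto
  from pinf_attained[OF this upr_nonempty[OF assms]]
  show "fst z \<le> fst (upr P z)" "snd z < snd (upr P z)" unfolding upr_def by (smt (verit) mem_Collect_eq)+
qed

lemma upl_least: "w \<in> grid P \<Longrightarrow> fst z < fst w \<Longrightarrow> snd z \<le> snd w \<Longrightarrow> upl P z \<le> w"
  unfolding upl_def by (rule le_pinf_grid) (auto simp: le_point)

lemma upr_least: "w \<in> grid P \<Longrightarrow> fst z \<le> fst w \<Longrightarrow> snd z < snd w \<Longrightarrow> upr P z \<le> w"
  unfolding upr_def by (rule le_pinf_grid) (auto simp: le_point)

text \<open>A point of \<open>P\<close> shares neither row nor column with another point of
  \<open>P\<close>, so the strict and the weak inequality may be interchanged in the two defining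
  sets.\<close>

lemma upl_upr_P:
  assumes "z \<in> P" shows "upl P z = upr P z"
proof -
  have "{u\<in>P. fst z < fst u \<and> snd z \<le> snd u} = {u\<in>P. fst z \<le> fst u \<and> snd z < snd u}"
    using eq_fst[OF assms] eq_snd[OF assms] by (auto simp: less_le)
  then show ?thesis by (simp add: upl_def upr_def)
qed

lemma notP_T: "z \<notin> P \<Longrightarrow> z \<noteq> T" using T_in by auto

text \<open>Off \<open>P\<close>, the point of \<open>P\<close> in the row of \<open>z\<close> lies
  strictly beyond \<open>z\<close>; it bounds the left cover, which therefore cannot leave the
  row.\<close>

lemma snd_upl: assumes "z \<in> grid P" "z \<notin> P" shows "snd (upl P z) = snd z"
proof -
  obtain v where v: "v \<in> P" "snd v = snd z" "fst z \<le> fst v" using row_point[OF assms(1)] .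
  have "v \<noteq> z" using v assms by auto
  then have "fst z < fst v" using v by (auto simp: prod_eq_iff less_le)
  then have "upl P z \<le> v" using v by (intro upl_least P_grid) auto
  then show ?thesis using upl_gt(2)[OF assms(1) notP_T[OF assms(2)]] v by (auto simp: le_point)
qed

lemma fst_upr: assumes "z \<in> grid P" "z \<notin> P" shows "fst (upr P z) = fst z"
proof -
  obtain v where v: "v \<in> P" "fst v = fst z" "snd z \<le> snd v" using col_point[OF assms(1)] .
  have "v \<noteq> z" using v assms by auto
  then have "snd z < snd v" using v by (auto simp: prod_eq_iff less_le)
  then have "upr P z \<le> v" using v by (intro upr_least P_grid) auto
  then show ?thesis using upr_gt(1)[OF assms(1) notP_T[OF assms(2)]] v by (auto simp: le_point)
qed

lemma upl_neq_upr: "z \<in> grid P \<Longrightarrow> z \<notin> P \<Longrightarrow> upl P z \<noteq> upr P z"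
  using fst_upr upl_gt(1) notP_T by fastforce

lemma above_cases:
  assumes "z \<in> grid P" "w \<in> grid P" "z \<le> w" "z \<noteq> w"
  shows "upl P z \<le> w \<or> upr P z \<le> w"
proof (cases "fst z < fst w")
  case True then show ?thesis using assms upl_least by (auto simp: le_point)
next
  case False
  then have "snd z < snd w" using assms by (auto simp: le_point prod_eq_iff)
  then show ?thesis using assms upr_least by (auto simp: le_point)
qed

lemma upr_not_T: "z \<in> grid P \<Longrightarrow> z \<notin> P \<Longrightarrow> upr P z \<noteq> T"
  using fst_upr grid_fst_T notP_T by fastforce

lemma upl_not_T: "z \<in> grid P \<Longrightarrow> z \<notin> P \<Longrightarrow> upl P z \<noteq> T"
  using snd_upl grid_snd_T notP_T by fastforce

text \<open>Both sides are the least grid element that exceeds \<open>z\<close> strictly in both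
  coordinates. This closes the cell whose bottom is \<open>z\<close>.\<close>

lemma upl_upr_commute:
  assumes "z \<in> grid P" "z \<notin> P" shows "upl P (upr P z) = upr P (upl P z)"
proof (rule antisym)
  note T = notP_T[OF assms(2)]
  note r = upr_grid[OF assms(1) T] upr_gt[OF assms(1) T] fst_upr[OF assms] upr_not_T[OF assms]
  note l = upl_grid[OF assms(1) T] upl_gt[OF assms(1) T] snd_upl[OF assms] upl_not_T[OF assms]
  note rl = upr_grid[OF l(1,5)] upr_gt[OF l(1,5)]
  note lr = upl_grid[OF r(1,5)] upl_gt[OF r(1,5)]
  have "upr P z \<le> upr P (upl P z)" using l rl by (intro upr_least) auto
  then show "upl P (upr P z) \<le> upr P (upl P z)"
    using rl l r by (intro upl_least) (auto simp: le_point)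
  have "upl P z \<le> upl P (upr P z)" using r lr by (intro upl_least) auto
  then show "upr P (upl P z) \<le> upl P (upr P z)"
    using lr l r by (intro upr_least) (auto simp: le_point)
qed

section \<open>Coverings and semimodularity of the grid\<close>

definition cov :: "point \<Rightarrow> point \<Rightarrow> bool" where
  "cov z w \<longleftrightarrow> z \<in> grid P \<and> w \<in> grid P \<and> z \<le> w \<and> z \<noteq> w \<and>
     (\<forall>x\<in>grid P. z \<le> x \<and> x \<le> w \<longrightarrow> x = z \<or> x = w)"

lemma cov_upl: assumes "z \<in> grid P" "z \<noteq> T" shows "cov z (upl P z)"
  unfolding cov_def
proof (intro conjI ballI impI)
  show "z \<in> grid P" "upl P z \<in> grid P" using assms upl_grid by auto
  show "z \<le> upl P z" using upl_gt[OF assms] by (auto simp: le_point)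
  show "z \<noteq> upl P z" using upl_gt[OF assms] by auto
  fix x assume x: "x \<in> grid P" "z \<le> x \<and> x \<le> upl P z"
  show "x = z \<or> x = upl P z"
  proof (rule ccontr)
    assume n: "\<not> ?thesis"
    from above_cases[OF assms(1) x(1)] x n have a: "upl P z \<le> x \<or> upr P z \<le> x" by auto
    show False
    proof (cases "fst z < fst x")
      case True then show False using n x upl_least[OF x(1) True] by (auto simp: le_point prod_eq_iff)
    next
      case False
      \<comment> \<open>An element in the column of \<open>z\<close> below the left cover forces the
        left cover out of the row of \<open>z\<close>. This happens only on \<open>P\<close>, where
        the two covers coincide.\<close>
      then have "snd z < snd x" using x n by (auto simp: le_point prod_eq_iff)
      then have "snd z < snd (upl P z)" using x by (auto simp: le_point)
      then have "z \<in> P" using snd_upl assms by fastforce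
      then have "upr P z = upl P z" using upl_upr_P by simp
      then show False using a n x by auto
    qed
  qed
qed

lemma cov_upr: assumes "z \<in> grid P" "z \<noteq> T" shows "cov z (upr P z)"
  unfolding cov_def
proof (intro conjI ballI impI)
  show "z \<in> grid P" "upr P z \<in> grid P" using assms upr_grid by auto
  show "z \<le> upr P z" using upr_gt[OF assms] by (auto simp: le_point)
  show "z \<noteq> upr P z" using upr_gt[OF assms] by auto
  fix x assume x: "x \<in> grid P" "z \<le> x \<and> x \<le> upr P z"
  show "x = z \<or> x = upr P z"
  proof (rule ccontr)
    assume n: "\<not> ?thesis"
    from above_cases[OF assms(1) x(1)] x n have a: "upl P z \<le> x \<or> upr P z \<le> x" by auto
    show False
    proof (cases "snd z < snd x")
      case True then show False using n x upr_least[OF x(1) _ True] by (auto simp: le_point prod_eq_iff)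
    next
      case False
      then have "fst z < fst x" using x n by (auto simp: le_point prod_eq_iff)
      then have "fst z < fst (upr P z)" using x by (auto simp: le_point)
      then have "z \<in> P" using fst_upr assms by fastforce
      then have "upr P z = upl P z" using upl_upr_P by simp
      then show False using a n x by auto
    qed
  qed
qed

lemma cov_iff: "cov z w \<longleftrightarrow> z \<in> grid P \<and> z \<noteq> T \<and> (w = upl P z \<or> w = upr P z)"
proof
  assume c: "cov z w"
  then have g: "z \<in> grid P" "w \<in> grid P" "z \<le> w" "z \<noteq> w" by (auto simp: cov_def)
  then have T: "z \<noteq> T" using grid_le_T[OF g(2)] by auto
  from above_cases[OF g] have "w = upl P z \<or> w = upr P z"
    using c upl_grid[OF g(1) T] upr_grid[OF g(1) T] upl_gt[OF g(1) T] upr_gt[OF g(1) T]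
    unfolding cov_def le_point by (metis less_irrefl less_imp_le)
  then show "z \<in> grid P \<and> z \<noteq> T \<and> (w = upl P z \<or> w = upr P z)" using g T by auto
qed (use cov_upl cov_upr in blast)

text \<open>If \<open>b\<close> is the left cover of \<open>a\<close> and not below
  \<open>pjoin a c\<close>, then this join cannot have left the column of \<open>a\<close>, and its
  own left cover is the join of \<open>b\<close> and \<open>c\<close>. The right cover is treated
  with rows instead of columns.\<close>

lemma semimodular_grid:
  assumes "cov a b" "c \<in> grid P"
  shows "cov (pjoin a c) (pjoin b c) \<or> pjoin a c = pjoin b c"
proof -
  have ab: "a \<in> grid P" "b \<in> grid P" "a \<le> b" "a \<noteq> T" using assms(1) cov_iff unfolding cov_def by blast+
  let ?w = "pjoin a c"
  have w: "?w \<in> grid P" "a \<le> ?w" "c \<le> ?w" using pjoin_grid pjoin_ge ab assms by auto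
  have le: "?w \<le> pjoin b c" using ab assms pjoin_ge[of b c] by (intro pjoin_least pjoin_grid) auto
  have wg: "pjoin b c \<in> grid P" using ab assms pjoin_grid by auto
  show ?thesis
  proof (cases "b \<le> ?w")
    case True
    then have "pjoin b c \<le> ?w" using w by (intro pjoin_least) auto
    then show ?thesis using le by auto
  next
    case False
    have wT: "?w \<noteq> T" using False grid_le_T[OF ab(2)] by auto
    from assms(1) cov_iff consider "b = upl P a" | "b = upr P a" by auto
    then show ?thesis
    proof cases
      case 1
      have f: "fst ?w = fst a"
      proof (rule ccontr)
        assume "fst ?w \<noteq> fst a" then have "upl P a \<le> ?w" using w by (intro upl_least) (auto simp: le_point)
        then show False using False 1 by auto
      qed
      have "pjoin b c = upl P ?w"
      proof (rule antisym)
        have "b \<le> upl P ?w" unfolding 1 using upl_gt[OF w(1) wT] upl_grid[OF w(1) wT] f w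
          by (intro upl_least) (auto simp: le_point)
        moreover have "c \<le> upl P ?w" using upl_gt[OF w(1) wT] w by (auto simp: le_point)
        ultimately show "pjoin b c \<le> upl P ?w" using upl_grid[OF w(1) wT] by (intro pjoin_least)
        show "upl P ?w \<le> pjoin b c"
          using wg le f pjoin_ge[OF ab(2) assms(2)] upl_gt[OF ab(1,4)] 1
          by (intro upl_least) (auto simp: le_point)
      qed
      then show ?thesis using cov_upl[OF w(1) wT] by auto
    next
      case 2
      have f: "snd ?w = snd a"
      proof (rule ccontr)
        assume "snd ?w \<noteq> snd a" then have "upr P a \<le> ?w" using w by (intro upr_least) (auto simp: le_point)
        then show False using False 2 by auto
      qed
      have "pjoin b c = upr P ?w"
      proof (rule antisym)
        have "b \<le> upr P ?w" unfolding 2 using upr_gt[OF w(1) wT] upr_grid[OF w(1) wT] f w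
          by (intro upr_least) (auto simp: le_point)
        moreover have "c \<le> upr P ?w" using upr_gt[OF w(1) wT] w by (auto simp: le_point)
        ultimately show "pjoin b c \<le> upr P ?w" using upr_grid[OF w(1) wT] by (intro pjoin_least)
        show "upr P ?w \<le> pjoin b c"
          using wg le f pjoin_ge[OF ab(2) assms(2)] upr_gt[OF ab(1,4)] 2
          by (intro upr_least) (auto simp: le_point)
      qed
      then show ?thesis using cov_upr[OF w(1) wT] by auto
    qed
  qed
qed

end


section \<open>Wings and trajectories in coordinates\<close>

lemma pinf_swap: "pinf (prod.swap ` Q) = prod.swap (pinf Q)"
  by (simp add: pinf_def image_image)

text \<open>Exchanging the coordinates reflects the drawing and exchanges left with right covers;
  results on left wings are carried over to right wings in this way.\<close>

lemma upl_swap: "upl (prod.swap ` P) (prod.swap z) = prod.swap (upr P z)"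
proof -
  have "{u \<in> prod.swap ` P. fst (prod.swap z) < fst u \<and> snd (prod.swap z) \<le> snd u} =
    prod.swap ` {u \<in> P. fst z \<le> fst u \<and> snd z < snd u}" by auto
  then show ?thesis by (simp only: upl_def upr_def pinf_swap)
qed

lemma upr_swap: "upr (prod.swap ` P) (prod.swap z) = prod.swap (upl P z)"
proof -
  have "{u \<in> prod.swap ` P. fst (prod.swap z) \<le> fst u \<and> snd (prod.swap z) < snd u} =
    prod.swap ` {u \<in> P. fst z < fst u \<and> snd z \<le> snd u}" by auto
  then show ?thesis by (simp only: upl_def upr_def pinf_swap)
qed

lemma eq_swap_image: "(\<And>z. z \<in> A \<longleftrightarrow> prod.swap z \<in> B) \<Longrightarrow> A = prod.swap ` B"
  by (force simp: image_iff)

lemma grid_swap: "grid (prod.swap ` P) = prod.swap ` grid P"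
proof -
  have "z \<in> grid (prod.swap ` P) \<longleftrightarrow> prod.swap z \<in> grid P" for z
    by (auto simp: grid_def)
  then show ?thesis by (rule eq_swap_image)
qed

lemma swap_in_iff [simp]: "prod.swap z \<in> prod.swap ` A \<longleftrightarrow> z \<in> A"
  by (metis image_iff swap_swap)

lemma perm_set_swap: "perm_set P T \<Longrightarrow> perm_set (prod.swap ` P) (prod.swap T)"
  unfolding perm_set_def by (auto simp: inj_on_def le_point)

text \<open>The two elements required to be off \<open>P\<close> are the bottoms of the two cells
  between the chains, so both cells are proper. The first disjunct goes left and up, the second left
  and down.\<close>

definition next_l :: "point set \<Rightarrow> triple \<Rightarrow> triple \<Rightarrow> bool" where
  "next_l P X A \<longleftrightarrow>
     (\<exists>b\<in>grid P - P. upr P b \<notin> P \<and> A = (b, upr P b, upr P (upr P b)) \<and>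
        X = (upl P b, upl P (upr P b), upl P (upr P (upr P b)))) \<or>
     (\<exists>c\<in>grid P - P. upl P c \<notin> P \<and> X = (c, upl P c, upl P (upl P c)) \<and>
        A = (upr P c, upr P (upl P c), upr P (upl P (upl P c))))"

definition swap3 :: "triple \<Rightarrow> triple" where
  "swap3 A = (prod.swap (bot_elem A), prod.swap (mid_elem A), prod.swap (top_elem A))"

lemma swap3_swap3 [simp]: "swap3 (swap3 A) = A"
  by (simp add: swap3_def bot_elem_def mid_elem_def top_elem_def)

lemma next_l_swap_imp:
  assumes "next_l P X A" shows "next_l (prod.swap ` P) (swap3 A) (swap3 X)"
proof -
  note [simp] = swap3_def bot_elem_def mid_elem_def top_elem_def upl_swap upr_swap
  from assms[unfolded next_l_def] consider
    b where "b \<in> grid P - P" "upr P b \<notin> P" "A = (b, upr P b, upr P (upr P b))"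
      "X = (upl P b, upl P (upr P b), upl P (upr P (upr P b)))" |
    c where "c \<in> grid P - P" "upl P c \<notin> P" "X = (c, upl P c, upl P (upl P c))"
      "A = (upr P c, upr P (upl P c), upr P (upl P (upl P c)))" by blast
  then show ?thesis
  proof cases
    case 1
    show ?thesis unfolding next_l_def
      by (rule disjI2, rule bexI[of _ "prod.swap b"]) (use 1 in \<open>auto simp: grid_swap\<close>)
  next
    case 2
    show ?thesis unfolding next_l_def
      by (rule disjI1, rule bexI[of _ "prod.swap c"]) (use 2 in \<open>auto simp: grid_swap\<close>)
  qed
qed

lemma next_l_swap_rtranclp_imp:
  assumes "(next_l P)\<^sup>*\<^sup>* X A" shows "(next_l (prod.swap ` P))\<^sup>*\<^sup>* (swap3 A) (swap3 X)"
  using assms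
proof induction
  case (step y z)
  then show ?case using next_l_swap_imp[OF step(2)] by (meson converse_rtranclp_into_rtranclp)
qed auto

lemma next_l_swap_rtranclp:
  "(next_l (prod.swap ` P))\<^sup>*\<^sup>* (swap3 A) (swap3 X) \<longleftrightarrow> (next_l P)\<^sup>*\<^sup>* X A"
proof
  assume "(next_l (prod.swap ` P))\<^sup>*\<^sup>* (swap3 A) (swap3 X)"
  from next_l_swap_rtranclp_imp[OF this] show "(next_l P)\<^sup>*\<^sup>* X A" by (simp add: image_image)
qed (rule next_l_swap_rtranclp_imp)

text \<open>A larger first and a smaller second coordinate mean a position to the left in the
  drawing, so this describes the left boundary chain without reference to the plane.\<close>

definition on_left :: "point set \<Rightarrow> point \<Rightarrow> bool" where
  "on_left P x \<longleftrightarrow> \<not> (\<exists>z\<in>grid P. fst x < fst z \<and> snd z < snd x)"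

definition on_right :: "point set \<Rightarrow> point \<Rightarrow> bool" where
  "on_right P x \<longleftrightarrow> \<not> (\<exists>z\<in>grid P. fst z < fst x \<and> snd x < snd z)"

lemma on_left_swap: "on_left (prod.swap ` P) (prod.swap x) \<longleftrightarrow> on_right P x"
  by (auto simp: on_left_def on_right_def grid_swap)

lemma on_right_swap: "on_right (prod.swap ` P) (prod.swap x) \<longleftrightarrow> on_left P x"
  by (auto simp: on_left_def on_right_def grid_swap)

text \<open>
  The middle elements of the left (right) wing of a scheme with anchor \<open>a\<close>: the wing climbs along
  the row (column) of \<open>a\<close> until it meets \<open>P\<close>, and then descends along the column (row) of that point.
\<close>

definition left_mids :: "point set \<Rightarrow> point \<Rightarrow> point set" where
  "left_mids P a = {z\<in>grid P. (snd z = snd a \<and> fst a < fst z) \<or> (\<exists>u\<in>P. snd u = snd a \<and> fst z = fst u)}"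

definition right_mids :: "point set \<Rightarrow> point \<Rightarrow> point set" where
  "right_mids P a = {z\<in>grid P. (fst z = fst a \<and> snd a < snd z) \<or> (\<exists>u\<in>P. fst u = fst a \<and> snd z = snd u)}"

lemma left_mids_swap: "left_mids (prod.swap ` P) (prod.swap a) = prod.swap ` right_mids P a"
proof -
  have "z \<in> left_mids (prod.swap ` P) (prod.swap a) \<longleftrightarrow> prod.swap z \<in> right_mids P a" for z
    using swap_in_iff[of "prod.swap z" "grid P"]
    by (auto simp: left_mids_def right_mids_def grid_swap)
  then show ?thesis by (rule eq_swap_image)
qed

text \<open>Here \<open>e\<close> is the element with index \<open>(1, 0)\<close> of the scheme, its
  right cover is the anchor, and \<open>k\<close> is the point of \<open>P\<close> that ends the row
  of the anchor. The chain \<open>start\<close> will be the upper left side of the scheme.\<close>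

locale left_scheme = perm_set +
  fixes e k :: point
  assumes e_grid: "e \<in> grid P" and e_P: "e \<notin> P" and a_P: "upr P e \<notin> P"
    and k_P: "k \<in> P" and k_row: "snd k = snd (upr P e)"
begin

abbreviation a :: point where "a \<equiv> upr P e"

definition start :: triple where "start = (upl P e, upl P a, upr P (upl P a))"

definition wing :: "triple set" where "wing = {X. (next_l P)\<^sup>*\<^sup>* X start}"

lemma a_grid: "a \<in> grid P" using e_grid e_P notP_T upr_grid by auto

lemma row_le: "z \<in> grid P \<Longrightarrow> snd z = snd a \<Longrightarrow> fst z \<le> fst k"
  using row_point[of z] eq_snd k_P k_row by metis

lemma col_le: "z \<in> grid P \<Longrightarrow> fst z = fst k \<Longrightarrow> snd z \<le> snd a"
  using col_point[of z] eq_fst k_P k_row by metis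

lemma left_mids_eq: "left_mids P a = {z\<in>grid P. (snd z = snd a \<and> fst a < fst z) \<or> fst z = fst k}"
proof -
  have "(\<exists>u\<in>P. snd u = snd a \<and> fst z = fst u) \<longleftrightarrow> fst z = fst k" for z :: point
    using k_P k_row eq_snd by metis
  then show ?thesis unfolding left_mids_def by simp
qed

text \<open>The last conjunct is the invariant that no element of the row between the anchor and the
  current middle has been skipped. The witness \<open>d\<close> remembers the bottom of a cell just
  crossed; it is needed when a wing stops before the column of \<open>k\<close>.\<close>

definition climbing :: "point \<Rightarrow> triple \<Rightarrow> bool" where
  "climbing b X \<longleftrightarrow> b \<in> grid P \<and> b \<noteq> T \<and> upr P b \<noteq> T \<and> X = (b, upr P b, upr P (upr P b)) \<and>
     (\<exists>d\<in>grid P - P. upr P d \<notin> P \<and> b = upl P d) \<and>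
     snd (upr P b) = snd a \<and> fst a < fst (upr P b) \<and>
     (\<forall>z\<in>grid P. snd z = snd a \<and> fst a < fst z \<and> fst z \<le> fst (upr P b) \<longrightarrow> z \<in> mid_elem ` wing)"

text \<open>Here the row is already exhausted, and the last conjunct says that the column of
  \<open>k\<close> is exhausted down to the current middle.\<close>

definition descending :: "point \<Rightarrow> triple \<Rightarrow> bool" where
  "descending c X \<longleftrightarrow> c \<in> grid P \<and> c \<notin> P \<and> upl P c \<notin> P \<and> X = (c, upl P c, upl P (upl P c)) \<and>
     fst (upl P c) = fst k \<and>
     (\<forall>z\<in>grid P. snd z = snd a \<and> fst a < fst z \<longrightarrow> z \<in> mid_elem ` wing) \<and>
     (\<forall>z\<in>grid P. fst z = fst k \<and> snd (upl P c) \<le> snd z \<longrightarrow> z \<in> mid_elem ` wing)"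

lemma start_climbing: "climbing (upl P e) start"
proof -
  have eT: "e \<noteq> T" and aT: "a \<noteq> T" using e_P a_P T_in by auto
  have ue: "upl P e \<in> grid P" "upl P e \<noteq> T" using e_grid e_P eT upl_grid upl_not_T by auto
  have m: "upr P (upl P e) = upl P a" using upl_upr_commute[OF e_grid e_P] by simp
  have mid: "upl P a \<in> mid_elem ` wing"
    by (rule image_eqI[of _ _ start]) (auto simp: start_def mid_elem_def wing_def)
  have "z = upl P a" if z: "z \<in> grid P" "snd z = snd a" "fst a < fst z" "fst z \<le> fst (upl P a)" for z
    using upl_least[of z a] z by (auto simp: le_point prod_eq_iff snd_upl[OF a_grid a_P])
  then have cv: "\<forall>z\<in>grid P. snd z = snd a \<and> fst a < fst z \<and> fst z \<le> fst (upl P a) \<longrightarrow> z \<in> mid_elem ` wing"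
    using mid by metis
  show ?thesis
    unfolding climbing_def m
    using cv ue e_grid e_P eT aT a_grid a_P upl_not_T[OF a_grid a_P] snd_upl[OF a_grid a_P] upl_gt[OF a_grid aT]
    by (auto simp: start_def)
qed

lemma wing_step:
  assumes Y: "next_l P Y X" "X \<in> wing" and X: "climbing b X \<or> descending c X"
  shows "(\<exists>b. climbing b Y) \<or> (\<exists>c. descending c Y)"
proof -
  have Yw: "mid_elem Y \<in> mid_elem ` wing"
    using Y unfolding wing_def by (auto intro: converse_rtranclp_into_rtranclp)
  from Y(1)[unfolded next_l_def] consider
    (up) d where "d \<in> grid P" "d \<notin> P" "upr P d \<notin> P" "X = (d, upr P d, upr P (upr P d))"
      "Y = (upl P d, upl P (upr P d), upl P (upr P (upr P d)))" |
    (down) d where "d \<in> grid P" "d \<notin> P" "upl P d \<notin> P" "Y = (d, upl P d, upl P (upl P d))"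
      "X = (upr P d, upr P (upl P d), upr P (upl P (upl P d)))" by blast
  then show ?thesis
  proof cases
    case up
    let ?m = "upr P d"
    have dT: "d \<noteq> T" and mT: "?m \<noteq> T" using up T_in by auto
    have mg: "?m \<in> grid P" using upr_grid up dT by auto
    \<comment> \<open>A descending chain starts with a left cover off \<open>P\<close>, where the
      two covers differ, so a wing that goes down never climbs again.\<close>
    have "\<not> descending c X" using up(2,4) upl_neq_upr[OF up(1,2)] by (auto simp: descending_def)
    with X have c: "climbing d X" using up(4) by (auto simp: climbing_def)
    have m': "upr P (upl P d) = upl P ?m" "upr P (upl P ?m) = upl P (upr P ?m)"
      using upl_upr_commute[OF up(1,2)] upl_upr_commute[OF mg up(3)] by auto
    have s: "snd (upl P ?m) = snd a" using snd_upl[OF mg up(3)] c by (auto simp: climbing_def)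
    have f: "fst a < fst (upl P ?m)" using upl_gt[OF mg mT] c by (auto simp: climbing_def)
    have cv: "z \<in> mid_elem ` wing"
      if z: "z \<in> grid P" "snd z = snd a" "fst a < fst z" "fst z \<le> fst (upl P ?m)" for z
    proof (cases "fst z \<le> fst ?m")
      case True then show ?thesis using c z by (auto simp: climbing_def)
    next
      case False
      then have "upl P ?m \<le> z" using c z by (intro upl_least) (auto simp: climbing_def)
      then have "z = mid_elem Y" using z s up(5) by (auto simp: mid_elem_def le_point prod_eq_iff)
      then show ?thesis using Yw by simp
    qed
    have "climbing (upl P d) Y"
      unfolding climbing_def m' using s f cv up(1-3,5) upl_grid[OF up(1) dT] upl_not_T[OF up(1,2)]
        upl_not_T[OF mg up(3)] by auto
    then show ?thesis by blast
  next
    case down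
    have dT: "d \<noteq> T" and uT: "upl P d \<noteq> T" using down T_in by auto
    have ug: "upl P d \<in> grid P" using upl_grid down dT by auto
    let ?m = "upr P (upl P d)"
    have mg: "?m \<in> grid P" using upr_grid[OF ug uT] .
    have fm: "fst ?m = fst (upl P d)" using fst_upr[OF ug down(3)] .
    have t: "upr P (upl P (upl P d)) = upl P ?m" using upl_upr_commute[OF ug down(3)] by simp
    have cov: "fst ?m = fst k \<and>
       (\<forall>z\<in>grid P. snd z = snd a \<and> fst a < fst z \<longrightarrow> z \<in> mid_elem ` wing) \<and>
       (\<forall>z\<in>grid P. fst z = fst k \<and> snd ?m \<le> snd z \<longrightarrow> z \<in> mid_elem ` wing)"
    proof (cases "\<exists>b. climbing b X")
      case True
      then have c: "?m \<noteq> T" "upr P (upl P (upl P d)) = upr P ?m" "snd ?m = snd a" "fst a < fst ?m"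
        "\<And>z. z\<in>grid P \<Longrightarrow> snd z = snd a \<Longrightarrow> fst a < fst z \<Longrightarrow> fst z \<le> fst ?m \<Longrightarrow> z \<in> mid_elem ` wing"
        using down(5) by (auto simp: climbing_def)
      have "?m \<in> P" using upl_neq_upr[OF mg] t c(2) by auto
      then have "?m = k" using eq_snd[OF _ k_P] c(3) k_row by auto
      then show ?thesis using c(3-5) row_le col_le k_row
        by (metis (no_types, lifting) dual_order.antisym)
    next
      case False
      with X have "descending c X" by blast
      then show ?thesis using down(5) by (auto simp: descending_def)
    qed
    have "z \<in> mid_elem ` wing" if z: "z \<in> grid P" "fst z = fst k" "snd (upl P d) \<le> snd z" for z
    proof (cases "snd z = snd (upl P d)")
      case True
      then have "z = mid_elem Y" using z cov fm down(4) by (auto simp: mid_elem_def prod_eq_iff)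
      then show ?thesis using Yw by simp
    next
      case False
      then have "?m \<le> z" using z cov fm by (intro upr_least) auto
      then show ?thesis using cov z by (auto simp: le_point)
    qed
    then have "descending d Y" unfolding descending_def using down cov fm by auto
    then show ?thesis by blast
  qed
qed

lemma wing_cases:
  assumes "X \<in> wing"
  shows "(\<exists>b. climbing b X) \<or> (\<exists>c. descending c X)"
proof -
  have "(next_l P)\<^sup>*\<^sup>* X start" using assms by (simp add: wing_def)
  then show ?thesis
  proof (induction rule: converse_rtranclp_induct)
    case base then show ?case using start_climbing by blast
  next
    case (step y z)
    then have "z \<in> wing" by (simp add: wing_def)
    then show ?case using wing_step[OF step(1)] step(3) by blast
  qed
qed

lemma wing_mids: "mid_elem ` wing \<subseteq> left_mids P a"
proof
  fix z assume "z \<in> mid_elem ` wing"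
  then obtain X where X: "X \<in> wing" "z = mid_elem X" by auto
  from wing_cases[OF X(1)] show "z \<in> left_mids P a"
  proof
    assume "\<exists>b. climbing b X"
    then obtain b where b: "climbing b X" by auto
    then have "upr P b \<in> grid P" using upr_grid[of b] by (simp add: climbing_def)
    then show ?thesis using b unfolding left_mids_eq climbing_def mid_elem_def X(2) by auto
  next
    assume "\<exists>c. descending c X"
    then show ?thesis unfolding left_mids_eq descending_def mid_elem_def X(2) using upl_grid notP_T by auto
  qed
qed

lemma wing_covers:
  assumes X: "X \<in> wing" "on_left P (mid_elem X)"
    and t: "fst (mid_elem X) = fst k \<or> on_left P (top_elem X)"
  shows "mid_elem ` wing = left_mids P a"
proof (rule antisym[OF wing_mids], rule subsetI)
  fix z assume z: "z \<in> left_mids P a"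
  let ?m = "mid_elem X"
  \<comment> \<open>A lower element of this column would be off \<open>P\<close>, so its left cover
    would continue along a lower row and lie to the left of \<open>?m\<close>.\<close>
  have nomore: "snd ?m \<le> snd z" if "fst z = fst k" "fst ?m = fst k" "snd ?m \<le> snd a"
  proof (rule ccontr)
    assume n: "\<not> ?thesis"
    have zg: "z \<in> grid P" using z by (auto simp: left_mids_def)
    have "z \<notin> P" using n that eq_fst[OF _ k_P, of z] k_row by auto
    then have "snd (upl P z) = snd z" "fst z < fst (upl P z)" "upl P z \<in> grid P"
      using snd_upl upl_gt upl_grid zg notP_T by auto
    then show False using X(2) n that by (auto simp: on_left_def)
  qed
  from wing_cases[OF X(1)] show "z \<in> mid_elem ` wing"
  proof
    assume "\<exists>b. climbing b X"
    then obtain b where b: "climbing b X" by auto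
    then have m: "?m = upr P b" "top_elem X = upr P ?m" "snd ?m = snd a" "?m \<in> grid P" "?m \<noteq> T"
      using upr_grid by (auto simp: climbing_def mid_elem_def top_elem_def)
    \<comment> \<open>Off the column of \<open>k\<close> the middle has two upper covers, and the
      left one lies to the left of the top, contrary to \<open>t\<close>.\<close>
    have fm: "fst ?m = fst k"
    proof (rule ccontr)
      assume f: "fst ?m \<noteq> fst k"
      then have "?m \<notin> P" using eq_snd[OF _ k_P, of ?m] m k_row by auto
      then have "fst (upr P ?m) = fst ?m" "snd (upl P ?m) = snd ?m" "fst ?m < fst (upl P ?m)"
        "upl P ?m \<in> grid P" "snd ?m < snd (upr P ?m)"
        using fst_upr snd_upl upl_gt(1) upl_grid upr_gt(2) m(4,5) by blast+
      then show False using t f m(2) by (auto simp: on_left_def)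
    qed
    show ?thesis using z
      unfolding left_mids_eq mem_Collect_eq
    proof (elim conjE disjE)
      assume "z \<in> grid P" "snd z = snd a" "fst a < fst z"
      then show ?thesis using b fm m(1) row_le by (auto simp: climbing_def)
    next
      assume g: "z \<in> grid P" and f: "fst z = fst k"
      then have "snd z = snd a" using nomore fm m(3) col_le[OF g f] by auto
      then show ?thesis using b fm m(1) f g by (auto simp: climbing_def)
    qed
  next
    assume "\<exists>c. descending c X"
    then obtain c where c: "descending c X" by auto
    then have m: "?m = upl P c" "fst ?m = fst k" "?m \<in> grid P"
      using upl_grid notP_T by (auto simp: descending_def mid_elem_def)
    show ?thesis using z nomore col_le[OF m(3,2)] c m
      unfolding left_mids_eq mem_Collect_eq descending_def by auto
  qed
qed

end

context perm_set
begin

text \<open>Together with the reflected version this shows that the two sets of deleted elements are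
  disjoint and do not contain the anchor.\<close>

lemma left_mids_bounds:
  assumes a: "a \<in> grid P" "a \<notin> P" and z: "z \<in> left_mids P a"
  shows "fst a < fst z \<and> snd z \<le> snd a"
proof -
  have zg: "z \<in> grid P" using z by (auto simp: left_mids_def)
  consider "snd z = snd a" "fst a < fst z" | u where "u \<in> P" "snd u = snd a" "fst z = fst u"
    using z by (auto simp: left_mids_def)
  then show ?thesis
  proof cases
    case 2
    obtain v where v: "v \<in> P" "snd v = snd a" "fst a \<le> fst v" using row_point[OF a(1)] .
    have "v = u" using eq_snd v 2 by auto
    moreover have "v \<noteq> a" using v a(2) by auto
    ultimately have "fst a < fst u" using v by (auto simp: prod_eq_iff less_le)
    moreover obtain w where w: "w \<in> P" "fst w = fst z" "snd z \<le> snd w" using col_point[OF zg] .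
    moreover have "w = u" using eq_fst w 2 by auto
    ultimately show ?thesis using 2 by auto
  qed auto
qed

lemma right_mids_bounds:
  assumes a: "a \<in> grid P" "a \<notin> P" and z: "z \<in> right_mids P a"
  shows "fst z \<le> fst a \<and> snd a < snd z"
proof -
  interpret swapped: perm_set "prod.swap ` P" "prod.swap T" by (rule perm_set_swap) unfold_locales
  have "prod.swap z \<in> left_mids (prod.swap ` P) (prod.swap a)" using z by (simp add: left_mids_swap)
  from swapped.left_mids_bounds[OF _ _ this] a show ?thesis by (auto simp: grid_swap)
qed

end

text \<open>
  A left wing ending on the boundary need not have reached the column of \<open>k\<close>: while climbing, its
  last chain may lie on the boundary without being stopped by \<open>P\<close>. In this case the removal of its
  middle element leaves \<open>a\<close> and a lower cover \<open>b\<close> below two elements \<open>w\<close> and \<open>t\<close> with nothing in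
  between, which is impossible in a planar diagram; hence the hypothesis \<open>interp\<close>.
\<close>

lemma (in left_scheme) mid_on_boundary_covers:
  assumes X: "X \<in> wing" "on_left P (mid_elem X) \<or> on_right P (mid_elem X)"
    and R: "R \<subseteq> right_mids P a"
    and interp: "\<And>x y u v. \<lbrakk>{x, y, u, v} \<subseteq> grid P - (mid_elem ` wing \<union> R); x \<le> u; x \<le> v; y \<le> u; y \<le> v\<rbrakk>
      \<Longrightarrow> \<exists>z\<in>grid P - (mid_elem ` wing \<union> R). x \<le> z \<and> y \<le> z \<and> z \<le> u \<and> z \<le> v"
  shows "mid_elem ` wing = left_mids P a"
  using wing_cases[OF X(1)]
proof
  let ?m = "mid_elem X"
  assume "\<exists>c. descending c X"
  then obtain c where c: "descending c X" by auto
  then have cg: "c \<in> grid P" "c \<notin> P" "?m = upl P c" "fst ?m = fst k" by (auto simp: descending_def mid_elem_def)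
  have "\<not> on_right P ?m"
    unfolding on_right_def not_not
    by (rule bexI[of _ "upr P c"]) (use fst_upr[OF cg(1,2)] snd_upl[OF cg(1,2)] upr_grid[OF cg(1) notP_T[OF cg(2)]]
      upl_gt[OF cg(1) notP_T[OF cg(2)]] upr_gt[OF cg(1) notP_T[OF cg(2)]] cg(3) in auto)
  then show ?thesis using X cg(4) wing_covers by blast
next
  let ?m = "mid_elem X"
  assume "\<exists>b. climbing b X"
  then obtain b where b: "climbing b X" by auto
  then have m: "b \<in> grid P" "b \<noteq> T" "?m = upr P b" "snd ?m = snd a" "fst a < fst ?m" "?m \<noteq> T"
    by (auto simp: climbing_def mid_elem_def)
  have mg: "?m \<in> grid P" using m upr_grid by auto
  have aT: "a \<noteq> T" using a_P T_in by auto
  have "\<not> on_right P ?m"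
    unfolding on_right_def not_not
    by (rule bexI[of _ "upr P a"]) (use fst_upr[OF a_grid a_P] upr_grid[OF a_grid aT] upr_gt[OF a_grid aT] m in auto)
  then have mL: "on_left P ?m" using X by auto
  show ?thesis
  proof (cases "fst ?m = fst k")
    case True then show ?thesis using X(1) mL wing_covers by blast
  next
    case False
    have mk: "fst ?m < fst k" using row_le[OF mg m(4)] False by auto
    have mP: "?m \<notin> P" using False eq_snd[OF _ k_P, of ?m] k_row m by auto
    have bm: "snd b < snd ?m" using m(3) upr_gt[OF m(1,2)] by simp
    \<comment> \<open>Off \<open>P\<close>, the left cover of \<open>d\<close> would lie to the left
      of \<open>?m\<close>, which is on the left boundary.\<close>
    have nb: "d \<in> P" if "d \<in> grid P" "upr P d = ?m" for d
    proof (rule ccontr)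
      assume n: "d \<notin> P"
      then have "fst (upr P d) = fst d" "snd (upl P d) = snd d" "upl P d \<in> grid P"
         "fst d < fst (upl P d)" "snd d < snd (upr P d)"
        using fst_upr[OF that(1) n] snd_upl[OF that(1) n] upl_grid[OF that(1) notP_T[OF n]]
          upl_gt[OF that(1) notP_T[OF n]] upr_gt[OF that(1) notP_T[OF n]] by auto
      then show False using mL that by (auto simp: on_left_def)
    qed
    have bP: "b \<in> P" using nb m by auto
    have fb: "fst b < fst ?m" using upl_gt[OF m(1,2)] upl_upr_P[OF bP] m(3) by auto
    define w t where "w = upl P ?m" and "t = upr P ?m"
    have w: "w \<in> grid P" "snd w = snd ?m" "fst ?m < fst w"
      using upl_grid[OF mg m(6)] snd_upl[OF mg mP] upl_gt[OF mg m(6)] by (auto simp: w_def)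
    have t: "t \<in> grid P" "fst t = fst ?m" "snd ?m < snd t"
      using upr_grid[OF mg m(6)] fst_upr[OF mg mP] upr_gt[OF mg m(6)] by (auto simp: t_def)
    have wm: "w \<notin> mid_elem ` wing"
    proof
      assume "w \<in> mid_elem ` wing"
      then obtain Y where Y: "Y \<in> wing" "w = mid_elem Y" by auto
      from wing_cases[OF Y(1)] show False
      proof
        assume "\<exists>c. descending c Y"
        then have "fst w = fst k" "w \<notin> P" by (auto simp: descending_def Y(2) mid_elem_def)
        then have "w = k" using w m(4) k_row by (auto simp: prod_eq_iff)
        then show False using \<open>w \<notin> P\<close> k_P by auto
      next
        assume "\<exists>b. climbing b Y"
        then obtain d where d: "d \<in> grid P" "d \<notin> P" "upr P d \<notin> P" "w = upr P (upl P d)"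
          by (auto simp: climbing_def Y(2) mid_elem_def)
        let ?n = "upr P d"
        have n: "?n \<in> grid P" "upl P ?n = w" using d upr_grid notP_T upl_upr_commute[OF d(1,2)] by auto
        have s: "snd ?n = snd ?m" using snd_upl[OF n(1) d(3)] n(2) w by auto
        have f: "fst ?n < fst w" using upl_gt[OF n(1) notP_T[OF d(3)]] n by auto
        \<comment> \<open>Two elements of one row with the same left cover \<open>w\<close>
          coincide, since the left cover is the next element of the row.\<close>
        have "\<not> fst ?n < fst ?m" using upl_least[OF mg, of ?n] n(2) w s by (auto simp: le_point)
        moreover have "\<not> fst ?m < fst ?n" using upl_least[OF n(1), of ?m] f s by (auto simp: le_point w_def)
        ultimately have "?n = ?m" using s by (auto simp: prod_eq_iff)
        then show False using nb d by auto
      qed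
    qed
    let ?G = "grid P - (mid_elem ` wing \<union> R)"
    have L: "z \<in> ?G" if "z \<in> grid P" "z \<notin> left_mids P a \<or> z \<notin> mid_elem ` wing" "fst a < fst z \<or> snd z \<le> snd a" for z
      using that wing_mids R right_mids_bounds[OF a_grid a_P, of z] by auto
    have "a \<in> ?G" using L[OF a_grid] left_mids_bounds[OF a_grid a_P, of a] by auto
    moreover have "b \<in> ?G" using L[OF m(1)] fb bm mk m(4) unfolding left_mids_eq by simp
    moreover have "w \<in> ?G" using L[OF w(1)] wm w(3) m(5) by simp
    moreover have "t \<in> ?G" using L[OF t(1)] left_mids_bounds[OF a_grid a_P, of t] t m(4,5) by auto
    ultimately have G: "{a, b, w, t} \<subseteq> ?G" by (simp only: insert_subset empty_subsetI simp_thms)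
    have "a \<le> w" "a \<le> t" "b \<le> w" "b \<le> t" using w t m fb bm by (auto simp: le_point)
    from interp[OF G this] obtain z where z: "z \<in> ?G" "a \<le> z" "b \<le> z" "z \<le> w" "z \<le> t" by blast
    have zm: "z \<le> ?m" using z w t by (auto simp: le_point)
    have "z \<noteq> b" using z(2) bm m(4) by (auto simp: le_point)
    then have "?m \<le> z" using above_cases[OF m(1) _ z(3)] z(1) upl_upr_P[OF bP] m(3) by auto
    then have "z = ?m" using zm by auto
    then show ?thesis using z(1) X(1) by auto
  qed
qed

section \<open>The point set of a resection\<close>

context perm_set
begin

text \<open>The anchor takes over the row of \<open>k\<close> and the column of \<open>c\<close>,
  which are thereby cut off at the anchor. The column of \<open>k\<close> and the row of
  \<open>c\<close> lose their points and disappear. These are exactly the elements in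
  \<open>left_mids\<close> and \<open>right_mids\<close>.\<close>

lemma
  assumes a: "a \<in> grid P" "a \<notin> P" and k: "k \<in> P" "snd k = snd a" and c: "c \<in> P" "fst c = fst a"
  defines "P' \<equiv> insert a (P - {k, c})"
  shows grid_resect: "grid P - (left_mids P a \<union> right_mids P a) = grid P'"
    and perm_set_resect: "perm_set P' T"
proof -
  obtain v where v: "v \<in> P" "snd v = snd a" "fst a \<le> fst v" using row_point[OF a(1)] .
  have "v = k" using eq_snd v k by auto
  moreover have "v \<noteq> a" using v a(2) by auto
  ultimately have ak: "fst a < fst k" using v by (auto simp: prod_eq_iff less_le)
  obtain v where v: "v \<in> P" "fst v = fst a" "snd a \<le> snd v" using col_point[OF a(1)] .
  have "v = c" using eq_fst v c by auto
  moreover have "v \<noteq> a" using v a(2) by auto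
  ultimately have ac: "snd a < snd c" using v by (auto simp: prod_eq_iff less_le)
  have kc: "k \<noteq> c" using ak c by auto
  show "grid P - (left_mids P a \<union> right_mids P a) = grid P'"
  proof (intro equalityI subsetI)
    fix z assume z: "z \<in> grid P - (left_mids P a \<union> right_mids P a)"
    then have zg: "z \<in> grid P" by auto
    have n: "fst z \<noteq> fst k" "snd z \<noteq> snd c" "snd z = snd a \<Longrightarrow> fst z \<le> fst a" "fst z = fst a \<Longrightarrow> snd z \<le> snd a"
      using z k c by (auto simp: left_mids_def right_mids_def)
    obtain u where u: "u \<in> P" "fst u = fst z" "snd z \<le> snd u" using col_point[OF zg] .
    obtain v where v: "v \<in> P" "snd v = snd z" "fst z \<le> fst v" using row_point[OF zg] .
    have "\<exists>u\<in>P'. fst u = fst z \<and> snd z \<le> snd u"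
    proof (cases "u = c")
      case True then show ?thesis using n(4) u c by (intro bexI[of _ a]) (auto simp: P'_def)
    next
      case False then show ?thesis using n(1) u by (intro bexI[of _ u]) (auto simp: P'_def)
    qed
    moreover have "\<exists>v\<in>P'. snd v = snd z \<and> fst z \<le> fst v"
    proof (cases "v = k")
      case True then show ?thesis using n(3) v k by (intro bexI[of _ a]) (auto simp: P'_def)
    next
      case False then show ?thesis using n(2) v by (intro bexI[of _ v]) (auto simp: P'_def)
    qed
    ultimately show "z \<in> grid P'" by (simp add: grid_def)
  next
    fix z assume z: "z \<in> grid P'"
    obtain u where u: "u \<in> P'" "fst u = fst z" "snd z \<le> snd u" using z by (auto simp: grid_def)
    obtain v where v: "v \<in> P'" "snd v = snd z" "fst z \<le> fst v" using z by (auto simp: grid_def)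
    have "\<exists>u\<in>P. fst u = fst z \<and> snd z \<le> snd u"
      using u c ac by (cases "u = a") (force intro: bexI[of _ c], auto simp: P'_def)
    moreover have "\<exists>v\<in>P. snd v = snd z \<and> fst z \<le> fst v"
      using v k ak by (cases "v = a") (force intro: bexI[of _ k], auto simp: P'_def)
    ultimately have zg: "z \<in> grid P" by (simp add: grid_def)
    have "fst z \<noteq> fst k" using u ak eq_fst[OF _ k(1), of u] by (auto simp: P'_def)
    moreover have "snd z \<noteq> snd c" using v ac eq_snd[OF _ c(1), of v] by (auto simp: P'_def)
    moreover have "fst z \<le> fst a" if "snd z = snd a"
      using v that k eq_snd[OF _ k(1), of v] by (auto simp: P'_def)
    moreover have "snd z \<le> snd a" if "fst z = fst a"
      using u that c eq_fst[OF _ c(1), of u] by (auto simp: P'_def)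
    moreover have "u = k" if "u \<in> P" "snd u = snd a" for u using that k eq_snd by auto
    moreover have "u = c" if "u \<in> P" "fst u = fst a" for u using that c eq_fst by auto
    ultimately show "z \<in> grid P - (left_mids P a \<union> right_mids P a)"
      using zg unfolding left_mids_def right_mids_def by fastforce
  qed
  have T: "T \<noteq> k" "T \<noteq> c" using grid_fst_T[OF a(1) notP_T[OF a(2)]] grid_snd_T[OF a(1) notP_T[OF a(2)]] k c by auto
  show "perm_set P' T"
  proof
    show "finite P'" using fin by (simp add: P'_def)
    show "inj_on fst P'" unfolding P'_def
      using inj_fst eq_fst[OF _ c(1)] c(2) by (auto simp: inj_on_insert inj_on_diff)
    show "inj_on snd P'" unfolding P'_def
      using inj_snd eq_snd[OF _ k(1)] k(2) by (auto simp: inj_on_insert inj_on_diff)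
    show "T \<in> P'" using T T_in by (auto simp: P'_def)
    show "u \<le> T" if "u \<in> P'" for u using that T_ge grid_le_T[OF a(1)] unfolding P'_def by blast
  qed
qed

end

text \<open>North-west refers to the axes before the rotation. In the drawing, the relation
  \<open>nw u v\<close> says that \<open>u\<close> lies to the right of \<open>v\<close>.\<close>

definition nw :: "point \<Rightarrow> point \<Rightarrow> bool" where
  "nw u v \<longleftrightarrow> fst u < fst v \<and> snd v < snd u"

definition middle :: "point set \<Rightarrow> point \<Rightarrow> bool" where
  "middle P v \<longleftrightarrow> v \<in> P \<and> (\<exists>u\<in>P. nw u v) \<and> (\<exists>w\<in>P. nw v w)"

lemma gridI:
  "u \<in> P \<Longrightarrow> v \<in> P \<Longrightarrow> fst u = fst z \<Longrightarrow> snd z \<le> snd u \<Longrightarrow> snd v = snd z \<Longrightarrow> fst z \<le> fst v \<Longrightarrow> z \<in> grid P"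
  unfolding grid_def by blast

context perm_set
begin

lemma grid_eqI:
  assumes "x \<in> grid P" "y \<in> grid P" "\<And>u. u \<in> P \<Longrightarrow> x \<le> u \<longleftrightarrow> y \<le> u"
  shows "x = y"
proof -
  have "x \<le> y" if h: "x \<in> grid P" "y \<in> grid P" "\<And>u. u \<in> P \<Longrightarrow> y \<le> u \<Longrightarrow> x \<le> u" for x y
  proof -
    obtain u where u: "u \<in> P" "fst u = fst y" "snd y \<le> snd u" using col_point[OF h(2)] .
    obtain v where v: "v \<in> P" "snd v = snd y" "fst y \<le> fst v" using row_point[OF h(2)] .
    have "x \<le> u" "x \<le> v" using u v by (intro h(3); simp add: le_point)+
    then show ?thesis using u v by (auto simp: le_point)
  qed
  then show ?thesis using assms by (intro antisym) blast+
qed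

text \<open>Without middle points, the points of \<open>P\<close> are meet-prime. The only critical
  case is that \<open>x\<close> respects one coordinate of \<open>u\<close> and \<open>y\<close> the
  other; then the point in the column of one and the point in the row of the other make
  \<open>u\<close> a middle point.\<close>

lemma pmin_le_P:
  assumes nm: "\<And>v. \<not> middle P v" and x: "x \<in> grid P" and y: "y \<in> grid P" and u: "u \<in> P" "pmin x y \<le> u"
  shows "x \<le> u \<or> y \<le> u"
proof -
  have *: False if x: "x \<in> grid P" and y: "y \<in> grid P" and n: "fst x \<le> fst u" "\<not> snd x \<le> snd u" "snd y \<le> snd u" "\<not> fst y \<le> fst u" for x y
  proof -
    obtain c where c: "c \<in> P" "fst c = fst x" "snd x \<le> snd c" using col_point[OF x] .
    obtain r where r: "r \<in> P" "snd r = snd y" "fst y \<le> fst r" using row_point[OF y] .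
    have "fst c \<noteq> fst u" using eq_fst[OF c(1) u(1)] c n by auto
    then have "nw c u" using c n by (auto simp: nw_def)
    moreover have "snd r \<noteq> snd u" using eq_snd[OF r(1) u(1)] r n by auto
    then have "nw u r" using r n by (auto simp: nw_def)
    ultimately show False using nm[of u] u c r by (auto simp: middle_def)
  qed
  show ?thesis using *[OF x y] *[OF y x] u(2) by (auto simp: pmin_def le_point min_le_iff_disj)
qed

text \<open>The two sides are compared by the points of \<open>P\<close> above them. By
  meet-primeness, this turns meets into disjunctions and joins into conjunctions, and the law
  becomes propositional.\<close>

lemma distrib_grid:
  assumes nm: "\<And>v. \<not> middle P v" and "x \<in> grid P" "y \<in> grid P" "z \<in> grid P"
  shows "pmin x (pjoin y z) = pjoin (pmin x y) (pmin x z)"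
proof (rule grid_eqI)
  show g: "pmin x (pjoin y z) \<in> grid P" "pjoin (pmin x y) (pmin x z) \<in> grid P"
    using assms grid_pmin pjoin_grid by auto
  have le: "pmin a b \<le> u \<longleftrightarrow> a \<le> u \<or> b \<le> u" if "a \<in> grid P" "b \<in> grid P" "u \<in> P" for a b u
    using pmin_le_P[OF nm that] pmin_le[of a b] order_trans by blast
  fix u assume u: "u \<in> P"
  show "pmin x (pjoin y z) \<le> u \<longleftrightarrow> pjoin (pmin x y) (pmin x z) \<le> u"
    using u assms grid_pmin pjoin_grid by (simp add: le pjoin_le_iff P_grid) blast
qed

end

text \<open>
  The situation created by splitting the point \<open>a\<close> into \<open>k\<close> and \<open>b\<close>, where \<open>d\<close> is the nearest column
  to the left of \<open>a\<close> among the points to its upper left, and \<open>c\<close> the nearest row below \<open>a\<close> among the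
  points to its lower right. Swapping the coordinates exchanges \<open>k\<close> with \<open>b\<close> and \<open>c\<close> with \<open>d\<close>.
\<close>

locale anchored = perm_set +
  fixes a b k c d :: point
  assumes b_P: "b \<in> P" and k_P: "k \<in> P" and c_P: "c \<in> P" and d_P: "d \<in> P"
    and b_col: "fst b = fst a" and k_row: "snd k = snd a"
    and fst_ord: "fst d < fst a" "fst a < fst c" "fst c < fst k"
    and snd_ord: "snd c < snd a" "snd a < snd d" "snd d < snd b"
    and fst_gap: "\<And>x. x \<in> P \<Longrightarrow> fst d < fst x \<Longrightarrow> fst x < fst a \<Longrightarrow> snd x < snd c"
    and snd_gap: "\<And>x. x \<in> P \<Longrightarrow> snd c < snd x \<Longrightarrow> snd x < snd a \<Longrightarrow> fst x < fst d"
    and next_k: "\<And>x. x \<in> P \<Longrightarrow> fst c < fst x \<Longrightarrow> fst k \<le> fst x"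
    and next_b: "\<And>x. x \<in> P \<Longrightarrow> snd d < snd x \<Longrightarrow> snd b \<le> snd x"
begin

lemma anchored_swap:
  "anchored (prod.swap ` P) (prod.swap T) (prod.swap a) (prod.swap k) (prod.swap b) (prod.swap d) (prod.swap c)"
proof -
  interpret s: perm_set "prod.swap ` P" "prod.swap T" by (rule perm_set_swap) unfold_locales
  show ?thesis
    by unfold_locales
      (use b_P k_P c_P d_P b_col k_row fst_ord snd_ord fst_gap snd_gap next_k next_b in auto)
qed

text \<open>The elements \<open>base\<close>, \<open>e\<close>, \<open>f\<close> and
  \<open>a\<close> are the bottom cell of the future scheme. The two gap conditions say that no
  other row or column of the grid passes through it.\<close>

definition base :: point where "base = (fst d, snd c)"
definition e :: point where "e = (fst a, snd c)"
definition f :: point where "f = (fst d, snd a)"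

lemma base_grid: "base \<in> grid P"
  by (rule gridI[OF d_P c_P]) (use fst_ord snd_ord in \<open>simp_all add: base_def\<close>)

lemma e_grid: "e \<in> grid P"
  by (rule gridI[OF b_P c_P]) (use fst_ord snd_ord b_col in \<open>simp_all add: e_def\<close>)

lemma f_grid: "f \<in> grid P"
  by (rule gridI[OF d_P k_P]) (use fst_ord snd_ord k_row in \<open>simp_all add: f_def\<close>)

lemma a_grid: "a \<in> grid P"
  by (rule gridI[OF b_P k_P]) (use fst_ord snd_ord b_col k_row in simp_all)

lemma base_P: "base \<notin> P"
proof
  assume "base \<in> P"
  from eq_fst[OF this d_P] have "snd base = snd d" using b_col by (simp add: base_def)
  then show False using fst_ord snd_ord by (simp add: base_def)
qed

lemma e_P: "e \<notin> P"
proof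
  assume "e \<in> P"
  from eq_fst[OF this b_P] have "snd e = snd b" using b_col by (simp add: e_def)
  then show False using fst_ord snd_ord by (simp add: e_def)
qed

lemma f_P: "f \<notin> P"
proof
  assume "f \<in> P"
  from eq_fst[OF this d_P] have "snd f = snd d" using b_col by (simp add: f_def)
  then show False using fst_ord snd_ord by (simp add: f_def)
qed

lemma a_P: "a \<notin> P"
proof
  assume "a \<in> P"
  from eq_fst[OF this b_P] have "snd a = snd b" using b_col by (simp)
  then show False using fst_ord snd_ord by (simp)
qed

lemma fst_above: assumes "w \<in> grid P" "fst d < fst w" "snd c \<le> snd w" shows "fst a \<le> fst w"
proof (rule ccontr)
  assume n: "\<not> ?thesis"
  obtain u where u: "u \<in> P" "fst u = fst w" "snd w \<le> snd u" using col_point[OF assms(1)] .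
  show False using fst_gap[OF u(1)] u n assms by auto
qed

lemma snd_above: assumes "w \<in> grid P" "snd c < snd w" "fst d \<le> fst w" shows "snd a \<le> snd w"
proof (rule ccontr)
  assume n: "\<not> ?thesis"
  obtain u where u: "u \<in> P" "snd u = snd w" "fst w \<le> fst u" using row_point[OF assms(1)] .
  show False using snd_gap[OF u(1)] u n assms by auto
qed

lemma fst_above_c: assumes "w \<in> grid P" "fst c < fst w" shows "fst k \<le> fst w"
  using col_point[OF assms(1)] next_k assms(2) by metis

lemma upl_base: "upl P base = e"
proof (rule antisym)
  have "base \<noteq> T" using base_P notP_T by auto
  note u = upl_grid[OF base_grid this] upl_gt[OF base_grid this]
  show "upl P base \<le> e" using e_grid fst_ord by (intro upl_least) (auto simp: base_def e_def)
  show "e \<le> upl P base" using fst_above[OF u(1)] u by (auto simp: le_point base_def e_def)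
qed

lemma upr_base: "upr P base = f"
proof (rule antisym)
  have "base \<noteq> T" using base_P notP_T by auto
  note u = upr_grid[OF base_grid this] upr_gt[OF base_grid this]
  show "upr P base \<le> f" using f_grid snd_ord by (intro upr_least) (auto simp: base_def f_def)
  show "f \<le> upr P base" using snd_above[OF u(1)] u by (auto simp: le_point base_def f_def)
qed

lemma upr_e: "upr P e = a"
proof (rule antisym)
  have "e \<noteq> T" using e_P notP_T by auto
  note u = upr_grid[OF e_grid this] upr_gt[OF e_grid this]
  show "upr P e \<le> a" using a_grid snd_ord by (intro upr_least) (auto simp: e_def)
  show "a \<le> upr P e" using snd_above[OF u(1)] u fst_ord by (auto simp: le_point e_def)
qed

lemma upl_f: "upl P f = a"
  using upl_upr_commute[OF base_grid base_P] by (simp add: upl_base upr_base upr_e)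

sublocale left: left_scheme P T e k
  by unfold_locales (use e_grid e_P a_P k_P k_row upr_e in auto)

definition chain_up :: "point \<Rightarrow> triple" where "chain_up x = (x, upr P x, upr P (upr P x))"
definition chain_down :: "point \<Rightarrow> triple" where "chain_down x = (x, upl P x, upl P (upl P x))"

lemma start_eq: "left.start = chain_up (upl P e)"
  using upl_upr_commute[OF e_grid e_P] by (simp add: left.start_def chain_up_def upr_e)

lemma k_T: "k \<noteq> T" using snd_ord k_row T_ge[OF d_P] by (auto simp: le_point)
lemma c_T: "c \<noteq> T" using fst_ord T_ge[OF k_P] by (auto simp: le_point)

text \<open>The bottom of the chain stays in the column of \<open>c\<close> and the middle in the
  column of \<open>k\<close>, which is the next one. The descent ends at the lowest grid element of
  the column of \<open>c\<close>, and there the chain lies on the left boundary.\<close>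

lemma descend:
  assumes "x \<in> grid P" "fst x = fst c" "chain_down x \<in> left.wing"
  shows "\<exists>X\<in>left.wing. on_left P (bot_elem X) \<and> on_left P (mid_elem X) \<and> on_left P (top_elem X)"
  using assms
proof (induction "card {z\<in>grid P. snd z < snd x}" arbitrary: x rule: less_induct)
  case less
  have xc: "snd x \<le> snd c" using col_point[OF less(2)] eq_fst[OF _ c_P] less(3) by metis
  have xT: "x \<noteq> T" using less(3) c_T xc T_ge[OF c_P] by (auto simp: prod_eq_iff le_point)
  have kk: "upl P y \<le> k" "fst (upl P y) = fst k" if "y \<in> grid P" "y \<noteq> T" "fst y = fst c" "snd y \<le> snd c" for y
  proof -
    show k: "upl P y \<le> k" using P_grid[OF k_P] that fst_ord snd_ord k_row by (intro upl_least) auto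
    show "fst (upl P y) = fst k"
      using k fst_above_c[OF upl_grid[OF that(1,2)]] upl_gt[OF that(1,2)] that(3) by (auto simp: le_point)
  qed
  show ?case
  proof (cases "\<exists>y\<in>grid P. fst y = fst c \<and> snd y < snd x")
    case True
    let ?S = "{y\<in>grid P. fst y = fst c \<and> snd y < snd x}"
    have S: "finite (snd ` ?S)" "snd ` ?S \<noteq> {}" using finite_grid True by auto
    then obtain y where y: "y \<in> ?S" "snd y = Max (snd ` ?S)" using Max_in[OF S] by (auto simp del: Max_in)
    then have max: "snd z \<le> snd y" if "z \<in> ?S" for z using S(1) that by simp
    have yg: "y \<in> grid P" "fst y = fst c" "snd y < snd x" using y by auto
    have yP: "y \<notin> P" using eq_fst[OF _ c_P, of y] yg xc by auto
    note yT = notP_T[OF yP]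
    have r: "upr P y = x"
    proof -
      have "upr P y \<le> x" using yg less(2,3) by (intro upr_least) auto
      moreover have "upr P y \<in> grid P" "fst (upr P y) = fst c" "snd y < snd (upr P y)"
        using upr_grid[OF yg(1) yT] fst_upr[OF yg(1) yP] upr_gt[OF yg(1) yT] yg(2) by auto
      ultimately show ?thesis using max[of "upr P y"] less(3) by (fastforce simp: le_point prod_eq_iff)
    qed
    have ug: "upl P y \<in> grid P" using upl_grid[OF yg(1) yT] .
    have uP: "upl P y \<notin> P"
      using kk(2)[OF yg(1) yT yg(2)] snd_upl[OF yg(1) yP] eq_fst[OF _ k_P, of "upl P y"] yg xc snd_ord k_row by auto
    have "next_l P (chain_down y) (chain_down x)"
      unfolding next_l_def
      by (rule disjI2, rule bexI[of _ y])
        (use yg yP uP upl_upr_commute[OF yg(1) yP] upl_upr_commute[OF ug uP] r in \<open>auto simp: chain_down_def\<close>)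
    then have "chain_down y \<in> left.wing" using less(4) by (auto simp: left.wing_def intro: converse_rtranclp_into_rtranclp)
    moreover have "card {z\<in>grid P. snd z < snd y} < card {z\<in>grid P. snd z < snd x}"
      using yg finite_grid by (intro psubset_card_mono) auto
    ultimately show ?thesis using less(1) yg by blast
  next
    case False
    \<comment> \<open>An element farther left but lower would have its meet with \<open>x\<close> in
      the column of \<open>c\<close> and below \<open>x\<close>. If \<open>x\<close> is
      \<open>c\<close> itself, the row of \<open>c\<close> ends there, and beyond the column of
      \<open>d\<close> the next possible row is that of \<open>a\<close>.\<close>
    have low: "snd x \<le> snd z \<and> (x = c \<longrightarrow> snd a \<le> snd z)" if z: "z \<in> grid P" "fst c < fst z" for z
    proof -
      have "pmin z x \<in> grid P" "fst (pmin z x) = fst c" "snd (pmin z x) = min (snd z) (snd x)"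
        using grid_pmin[OF z(1) less(2)] z less(3) by (simp_all add: pmin_def)
      then have "snd x \<le> snd z" using False by force
      moreover have "snd z \<noteq> snd c" using row_point[OF z(1)] eq_snd[OF _ c_P] z(2) by (metis not_less)
      ultimately show ?thesis using snd_above[OF z(1)] z fst_ord by auto
    qed
    let ?m = "upl P x"
    have mg: "?m \<in> grid P" using upl_grid less(2) xT by auto
    have fm: "fst ?m = fst k" using kk(2)[OF less(2) xT less(3) xc] .
    have mx: "on_left P x" using low less(3) by (force simp: on_left_def)
    have "on_left P ?m \<and> on_left P (upl P ?m)"
    proof (cases "x = c")
      \<comment> \<open>Nothing hangs below \<open>c\<close>, so the wing ends where it would have
        turned, with middle \<open>k\<close>.\<close>
      case True
      have "?m \<le> k" using kk(1)[OF less(2) xT less(3) xc] .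
      moreover have "snd k \<le> snd ?m" using low[OF mg] True fm fst_ord k_row by auto
      ultimately have mk: "?m = k" using fm by (auto simp: le_point prod_eq_iff)
      have 1: "snd k \<le> snd z" if "z \<in> grid P" "fst k \<le> fst z" for z
        using low[OF that(1)] that True fst_ord k_row by auto
      have "upl P k \<le> z" if "z \<in> grid P" "fst k < fst z" for z
        using that 1 by (intro upl_least) auto
      then show ?thesis unfolding mk on_left_def
        using 1 upl_gt[OF P_grid[OF k_P] k_T] by (force simp: le_point)
    next
      case False
      have xP: "x \<notin> P" using False less(3) eq_fst[OF _ c_P, of x] by auto
      have s: "snd ?m = snd x" using snd_upl[OF less(2) xP] .
      have "snd x < snd a" using xc snd_ord by auto
      then have mP: "?m \<notin> P" using eq_fst[OF _ k_P, of ?m] fm s k_row by auto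
      have "snd (upl P ?m) = snd x" "fst ?m < fst (upl P ?m)"
        using snd_upl[OF mg mP] upl_gt[OF mg notP_T[OF mP]] s by auto
      then show ?thesis using low fm fst_ord s by (force simp: on_left_def)
    qed
    then show ?thesis using mx less(4)
      by (intro bexI[of _ "chain_down x"]) (auto simp: chain_down_def bot_elem_def mid_elem_def top_elem_def)
  qed
qed

text \<open>The bottoms run along the row of \<open>c\<close> and the middles along the row of
  \<open>k\<close>. Since \<open>k\<close> has the column next to that of \<open>c\<close>, the two
  rows end simultaneously, at \<open>c\<close> and at its cover \<open>k\<close>.\<close>

lemma climb:
  assumes "x \<in> grid P" "snd x = snd c" "fst a < fst x" "chain_up x \<in> left.wing"
  shows "\<exists>X\<in>left.wing. on_left P (bot_elem X) \<and> on_left P (mid_elem X) \<and> on_left P (top_elem X)"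
  using assms
proof (induction "card {z\<in>grid P. fst x < fst z}" arbitrary: x rule: less_induct)
  case less
  have xc: "fst x \<le> fst c" using row_point[OF less(2)] eq_snd[OF _ c_P] less(3) by metis
  have xT: "x \<noteq> T" using less(3) c_T xc T_ge[OF c_P] by (auto simp: prod_eq_iff le_point)
  let ?m = "upr P x"
  have mg: "?m \<in> grid P" using upr_grid less(2) xT by auto
  have mk: "?m \<le> k" using P_grid[OF k_P] less(3) xc fst_ord snd_ord k_row by (intro upr_least) auto
  have sm: "snd ?m = snd k"
    using mk snd_above[OF mg] upr_gt[OF less(2) xT] less(3,4) fst_ord k_row by (auto simp: le_point)
  show ?case
  proof (cases "x = c")
    case True
    then have "?m = upl P c" using upl_upr_P[OF c_P] by simp
    then have "fst k \<le> fst ?m" using fst_above_c[OF mg] upl_gt[OF less(2) xT] True by auto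
    then have "?m = k" using mk sm by (auto simp: le_point prod_eq_iff)
    \<comment> \<open>Both \<open>c\<close> and \<open>k\<close> are in \<open>P\<close>, so left
      and right covers agree and the same chain can be read as climbing or as descending.\<close>
    then have "chain_up x = chain_down c"
      using True upl_upr_P[OF c_P] upl_upr_P[OF k_P] by (auto simp: chain_up_def chain_down_def)
    then show ?thesis using descend[OF P_grid[OF c_P]] less(5) by auto
  next
    case False
    have xP: "x \<notin> P" using False less(3) eq_snd[OF _ c_P, of x] by auto
    have "fst ?m < fst k" using fst_upr[OF less(2) xP] xc fst_ord by auto
    then have mP: "?m \<notin> P" using eq_snd[OF _ k_P sm] by auto
    let ?y = "upl P x"
    have y: "?y \<in> grid P" "snd ?y = snd c" "fst x < fst ?y"
      using upl_grid[OF less(2) xT] snd_upl[OF less(2) xP] upl_gt[OF less(2) xT] less(3) by auto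
    have "next_l P (chain_up ?y) (chain_up x)"
      unfolding next_l_def
      by (rule disjI1, rule bexI[of _ x])
        (use less(2) xP mP upl_upr_commute[OF less(2) xP] upl_upr_commute[OF mg mP] in \<open>auto simp: chain_up_def\<close>)
    then have "chain_up ?y \<in> left.wing" using less(5) by (auto simp: left.wing_def intro: converse_rtranclp_into_rtranclp)
    moreover have "card {z\<in>grid P. fst ?y < fst z} < card {z\<in>grid P. fst x < fst z}"
      using y finite_grid by (intro psubset_card_mono) auto
    moreover have "fst a < fst ?y" using y less(4) by simp
    ultimately show ?thesis using less(1) y(1,2) by blast
  qed
qed

lemma left_end: "\<exists>X\<in>left.wing. on_left P (bot_elem X) \<and> on_left P (mid_elem X) \<and> on_left P (top_elem X)"
proof (rule climb)
  have eT: "e \<noteq> T" using e_P notP_T by auto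
  show "upl P e \<in> grid P" "snd (upl P e) = snd c" "fst a < fst (upl P e)"
    using upl_grid[OF e_grid eT] snd_upl[OF e_grid e_P] upl_gt[OF e_grid eT] by (auto simp: e_def)
  show "chain_up (upl P e) \<in> left.wing" by (simp add: start_eq[symmetric] left.wing_def)
qed

end

text \<open>
  \<open>dchains P z\<close> contains the empty set, so the maximum in \<open>depth\<close> is over a nonempty set.
\<close>

definition dchains :: "point set \<Rightarrow> point \<Rightarrow> point set set" where
  "dchains P z = {C. C \<subseteq> P \<and> (\<forall>u\<in>C. nw z u) \<and> (\<forall>u\<in>C. \<forall>v\<in>C. u = v \<or> nw u v \<or> nw v u)}"

definition depth :: "point set \<Rightarrow> point \<Rightarrow> nat" where
  "depth P z = Max (card ` dchains P z)"

definition weight :: "point set \<Rightarrow> nat" where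
  "weight P = (\<Sum>z | middle P z. depth P z)"

lemma finite_dchains: "finite P \<Longrightarrow> finite (dchains P z)"
  by (rule finite_subset[of _ "Pow P"]) (auto simp: dchains_def)

lemma depth_ge: "finite P \<Longrightarrow> C \<in> dchains P z \<Longrightarrow> card C \<le> depth P z"
  unfolding depth_def by (intro Max_ge) (auto simp: finite_dchains)

lemma depth_le:
  assumes "finite P" "\<And>C. C \<in> dchains P z \<Longrightarrow> card C \<le> n" shows "depth P z \<le> n"
proof -
  have "{} \<in> dchains P z" by (auto simp: dchains_def)
  then show ?thesis unfolding depth_def using assms finite_dchains[OF assms(1)] by (subst Max_le_iff) auto
qed

section \<open>Splitting a point so that the weight decreases\<close>

lemma exists_gap:
  assumes "finite (S :: real set)" obtains t where "y < t" "\<And>x. x \<in> S \<Longrightarrow> y < x \<Longrightarrow> t < x"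
proof (cases "{x\<in>S. y < x} = {}")
  case True then show thesis using that[of "y + 1"] by auto
next
  case False
  let ?m = "Min {x\<in>S. y < x}"
  have f: "finite {x\<in>S. y < x}" using assms by auto
  have "y < ?m" using Min_in[OF f False] by blast
  moreover have "?m \<le> x" if "x \<in> S" "y < x" for x using that by (intro Min_le[OF f]) auto
  ultimately show thesis using that[of "(y + ?m) / 2"] by (fastforce simp: field_simps)
qed

lemma exists_max:
  fixes g :: "point \<Rightarrow> real"
  assumes "finite S" "S \<noteq> {}" shows "\<exists>x\<in>S. \<forall>y\<in>S. g y \<le> g x"
proof -
  have "Max (g ` S) \<in> g ` S" using assms by (intro Max_in) auto
  then obtain x where "x \<in> S" "g x = Max (g ` S)" by auto
  moreover have "g y \<le> Max (g ` S)" if "y \<in> S" for y using that assms(1) by (intro Max_ge) auto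
  ultimately show ?thesis by metis
qed

lemma nw_trans: "nw u v \<Longrightarrow> nw v w \<Longrightarrow> nw u w"
  by (auto simp: nw_def)

lemma (in perm_set) split_middle:
  assumes "\<exists>v. middle P v"
  shows "\<exists>Q a b k c d. anchored Q T a b k c d \<and> P = insert a (Q - {k, b}) \<and> weight Q < weight P"
proof -
  have fm: "finite {v. middle P v}" using fin by (rule finite_subset[rotated]) (auto simp: middle_def)
  have "{v. middle P v} \<noteq> {}" using assms by auto
  \<comment> \<open>The least abscissa is used three times: to clear the gap between
    \<open>d\<close> and \<open>a\<close>, to keep \<open>b\<close> out of the chains of middle
    points, and to show that \<open>b\<close> is not a middle point.\<close>
  from exists_max[OF fm this, of "\<lambda>v. - fst v"] obtain a
    where a: "middle P a" and amin: "\<And>v. middle P v \<Longrightarrow> fst a \<le> fst v" by fastforce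
  have aP: "a \<in> P" using a by (auto simp: middle_def)
  have "finite {w\<in>P. nw a w}" "{w\<in>P. nw a w} \<noteq> {}" using fin a by (auto simp: middle_def)
  from exists_max[OF this, of snd] obtain c where c: "c \<in> P" "nw a c"
    and cmax: "\<And>w. w \<in> P \<Longrightarrow> nw a w \<Longrightarrow> snd w \<le> snd c" by blast
  have "finite {w\<in>P. nw w a}" "{w\<in>P. nw w a} \<noteq> {}" using fin a by (auto simp: middle_def)
  from exists_max[OF this, of fst] obtain d where d: "d \<in> P" "nw d a"
    and dmax: "\<And>w. w \<in> P \<Longrightarrow> nw w a \<Longrightarrow> fst w \<le> fst d" by blast
  obtain \<kappa> where kap: "fst c < \<kappa>" "\<And>x. x \<in> P \<Longrightarrow> fst c < fst x \<Longrightarrow> \<kappa> < fst x"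
    using exists_gap[of "fst ` P" "fst c"] fin by (metis finite_imageI imageI)
  obtain \<mu> where mu: "snd d < \<mu>" "\<And>x. x \<in> P \<Longrightarrow> snd d < snd x \<Longrightarrow> \<mu> < snd x"
    using exists_gap[of "snd ` P" "snd d"] fin by (metis finite_imageI imageI)
  define b k where "b = (fst a, \<mu>)" and "k = (\<kappa>, snd a)"
  define Q where "Q = insert b (insert k (P - {a}))"
  have bk: "fst b = fst a" "snd b = \<mu>" "fst k = \<kappa>" "snd k = snd a" by (auto simp: b_def k_def)
  have ord: "fst d < fst a" "fst a < fst c" "snd c < snd a" "snd a < snd d"
    using c d by (auto simp: nw_def)
  have k_new: "fst x \<noteq> \<kappa>" if "x \<in> P" for x using kap(2)[OF that] kap(1) by fastforce
  have b_new: "snd x \<noteq> \<mu>" if "x \<in> P" for x using mu(2)[OF that] mu(1) by fastforce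
  have kP: "k \<notin> P" and bP: "b \<notin> P" using k_new[of k] b_new[of b] bk by auto
  have c_T: "fst c < fst T"
    using T_ge[OF aP] ord T_ge[OF c(1)] eq_fst[OF c(1) T_in] by (auto simp: le_point less_le)
  have d_T: "snd d < snd T"
    using T_ge[OF aP] ord T_ge[OF d(1)] eq_snd[OF d(1) T_in] by (auto simp: le_point less_le)
  have aT: "a \<noteq> T" using T_ge[OF c(1)] ord by (auto simp: le_point)
  have pQ: "perm_set Q T"
  proof
    show "finite Q" using fin by (simp add: Q_def)
    have k: "fst k \<noteq> fst x" "x \<noteq> a \<Longrightarrow> snd k \<noteq> snd x" if "x \<in> P" for x
      using k_new[OF that] eq_snd[OF that aP] bk by auto
    have b: "x \<noteq> a \<Longrightarrow> fst b \<noteq> fst x" "snd b \<noteq> snd x" if "x \<in> P" for x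
      using b_new[OF that] eq_fst[OF that aP] bk by auto
    have "fst b \<noteq> fst k" "snd b \<noteq> snd k" using bk ord kap(1) mu(1) by auto
    then show "inj_on fst Q" "inj_on snd Q" unfolding Q_def inj_on_def
      using k b eq_fst eq_snd by (metis insert_iff Diff_iff singletonI)+
    show "T \<in> Q" using T_in aT by (simp add: Q_def)
    have "k \<le> T" "b \<le> T"
      using kap(2)[OF T_in c_T] mu(2)[OF T_in d_T] T_ge[OF aP] bk by (auto simp: le_point)
    then show "u \<le> T" if "u \<in> Q" for u using that T_ge unfolding Q_def by blast
  qed
  have QP: "x \<in> P \<and> x \<noteq> a" if "x \<in> Q" "x \<noteq> b" "x \<noteq> k" for x using that by (auto simp: Q_def)
  \<comment> \<open>Otherwise \<open>x\<close> would have \<open>d\<close> on one side and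
    \<open>c\<close> on the other, hence be a middle point with smaller abscissa than
    \<open>a\<close>.\<close>
  have gap1: "snd x < snd c" if "x \<in> P" "fst d < fst x" "fst x < fst a" for x
  proof (rule ccontr)
    assume n: "\<not> ?thesis"
    have "snd x \<le> snd a" using dmax[OF that(1)] that by (fastforce simp: nw_def)
    moreover have "snd x \<noteq> snd a" "snd x \<noteq> snd c" using eq_snd[OF that(1) aP] eq_snd[OF that(1) c(1)] that ord by auto
    ultimately have "nw d x" "nw x c" using n ord that by (auto simp: nw_def)
    then have "middle P x" using that(1) c d by (auto simp: middle_def)
    then show False using amin[of x] that by simp
  qed
  have anch: "anchored Q T a b k c d"
  proof (intro anchored.intro pQ anchored_axioms.intro)
    show "b \<in> Q" "k \<in> Q" "c \<in> Q" "d \<in> Q" using c d ord by (auto simp: Q_def)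
    show "fst b = fst a" "snd k = snd a" "fst d < fst a" "fst a < fst c" "fst c < fst k"
      "snd c < snd a" "snd a < snd d" "snd d < snd b" using bk ord kap(1) mu(1) by auto
    fix x assume x: "x \<in> Q"
    show "snd x < snd c" if "fst d < fst x" "fst x < fst a"
      using gap1[of x] QP[OF x] that bk ord kap(1) by (cases "x = k"; cases "x = b") auto
    show "fst x < fst d" if h: "snd c < snd x" "snd x < snd a"
    proof -
      have xP: "x \<in> P" "x \<noteq> a" using QP[OF x] h bk ord mu(1) by (cases "x = k"; cases "x = b"; auto)+
      have "\<not> fst a < fst x" using cmax[OF xP(1)] h by (auto simp: nw_def)
      moreover have "fst x \<noteq> fst a" "fst x \<noteq> fst d" using eq_fst[OF xP(1) aP] eq_fst[OF xP(1) d(1)] xP(2) h ord by auto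
      ultimately show ?thesis using gap1[OF xP(1)] h by fastforce
    qed
    show "fst k \<le> fst x" if "fst c < fst x"
      using kap(2)[of x] QP[OF x] that bk ord by (cases "x = k"; cases "x = b") auto
    show "snd b \<le> snd x" if "snd d < snd x"
      using mu(2)[of x] QP[OF x] that bk ord by (cases "x = k"; cases "x = b") auto
  qed
  have PQ: "P = insert a (Q - {k, b})" using kP bP aP unfolding Q_def by auto
  \<comment> \<open>No old column lies between those of \<open>c\<close> and \<open>k\<close>, and
    \<open>c\<close> is lower than \<open>k\<close>; so in relation to old points \<open>c\<close>
    can stand in for \<open>k\<close>.\<close>
  have nw_k: "nw w c" if "w \<in> P" "nw w k" for w
  proof -
    have "w \<noteq> c" using that bk ord by (auto simp: nw_def)
    then have "fst w \<noteq> fst c" using eq_fst[OF that(1) c(1)] by auto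
    then show ?thesis using that kap(2)[OF that(1)] bk ord by (fastforce simp: nw_def)
  qed
  have k_nw: "nw c w" if "w \<in> P" "nw k w" for w
  proof -
    have h: "fst c < fst w" "nw a w" using that bk ord kap(1) by (auto simp: nw_def)
    then have "snd w \<noteq> snd c" using eq_snd[OF that(1) c(1)] by auto
    then show ?thesis using cmax[OF that(1) h(2)] h(1) by (simp add: nw_def)
  qed
  have fQ: "finite Q" using fin by (simp add: Q_def)
  have not_nw_b: "\<not> nw z b" if "z \<in> P" "middle P z" for z
    using amin[OF that(2)] bk by (auto simp: nw_def)
  \<comment> \<open>Whatever lies to the lower right of \<open>k\<close> also lies to the lower
    right of \<open>c\<close>. So \<open>c\<close> can be added to every chain counted for
    \<open>k\<close>, which gives a longer chain counted for \<open>a\<close>.\<close>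
  have depth_k: "depth Q k < depth P a"
  proof -
    have "depth Q k \<le> depth P a - 1"
    proof (rule depth_le[OF fQ])
      fix C assume C: "C \<in> dchains Q k"
      have CP: "C \<subseteq> P" using C QP bk ord kap(1) by (fastforce simp: dchains_def nw_def)
      have cC: "c \<notin> C" using C bk kap(1) by (auto simp: dchains_def nw_def)
      have cw: "nw c w" if "w \<in> C" for w using k_nw[of w] that CP C by (auto simp: dchains_def)
      have "insert c C \<in> dchains P a"
        using C CP c cw nw_trans[OF c(2)] by (auto simp: dchains_def)
      from depth_ge[OF fin this] show "card C \<le> depth P a - 1"
        using cC finite_subset[OF CP fin] by simp
    qed
    moreover have "{c} \<in> dchains P a" using c by (auto simp: dchains_def)
    then have "1 \<le> depth P a" using depth_ge[OF fin] by fastforce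
    ultimately show ?thesis by simp
  qed
  \<comment> \<open>Chains counted for an old middle point avoid \<open>b\<close>; if such a chain
    contains \<open>k\<close>, replacing \<open>k\<close> by \<open>c\<close> gives a chain of
    \<open>P\<close> of the same size.\<close>
  have depth_z: "depth Q z \<le> depth P z" if z: "z \<in> P" "middle P z" for z
  proof (rule depth_le[OF fQ])
    fix C assume C: "C \<in> dchains Q z"
    have bC: "b \<notin> C" using not_nw_b[OF z] C by (auto simp: dchains_def)
    have CP: "C - {k} \<subseteq> P" using C QP bC by (auto simp: dchains_def)
    show "card C \<le> depth P z"
    proof (cases "k \<in> C")
      case False
      then have "C \<in> dchains P z" using C CP by (auto simp: dchains_def)
      then show ?thesis by (rule depth_ge[OF fin])
    next
      case True
      have "c = k \<or> nw c k \<or> nw k c" if "c \<in> C" using that C True unfolding dchains_def by blast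
      then have cC: "c \<notin> C" using bk kap(1) ord by (auto simp: nw_def)
      have cw: "nw c w \<or> nw w c" if "w \<in> C - {k}" for w
        using that CP C True k_nw[of w] nw_k[of w] unfolding dchains_def by blast
      have zc: "nw z c" using nw_k[of z] z(1) C True by (auto simp: dchains_def)
      have "insert c (C - {k}) \<in> dchains P z"
        unfolding dchains_def mem_Collect_eq
      proof (intro conjI ballI)
        show "insert c (C - {k}) \<subseteq> P" using CP c by auto
        show "nw z u" if "u \<in> insert c (C - {k})" for u using that zc C by (auto simp: dchains_def)
        show "u = v \<or> nw u v \<or> nw v u" if "u \<in> insert c (C - {k})" "v \<in> insert c (C - {k})" for u v
          using that cw C unfolding dchains_def by blast
      qed
      from depth_ge[OF fin this] show ?thesis
        using cC True finite_subset[OF CP fin] by (simp add: card_Diff_singleton card.remove[symmetric])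
    qed
  qed
  have mid: "z = k \<or> (z \<noteq> a \<and> middle P z)" if m: "middle Q z" for z
  proof (cases "z = k")
    case False
    from m obtain u w where uw: "z \<in> Q" "u \<in> Q" "nw u z" "w \<in> Q" "nw z w" by (auto simp: middle_def)
    \<comment> \<open>A point to the upper left of \<open>b\<close> would be to the upper left of
      \<open>d\<close> as well, since the row of \<open>b\<close> follows that of \<open>d\<close>.
      Then \<open>d\<close> would be a middle point with smaller abscissa than
      \<open>a\<close>.\<close>
    have zb: "z \<noteq> b"
    proof
      assume zb: "z = b"
      have uP: "u \<in> P" using QP[OF uw(2)] uw(3) bk ord zb kap(1) mu(1) by (cases "u = b"; cases "u = k") (auto simp: nw_def)
      have "nw u a" using uw(3) zb bk ord mu(1) by (auto simp: nw_def)
      then have ud: "fst u \<le> fst d" using dmax uP by auto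
      have "snd d < snd u" using uw(3) zb bk mu(1) by (auto simp: nw_def)
      then have "fst u < fst d" using ud eq_fst[OF uP d(1)] by (auto simp: less_le)
      then have "nw u d" using \<open>snd d < snd u\<close> by (auto simp: nw_def)
      then have "middle P d" using uP d aP by (auto simp: middle_def)
      then show False using amin[of d] ord by simp
    qed
    have zP: "z \<in> P" "z \<noteq> a" using QP[OF uw(1) zb False] by auto
    have "\<exists>u\<in>P. nw u z"
    proof -
      consider "u = b" | "u = k" | "u \<in> P" using QP[OF uw(2)] by blast
      then show ?thesis
      proof cases
        case 1
        have "z \<noteq> d" using uw(3) 1 bk ord by (auto simp: nw_def)
        then have "snd z \<noteq> snd d" using eq_snd[OF zP(1) d(1)] by auto
        then have "nw d z" using uw(3) 1 bk ord mu(2)[OF zP(1)] by (fastforce simp: nw_def)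
        then show ?thesis using d by auto
      next
        case 2
        then have "nw a z" using uw(3) bk ord kap(1) by (auto simp: nw_def)
        then show ?thesis using aP by auto
      qed (use uw in auto)
    qed
    moreover have "\<exists>w\<in>P. nw z w"
    proof -
      consider "w = b" | "w = k" | "w \<in> P" using QP[OF uw(4)] by blast
      then show ?thesis
      proof cases
        case 1
        then have "nw z a" using uw(5) bk ord mu(1) by (auto simp: nw_def)
        then show ?thesis using aP by auto
      next
        case 2
        then show ?thesis using nw_k[OF zP(1)] uw(5) c by auto
      qed (use uw in auto)
    qed
    ultimately show ?thesis using zP by (auto simp: middle_def)
  qed simp
  \<comment> \<open>Whether \<open>k\<close> is a middle point of \<open>Q\<close> is left open; its
    depth is counted in either case.\<close>
  have "weight Q \<le> (\<Sum>z\<in>insert k ({z. middle P z} - {a}). depth Q z)"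
    unfolding weight_def by (rule sum_mono2) (use fm mid in auto)
  also have "\<dots> = depth Q k + (\<Sum>z\<in>{z. middle P z} - {a}. depth Q z)"
  proof (rule sum.insert)
    show "k \<notin> {z. middle P z} - {a}" using kP by (auto simp: middle_def)
  qed (use fm in auto)
  also have "\<dots> < depth P a + (\<Sum>z\<in>{z. middle P z} - {a}. depth P z)"
    using depth_k by (intro add_less_le_mono sum_mono) (auto intro!: depth_z simp: middle_def)
  also have "\<dots> = weight P"
    unfolding weight_def using fm a by (subst sum.remove[of _ a]) auto
  finally have "weight Q < weight P" .
  with anch PQ show ?thesis by blast
qed


section \<open>Planar bounded diagrams\<close>

text \<open>
  The abscissa at height \<open>h\<close> of the polygonal path through the given vertices; it is meaningful only
  when their heights increase and \<open>h\<close> is between the first and the last of them.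
\<close>

fun pl :: "point list \<Rightarrow> real \<Rightarrow> real" where
  "pl [] h = 0"
| "pl [a] h = fst a"
| "pl (a # b # xs) h =
     (if h \<le> snd b then fst a + (h - snd a) / (snd b - snd a) * (fst b - fst a) else pl (b # xs) h)"

definition segx :: "point \<Rightarrow> point \<Rightarrow> real \<Rightarrow> real" where
  "segx a b h = fst a + (h - snd a) / (snd b - snd a) * (fst b - fst a)"

lemma segx_ends: "segx a b (snd a) = fst a" "snd a < snd b \<Longrightarrow> segx a b (snd b) = fst b"
  by (auto simp: segx_def)

lemma segx_open_segment:
  assumes "snd a < h" "h < snd b" shows "(segx a b h, h) \<in> open_segment a b"
proof -
  let ?u = "(h - snd a) / (snd b - snd a)"
  have u: "0 < ?u" "?u < 1" using assms by auto
  have "?u * (snd b - snd a) = h - snd a" using assms by simp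
  moreover have "segx a b h = fst a + ?u * (fst b - fst a)" by (simp add: segx_def)
  ultimately have "(segx a b h, h) = (1 - ?u) *\<^sub>R a + ?u *\<^sub>R b"
    unfolding prod_eq_iff by (simp del: times_divide_eq_left) (simp only: left_diff_distrib right_diff_distrib; linarith)
  moreover have "a \<noteq> b" using assms by auto
  ultimately show ?thesis using u unfolding in_segment by blast
qed

lemma left_of_line_iff:
  assumes "snd a < snd b" shows "left_of_line p a b \<longleftrightarrow> fst p < segx a b (snd p)"
proof -
  have "left_of_line p a b \<longleftrightarrow> fst p - fst a < (fst b - fst a) * (snd p - snd a) / (snd b - snd a)"
    using assms by (simp add: left_of_line_def pos_less_divide_eq)
  then show ?thesis by (simp add: segx_def algebra_simps)
qed

lemma right_of_line_iff:
  assumes "snd a < snd b" shows "right_of_line p a b \<longleftrightarrow> segx a b (snd p) < fst p"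
proof -
  have "right_of_line p a b \<longleftrightarrow> (fst b - fst a) * (snd p - snd a) / (snd b - snd a) < fst p - fst a"
    using assms by (simp add: right_of_line_def pos_divide_less_eq)
  then show ?thesis by (simp add: segx_def algebra_simps)
qed

lemma po_covers:
  assumes "partial_order D"
  shows "covers D a b \<longleftrightarrow> a \<in> carrier D \<and> b \<in> carrier D \<and> le D a b \<and> a \<noteq> b \<and>
    (\<forall>c\<in>carrier D. le D a c \<and> le D c b \<longrightarrow> c = a \<or> c = b)"
proof -
  interpret partial_order D by fact
  show ?thesis by (auto simp: covers_def lless_def eq_is_equal)
qed

section \<open>Finite posets and saturated chains\<close>

locale finite_poset =
  fixes D :: "'a gorder"
  assumes po: "partial_order D" and fin: "finite (carrier D)"
begin

lemma le_refl: "x \<in> carrier D \<Longrightarrow> le D x x"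
  using po by (meson partial_order_def weak_partial_order.le_refl)

lemma le_antisym: "le D x y \<Longrightarrow> le D y x \<Longrightarrow> x \<in> carrier D \<Longrightarrow> y \<in> carrier D \<Longrightarrow> x = y"
  using po partial_order.le_antisym by fastforce

lemma le_trans: "le D x y \<Longrightarrow> le D y z \<Longrightarrow> x \<in> carrier D \<Longrightarrow> y \<in> carrier D \<Longrightarrow> z \<in> carrier D \<Longrightarrow> le D x z"
  using po by (meson partial_order_def weak_partial_order.le_trans)

lemmas covers_iff = po_covers[OF po]

lemma exists_minimal:
  assumes "S \<subseteq> carrier D" "S \<noteq> {}"
  shows "\<exists>m\<in>S. \<forall>z\<in>S. le D z m \<longrightarrow> z = m"
proof -
  have f: "finite S" using assms fin finite_subset by blast
  show ?thesis using f assms(2,1)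
  proof (induction rule: finite_ne_induct)
    case (singleton x) then show ?case by auto
  next
    case (insert x F)
    then obtain m where m: "m \<in> F" "\<forall>z\<in>F. le D z m \<longrightarrow> z = m" by auto
    show ?case
    proof (cases "le D x m")
      case True
      have "z = x" if "z \<in> F" "le D z x" for z
      proof -
        have "le D z m" using that True insert.prems m(1) by (meson insert_subset le_trans subsetD)
        then have "z = m" using m(2) that by auto
        then show ?thesis using True that insert.prems m(1) by (meson insert_subset le_antisym subsetD)
      qed
      then show ?thesis by (intro bexI[of _ x]) auto
    next
      case False
      then show ?thesis using m by (intro bexI[of _ m]) auto
    qed
  qed
qed

lemma exists_cover:
  assumes "le D x y" "x \<noteq> y" "x \<in> carrier D" "y \<in> carrier D"
  shows "\<exists>z. covers D x z \<and> le D z y"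
proof -
  let ?S = "{z\<in>carrier D. le D x z \<and> z \<noteq> x \<and> le D z y}"
  have "y \<in> ?S" using assms le_refl by auto
  then obtain m where m: "m \<in> ?S" "\<forall>z\<in>?S. le D z m \<longrightarrow> z = m" using exists_minimal[of ?S] by auto
  have "covers D x m" unfolding covers_iff
  proof (intro conjI ballI impI)
    fix c assume c: "c \<in> carrier D" "le D x c \<and> le D c m"
    show "c = x \<or> c = m"
      using c m assms le_trans[of c m y] by auto
  qed (use m assms in auto)
  then show ?thesis using m by auto
qed

definition cchain :: "'a list \<Rightarrow> bool" where
  "cchain xs \<longleftrightarrow> xs \<noteq> [] \<and> set xs \<subseteq> carrier D \<and> successively (covers D) xs"

lemma exists_cchain:
  assumes "le D x y" "x \<in> carrier D" "y \<in> carrier D"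
  shows "\<exists>xs. cchain xs \<and> hd xs = x \<and> last xs = y"
  using assms
proof (induction "card {z\<in>carrier D. le D x z}" arbitrary: x rule: less_induct)
  case less
  show ?case
  proof (cases "x = y")
    case True then show ?thesis using less by (intro exI[of _ "[x]"]) (auto simp: cchain_def)
  next
    case False
    then obtain z where z: "covers D x z" "le D z y" using exists_cover less by blast
    then have zc: "z \<in> carrier D" "le D x z" "x \<noteq> z" by (auto simp: covers_iff)
    have "card {w\<in>carrier D. le D z w} < card {w\<in>carrier D. le D x w}"
    proof (rule psubset_card_mono)
      show "finite {w \<in> carrier D. le D x w}" using fin by auto
      have "x \<in> {w \<in> carrier D. le D x w}" "x \<notin> {w \<in> carrier D. le D z w}"
        using less le_refl zc le_antisym by blast+
      moreover have "{w \<in> carrier D. le D z w} \<subseteq> {w \<in> carrier D. le D x w}"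
        using zc less le_trans by blast
      ultimately show "{w \<in> carrier D. le D z w} \<subset> {w \<in> carrier D. le D x w}" by blast
    qed
    then obtain xs where xs: "cchain xs" "hd xs = z" "last xs = y" using less z zc by blast
    then have "cchain (x # xs)" using z less by (cases xs) (auto simp: cchain_def)
    then show ?thesis using xs by (intro exI[of _ "x # xs"]) (auto simp: cchain_def)
  qed
qed

lemma cchain_Cons: "cchain (a # b # xs) \<longleftrightarrow> covers D a b \<and> cchain (b # xs)"
  by (auto simp: cchain_def covers_iff)

lemma cchain_hd_le: "cchain (a # xs) \<Longrightarrow> v \<in> set (a # xs) \<Longrightarrow> le D a v"
proof (induction xs arbitrary: a)
  case Nil then show ?case using le_refl by (auto simp: cchain_def)
next
  case (Cons b xs)
  then have c: "covers D a b" "cchain (b # xs)" by (auto simp: cchain_Cons)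
  then have ab: "le D a b" "a \<in> carrier D" "b \<in> carrier D" by (auto simp: covers_iff)
  have "v \<in> carrier D" using Cons.prems by (auto simp: cchain_def)
  then show ?case using Cons.prems Cons.IH[OF c(2)] ab le_trans le_refl by (metis set_ConsD)
qed

lemma cchain_comparable: "cchain xs \<Longrightarrow> x \<in> set xs \<Longrightarrow> y \<in> set xs \<Longrightarrow> le D x y \<or> le D y x"
proof (induction xs)
  case (Cons a xs)
  show ?case
  proof (cases xs)
    case Nil then show ?thesis using Cons le_refl by (auto simp: cchain_def)
  next
    case (Cons b ys)
    then have "cchain xs" using Cons.prems(1) by (auto simp: cchain_Cons)
    then show ?thesis using Cons.IH Cons.prems cchain_hd_le[OF Cons.prems(1)] by auto
  qed
qed (auto simp: cchain_def)

lemma cchain_append: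
  assumes "cchain xs" "cchain ys" "last xs = hd ys"
  shows "cchain (xs @ tl ys)" "hd (xs @ tl ys) = hd xs" "last (xs @ tl ys) = last ys"
    "set (xs @ tl ys) = set xs \<union> set ys"
proof -
  obtain y yt where y: "ys = y # yt" using assms by (cases ys) (auto simp: cchain_def)
  have n: "xs \<noteq> []" using assms by (auto simp: cchain_def)
  then have l: "last xs = y" "y \<in> set xs" using assms y by auto
  show "hd (xs @ tl ys) = hd xs" "last (xs @ tl ys) = last ys" using n y l by auto
  show "set (xs @ tl ys) = set xs \<union> set ys" using y l by auto
  show "cchain (xs @ tl ys)"
    using assms n y l unfolding cchain_def
    by (auto simp: successively_append_iff successively_Cons)
qed

end

section \<open>Polygonal paths\<close>

lemma pl_step: "pl (a # b # xs) = (\<lambda>h. if h \<le> snd b then segx a b h else pl (b # xs) h)"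
  by (auto simp: segx_def)

abbreviation rising :: "point list \<Rightarrow> bool" where
  "rising \<equiv> successively (\<lambda>a b. snd a < snd b)"

lemma pl_hd: "rising (a # xs) \<Longrightarrow> pl (a # xs) (snd a) = fst a"
  by (cases xs) auto

lemma pl_beyond: "rising (a # b # xs) \<Longrightarrow> snd b \<le> h \<Longrightarrow> pl (a # b # xs) h = pl (b # xs) h"
  using pl_hd[of b xs] segx_ends(2)[of a b] unfolding pl_step by auto

lemma continuous_pl:
  assumes "rising xs" shows "continuous_on UNIV (pl xs)"
  using assms
proof (induction xs rule: induct_list012)
  case (3 a b xs)
  have s: "continuous_on X (segx a b)" for X
    unfolding segx_def by (intro continuous_intros) (use 3 in auto)
  have "continuous_on UNIV (pl (b # xs))" using 3 by simp
  then have "continuous_on X (pl (b # xs))" for X by (rule continuous_on_subset) auto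
  then show ?case unfolding pl_step
    using 3 pl_hd[of b xs] segx_ends(2)[of a b]
    by (intro continuous_on_cases_le s continuous_on_id) auto
qed auto

lemma rising_heights:
  "rising (a # xs) \<Longrightarrow> v \<in> set (a # xs) \<Longrightarrow> snd a \<le> snd v"
  by (induction xs arbitrary: a) force+

lemma pl_vertex: "rising xs \<Longrightarrow> v \<in> set xs \<Longrightarrow> pl xs (snd v) = fst v"
proof (induction xs rule: induct_list012)
  case (3 a b xs)
  show ?case
  proof (cases "v = a")
    case True then show ?thesis using pl_hd[OF 3(3)] by simp
  next
    case False
    then have "v \<in> set (b # xs)" using 3 by auto
    then show ?thesis using 3 pl_beyond[OF 3(3)] rising_heights[of b xs v] by auto
  qed
qed auto

text \<open>The second alternative describes the path on a whole closed edge and not only at height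
  \<open>h\<close>, so that later a common edge of two paths can be followed down to its lower
  end.\<close>

lemma pl_cases:
  assumes "rising xs" "xs \<noteq> []" "snd (hd xs) \<le> h" "h \<le> snd (last xs)"
  obtains v where "v \<in> set xs" "snd v = h"
  | a b ys zs where "xs = ys @ a # b # zs" "snd a < h" "h < snd b"
      "\<And>t. snd a \<le> t \<Longrightarrow> t \<le> snd b \<Longrightarrow> pl xs t = segx a b t"
proof -
  have "(\<exists>v\<in>set xs. snd v = h) \<or> (\<exists>a b ys zs. xs = ys @ a # b # zs \<and> snd a < h \<and> h < snd b \<and>
      (\<forall>t. snd a \<le> t \<and> t \<le> snd b \<longrightarrow> pl xs t = segx a b t))"
    using assms
  proof (induction xs rule: induct_list012)
    case (3 a b xs)
    show ?case
    proof (cases "h \<le> snd b")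
      case True
      show ?thesis
      proof (cases "h = snd a \<or> h = snd b")
        case False
        then show ?thesis using 3(5) True
          by (intro disjI2 exI[of _ a] exI[of _ b] exI[of _ "[]"] exI[of _ xs]) (auto simp: pl_step)
      qed (use 3 in auto)
    next
      case False
      then consider v where "v \<in> set (b # xs)" "snd v = h"
        | c d ys zs where "b # xs = ys @ c # d # zs" "snd c < h" "h < snd d"
          "\<forall>t. snd c \<le> t \<and> t \<le> snd d \<longrightarrow> pl (b # xs) t = segx c d t"
        using 3(2-) by auto
      then show ?thesis
      proof cases
        case 2
        have "rising (b # xs)" "c \<in> set (b # xs)" using 3(3) by (simp, simp add: 2(1))
        then have "snd b \<le> snd c" by (rule rising_heights)
        then have "\<forall>t. snd c \<le> t \<and> t \<le> snd d \<longrightarrow> pl (a # b # xs) t = segx c d t"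
          using 2(4) \<open>snd b \<le> snd c\<close> pl_beyond[OF 3(3)] by (metis order_trans)
        then show ?thesis using 2
          by (intro disjI2 exI[of _ c] exI[of _ d] exI[of _ "a # ys"] exI[of _ zs]) auto
      qed auto
    qed
  qed auto
  then show thesis using that by blast
qed

text \<open>Bounds are assumed instead of lattice operations because the results below are also
  applied to the outcome of a resection before it is known to be a lattice.\<close>

locale planar_bounded =
  fixes D :: diagram and bt tp :: point
  assumes planar: "planar_hasse_diagram D"
    and bt: "bt \<in> carrier D" and tp: "tp \<in> carrier D"
    and bt_le: "x \<in> carrier D \<Longrightarrow> le D bt x" and le_tp: "x \<in> carrier D \<Longrightarrow> le D x tp"

sublocale planar_bounded \<subseteq> finite_poset D
  by (rule finite_poset.intro) (use planar in \<open>simp_all add: planar_hasse_diagram_def\<close>)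

context planar_bounded
begin

lemma covers_rise: "covers D a b \<Longrightarrow> snd a < snd b"
  using planar unfolding planar_hasse_diagram_def by blast

lemma edge_vertex: "covers D a b \<Longrightarrow> x \<in> open_segment a b \<Longrightarrow> x \<notin> carrier D"
  using planar unfolding planar_hasse_diagram_def by blast

lemma edge_edge: "covers D a b \<Longrightarrow> covers D c d \<Longrightarrow> x \<in> open_segment a b \<Longrightarrow> x \<in> open_segment c d \<Longrightarrow> a = c \<and> b = d"
  using planar unfolding planar_hasse_diagram_def by blast

lemma cchain_rising: "cchain xs \<Longrightarrow> rising xs"
  unfolding cchain_def by (auto intro: successively_mono covers_rise)

lemma less_rise:
  assumes "le D x y" "x \<noteq> y" "x \<in> carrier D" "y \<in> carrier D" shows "snd x < snd y"
proof -
  obtain xs where xs: "cchain xs" "hd xs = x" "last xs = y" using exists_cchain assms by blast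
  then obtain b ys where "xs = x # b # ys" using assms(2) by (metis cchain_def last.simps list.exhaust list.sel(1))
  then have "snd x < snd b" "snd b \<le> snd y"
    using cchain_rising[OF xs(1)] rising_heights[of b ys "last xs"] xs(3) by auto
  then show ?thesis by simp
qed

lemma le_rise: "le D x y \<Longrightarrow> x \<in> carrier D \<Longrightarrow> y \<in> carrier D \<Longrightarrow> snd x \<le> snd y"
  using less_rise by fastforce

definition path :: "point list \<Rightarrow> bool" where
  "path p \<longleftrightarrow> cchain p \<and> hd p = bt \<and> last p = tp"

lemma path_carrier: "path p \<Longrightarrow> x \<in> set p \<Longrightarrow> x \<in> carrier D"
  by (auto simp: path_def cchain_def)

lemma path_le: assumes "path p" "x \<in> set p" "y \<in> set p" "snd x \<le> snd y" shows "le D x y"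
  using cchain_comparable[of p x y] assms less_rise[of y x] path_carrier[OF assms(1)] le_refl
  unfolding path_def by fastforce

lemma exists_path2:
  assumes "le D x y" "x \<in> carrier D" "y \<in> carrier D"
  shows "\<exists>p. path p \<and> x \<in> set p \<and> y \<in> set p"
proof -
  obtain p where p: "cchain p" "hd p = bt" "last p = x" using exists_cchain bt_le bt assms by blast
  obtain q where q: "cchain q" "hd q = x" "last q = y" using exists_cchain assms by blast
  obtain r where r: "cchain r" "hd r = y" "last r = tp" using exists_cchain le_tp tp assms by blast
  have qr: "cchain (q @ tl r)" "hd (q @ tl r) = x" "last (q @ tl r) = tp" "set (q @ tl r) = set q \<union> set r"
    using cchain_append[OF q(1) r(1)] q r by auto
  have pqr: "cchain (p @ tl (q @ tl r))" "hd (p @ tl (q @ tl r)) = bt" "last (p @ tl (q @ tl r)) = tp"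
    "set (p @ tl (q @ tl r)) = set p \<union> (set q \<union> set r)"
    using cchain_append[OF p(1) qr(1)] p qr by auto
  have "x \<in> set q" "y \<in> set q" using q by (auto simp: cchain_def)
  then show ?thesis using pqr by (intro exI[of _ "p @ tl (q @ tl r)"]) (auto simp: path_def)
qed

lemma exists_path: "x \<in> carrier D \<Longrightarrow> \<exists>p. path p \<and> x \<in> set p"
  using exists_path2[of x x] le_refl by blast

lemma heights: "x \<in> carrier D \<Longrightarrow> snd bt \<le> snd x \<and> snd x \<le> snd tp"
  using le_rise bt_le le_tp bt tp by blast

lemma path_cases:
  assumes "path p" "snd bt \<le> h" "h \<le> snd tp"
  obtains v where "v \<in> set p" "snd v = h" "pl p h = fst v"
  | a b where "a \<in> set p" "b \<in> set p" "covers D a b" "snd a < h" "h < snd b"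
      "\<And>t. snd a \<le> t \<Longrightarrow> t \<le> snd b \<Longrightarrow> pl p t = segx a b t"
proof -
  note goal1 = that(1) and goal2 = that(2)
  have r: "rising p" "p \<noteq> []" using assms(1) cchain_rising by (auto simp: path_def cchain_def)
  show thesis
  proof (rule pl_cases[OF r, of h])
    show "snd (hd p) \<le> h" "h \<le> snd (last p)" using assms by (auto simp: path_def)
    show thesis if "v \<in> set p" "snd v = h" for v using goal1[OF that] that pl_vertex[OF r(1), of v] by simp
    show thesis if "p = ys @ a # b # zs" "snd a < h" "h < snd b"
      "\<And>t. snd a \<le> t \<Longrightarrow> t \<le> snd b \<Longrightarrow> pl p t = segx a b t" for a b ys zs
    proof -
      have "covers D a b" using assms(1) that(1)
        by (auto simp: path_def cchain_def successively_append_iff)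
      then show thesis using that goal2[of a b] by simp
    qed
  qed
qed

text \<open>Planarity forbids a vertex inside an edge and a common inner point of two different
  edges. What remains is a common vertex or a common edge.\<close>

lemma path_meet:
  assumes p: "path p" "path q" and h: "snd bt \<le> h" "h \<le> snd tp" and e: "pl p h = pl q h"
  obtains v where "v \<in> set p" "v \<in> set q" "snd v = h"
  | a b :: point where "a \<in> set p" "a \<in> set q" "snd a < h" "h < snd b"
      "\<And>t. snd a \<le> t \<Longrightarrow> t \<le> snd b \<Longrightarrow> pl p t = pl q t"
proof (rule path_cases[OF p(1) h]; rule path_cases[OF p(2) h])
  fix v w assume v: "v \<in> set p" "snd v = h" "pl p h = fst v" and w: "w \<in> set q" "snd w = h" "pl q h = fst w"
  then have "v = w" using e by (auto simp: prod_eq_iff)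
  then show thesis using that(1) v w by auto
next
  fix v a b assume v: "v \<in> set p" "snd v = h" "pl p h = fst v" and
    w: "covers D a b" "snd a < h" "h < snd b" "\<And>t. snd a \<le> t \<Longrightarrow> t \<le> snd b \<Longrightarrow> pl q t = segx a b t"
  have "v = (segx a b h, h)" using v w e by (auto simp: prod_eq_iff)
  then show thesis using edge_vertex[OF w(1)] segx_open_segment[OF w(2,3)] path_carrier[OF p(1) v(1)] by auto
next
  fix v a b assume v: "v \<in> set q" "snd v = h" "pl q h = fst v" and
    w: "covers D a b" "snd a < h" "h < snd b" "\<And>t. snd a \<le> t \<Longrightarrow> t \<le> snd b \<Longrightarrow> pl p t = segx a b t"
  have "v = (segx a b h, h)" using v w e by (auto simp: prod_eq_iff)
  then show thesis using edge_vertex[OF w(1)] segx_open_segment[OF w(2,3)] path_carrier[OF p(2) v(1)] by auto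
next
  fix a b c d assume v: "a \<in> set p" "covers D a b" "snd a < h" "h < snd b" "\<And>t. snd a \<le> t \<Longrightarrow> t \<le> snd b \<Longrightarrow> pl p t = segx a b t"
    and w: "c \<in> set q" "covers D c d" "snd c < h" "h < snd d" "\<And>t. snd c \<le> t \<Longrightarrow> t \<le> snd d \<Longrightarrow> pl q t = segx c d t"
  have "segx a b h = segx c d h" using v w e by auto
  then have "a = c \<and> b = d"
    using edge_edge[OF v(2) w(2) segx_open_segment[OF v(3,4)]] segx_open_segment[OF w(3,4)] by auto
  then show thesis using that(2)[of a b] v w by auto
qed

lemma path_continuous: "path p \<Longrightarrow> continuous_on X (pl p)"
  by (rule continuous_on_subset[OF continuous_pl[OF cchain_rising]]) (auto simp: path_def)

text \<open>The intermediate value theorem is applied to the difference of the abscissas of the two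
  paths; its zero is then moved to a common vertex.\<close>

lemma crossing:
  assumes p: "path p" "path q" and h: "snd bt \<le> h1" "h1 \<le> h2" "h2 \<le> snd tp"
    and d: "(pl p h1 < pl q h1 \<and> pl q h2 < pl p h2) \<or> (pl q h1 < pl p h1 \<and> pl p h2 < pl q h2)"
  shows "\<exists>v. v \<in> set p \<and> v \<in> set q \<and> h1 \<le> snd v \<and> snd v \<le> h2"
proof -
  let ?f = "\<lambda>t. pl p t - pl q t"
  have c: "continuous_on {h1..h2} ?f" by (intro continuous_intros path_continuous p)
  have "\<exists>t\<ge>h1. t \<le> h2 \<and> ?f t = 0"
    using d
  proof
    assume "pl p h1 < pl q h1 \<and> pl q h2 < pl p h2"
    then show ?thesis using IVT'[OF _ _ h(2) c, of 0] by auto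
  next
    assume "pl q h1 < pl p h1 \<and> pl p h2 < pl q h2"
    then show ?thesis using IVT2'[OF _ _ h(2) c, of 0] by auto
  qed
  then obtain t where t: "h1 \<le> t" "t \<le> h2" "pl p t = pl q t" by auto
  have tt: "snd bt \<le> t" "t \<le> snd tp" using t h by auto
  show ?thesis
  proof (rule path_meet[OF p tt t(3)])
    fix a b assume a: "a \<in> set p" "a \<in> set q" "snd a < t" "t < snd b"
      "\<And>t. snd a \<le> t \<Longrightarrow> t \<le> snd b \<Longrightarrow> pl p t = pl q t"
    \<comment> \<open>The paths agree along the whole edge but differ at height \<open>h1\<close>,
      so the lower end of the edge cannot lie below \<open>h1\<close>.\<close>
    have "h1 \<le> snd a" using a(5)[of h1] a(4) t(1) d by force
    then show ?thesis using a t by (intro exI[of _ a]) simp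
  next
    fix v assume "v \<in> set p" "v \<in> set q" "snd v = t"
    then show ?thesis using t by (intro exI[of _ v]) simp
  qed
qed

section \<open>The left-right order of incomparable elements\<close>

definition inc :: "point \<Rightarrow> point \<Rightarrow> bool" where
  "inc x y \<longleftrightarrow> x \<in> carrier D \<and> y \<in> carrier D \<and> \<not> le D x y \<and> \<not> le D y x"

lemma inc_sym: "inc x y \<Longrightarrow> inc y x" by (auto simp: inc_def)

definition lft :: "point \<Rightarrow> point \<Rightarrow> bool" where
  "lft x y \<longleftrightarrow> inc x y \<and> (\<exists>p. path p \<and> y \<in> set p \<and> fst x < pl p (snd x))"

lemma path_vertex: "path p \<Longrightarrow> x \<in> set p \<Longrightarrow> pl p (snd x) = fst x"
  using pl_vertex[OF cchain_rising] by (auto simp: path_def)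

lemma off_path:
  assumes "path p" "x \<in> carrier D" "x \<notin> set p" shows "pl p (snd x) \<noteq> fst x"
proof
  assume e: "pl p (snd x) = fst x"
  have h: "snd bt \<le> snd x" "snd x \<le> snd tp" using heights[OF assms(2)] by auto
  show False
  proof (rule path_cases[OF assms(1) h])
    fix v assume "v \<in> set p" "snd v = snd x" "pl p (snd x) = fst v"
    then have "v = x" using e by (simp add: prod_eq_iff)
    then show False using assms \<open>v \<in> set p\<close> by simp
  next
    fix a b assume a: "covers D a b" "snd a < snd x" "snd x < snd b"
      "\<And>t. snd a \<le> t \<Longrightarrow> t \<le> snd b \<Longrightarrow> pl p t = segx a b t"
    have "x = (segx a b (snd x), snd x)" using a e by (simp add: prod_eq_iff)
    then show False using edge_vertex[OF a(1) segx_open_segment[OF a(2,3)]] assms(2) by simp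
  qed
qed

lemma path_inc: "path p \<Longrightarrow> x \<in> set p \<Longrightarrow> inc x y \<Longrightarrow> y \<notin> set p"
  using path_le[of p x y] path_le[of p y x] linear[of "snd x" "snd y"] by (auto simp: inc_def)

text \<open>If it failed, a path through \<open>x\<close> and a path through \<open>y\<close> would
  change sides between the heights of \<open>x\<close> and \<open>y\<close>. A common vertex there
  would make the two elements comparable. Consequently the choice of the path in \<open>lft\<close>
  is immaterial.\<close>

lemma side_iff:
  assumes p: "path p" "y \<in> set p" and q: "path q" "x \<in> set q" and xy: "inc x y"
  shows "fst x < pl p (snd x) \<longleftrightarrow> pl q (snd y) < fst y"
proof (rule ccontr)
  assume n: "\<not> ?thesis"
  have ne: "pl p (snd x) \<noteq> fst x" "pl q (snd y) \<noteq> fst y"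
    using off_path[OF p(1), of x] off_path[OF q(1), of y] path_inc[OF p(1,2) inc_sym[OF xy]] path_inc[OF q xy] xy
    by (auto simp: inc_def)
  have v: "pl q (snd x) = fst x" "pl p (snd y) = fst y" using path_vertex p q by auto
  have hx: "snd bt \<le> snd x" "snd x \<le> snd tp" and hy: "snd bt \<le> snd y" "snd y \<le> snd tp"
    using heights xy by (auto simp: inc_def)
  show False
  proof (cases "snd x \<le> snd y")
    case True
    obtain z where z: "z \<in> set p" "z \<in> set q" "snd x \<le> snd z" "snd z \<le> snd y"
      using crossing[OF p(1) q(1) hx(1) True hy(2)] n ne v by fastforce
    then have "le D x z" "le D z y" using path_le p q by blast+
    then show False using le_trans path_carrier[OF p(1) z(1)] xy unfolding inc_def by blast
  next
    case False
    then have yx: "snd y \<le> snd x" by simp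
    obtain z where z: "z \<in> set p" "z \<in> set q" "snd y \<le> snd z" "snd z \<le> snd x"
      using crossing[OF p(1) q(1) hy(1) yx hx(2)] n ne v by fastforce
    then have "le D y z" "le D z x" using path_le p q by blast+
    then show False using le_trans path_carrier[OF p(1) z(1)] xy unfolding inc_def by blast
  qed
qed

lemma lft_iff_right:
  assumes "inc x y" "path p" "y \<in> set p" shows "lft x y \<longleftrightarrow> fst x < pl p (snd x)"
proof -
  obtain q where q: "path q" "x \<in> set q" using exists_path assms unfolding inc_def by blast
  show ?thesis using side_iff[OF _ _ q assms(1)] assms unfolding lft_def by blast
qed

lemma lft_iff_left:
  assumes "inc x y" "path q" "x \<in> set q" shows "lft x y \<longleftrightarrow> pl q (snd y) < fst y"
proof -
  obtain p where p: "path p" "y \<in> set p" using exists_path assms unfolding inc_def by blast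
  show ?thesis using side_iff[OF p assms(2,3,1)] lft_iff_right[OF assms(1) p] by simp
qed

lemma lft_inc: "lft x y \<Longrightarrow> inc x y" by (simp add: lft_def)

lemma lft_total:
  assumes "inc x y" shows "lft x y \<longleftrightarrow> \<not> lft y x"
proof -
  obtain p where p: "path p" "y \<in> set p" using exists_path assms unfolding inc_def by blast
  have "x \<notin> set p" using path_inc[OF p inc_sym[OF assms]] .
  then have "pl p (snd x) \<noteq> fst x" using off_path[OF p(1)] assms by (auto simp: inc_def)
  then show ?thesis using lft_iff_right[OF assms p] lft_iff_left[OF inc_sym[OF assms] p] by auto
qed

lemma lft_asym: "lft x y \<Longrightarrow> \<not> lft y x"
  using lft_total lft_inc by blast

text \<open>One path contains both \<open>x\<close> and \<open>x'\<close>, and the side of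
  \<open>y\<close> with respect to this path decides for both.\<close>

lemma lft_move_left:
  assumes "lft x y" "inc x' y" "le D x x' \<or> le D x' x" shows "lft x' y"
proof -
  obtain p where p: "path p" "x \<in> set p" "x' \<in> set p"
    using exists_path2[of x x'] exists_path2[of x' x] assms by (auto simp: lft_def inc_def)
  then show ?thesis using assms lft_iff_left[OF lft_inc[OF assms(1)]] lft_iff_left[OF assms(2)] by blast
qed

lemma lft_move_right:
  assumes "lft x y" "inc x y'" "le D y y' \<or> le D y' y" shows "lft x y'"
proof -
  obtain p where p: "path p" "y \<in> set p" "y' \<in> set p"
    using exists_path2[of y y'] exists_path2[of y' y] assms by (auto simp: lft_def inc_def)
  then show ?thesis using assms lft_iff_right[OF lft_inc[OF assms(1)]] lft_iff_right[OF assms(2)] by blast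
qed

text \<open>A cycle of length three can be rotated so that \<open>y\<close> has the middle height.
  Then paths through \<open>x\<close> and \<open>z\<close> are on opposite sides of \<open>y\<close>
  but in the other order at the height of \<open>z\<close>, so they cross and make \<open>x\<close>
  and \<open>z\<close> comparable.\<close>

lemma lft_cycle_aux:
  assumes l: "lft x y" "lft y z" "lft z x"
    and s: "snd x \<le> snd y \<and> snd y \<le> snd z \<or> snd z \<le> snd y \<and> snd y \<le> snd x"
  shows False
proof -
  obtain p where p: "path p" "x \<in> set p" using exists_path l lft_inc unfolding inc_def by blast
  obtain q where q: "path q" "z \<in> set q" using exists_path l lft_inc unfolding inc_def by blast
  have 1: "pl p (snd y) < fst y" using lft_iff_left[OF lft_inc[OF l(1)] p] l by simp
  have 2: "fst y < pl q (snd y)" using lft_iff_right[OF lft_inc[OF l(2)] q] l by simp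
  have 3: "fst z < pl p (snd z)" using lft_iff_right[OF lft_inc[OF l(3)] p] l by simp
  have 4: "pl q (snd z) = fst z" using path_vertex q by simp
  have c: "x \<in> carrier D" "y \<in> carrier D" "z \<in> carrier D" "\<not> le D x z" "\<not> le D z x"
    using l lft_inc by (auto simp: inc_def)
  note h = heights[OF c(2)] heights[OF c(3)]
  from s show False
  proof
    assume s: "snd x \<le> snd y \<and> snd y \<le> snd z"
    then obtain w where w: "w \<in> set p" "w \<in> set q" "snd y \<le> snd w" "snd w \<le> snd z"
      using crossing[OF p(1) q(1), of "snd y" "snd z"] h 1 2 3 4 by auto
    then have "le D x w" "le D w z" using path_le[OF p] path_le[OF q(1) _ q(2)] s by auto
    then show False using le_trans c path_carrier[OF p(1) w(1)] by blast
  next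
    assume s: "snd z \<le> snd y \<and> snd y \<le> snd x"
    then obtain w where w: "w \<in> set p" "w \<in> set q" "snd z \<le> snd w" "snd w \<le> snd y"
      using crossing[OF p(1) q(1), of "snd z" "snd y"] h 1 2 3 4 by auto
    then have "le D z w" "le D w x" using path_le[OF q] path_le[OF p(1) _ p(2)] s by auto
    then show False using le_trans c path_carrier[OF p(1) w(1)] by blast
  qed
qed

lemma lft_trans: assumes l: "lft x y" "lft y z" shows "lft x z"
proof -
  have c: "x \<in> carrier D" "z \<in> carrier D" using l lft_inc by (auto simp: inc_def)
  have "inc x z"
  proof (rule ccontr)
    assume "\<not> inc x z"
    then obtain p where p: "path p" "x \<in> set p" "z \<in> set p"
      using exists_path2[of x z] exists_path2[of z x] c by (auto simp: inc_def)
    then show False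
      using lft_iff_left[OF lft_inc[OF l(1)] p(1,2)] lft_iff_right[OF lft_inc[OF l(2)] p(1,3)] l by simp
  qed
  moreover have "\<not> lft z x"
    using lft_cycle_aux[OF l] lft_cycle_aux[OF l(2) _ l(1)] lft_cycle_aux[OF _ l] by force
  ultimately show ?thesis using lft_total by blast
qed

text \<open>A covering leaves no room for a vertex of the path strictly between its ends, so a path
  through both ends runs along this edge.\<close>

lemma edge_on_path:
  assumes ab: "covers D a b" and p: "path p" "a \<in> set p" "b \<in> set p"
    and h: "snd a \<le> h" "h \<le> snd b"
  shows "pl p h = segx a b h"
proof -
  have c: "a \<in> carrier D" "b \<in> carrier D" "le D a b" "a \<noteq> b"
    "\<And>c. c \<in> carrier D \<Longrightarrow> le D a c \<Longrightarrow> le D c b \<Longrightarrow> c = a \<or> c = b"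
    using ab by (auto simp: covers_iff)
  have hh: "snd bt \<le> h" "h \<le> snd tp" using h heights[OF c(1)] heights[OF c(2)] by auto
  consider "h = snd a" | "h = snd b" | "snd a < h" "h < snd b" using h by linarith
  then show ?thesis
  proof cases
    case 3
    show ?thesis
    proof (rule path_cases[OF p(1) hh])
      fix v assume v: "v \<in> set p" "snd v = h"
      then have "le D a v" "le D v b" using path_le[OF p(1)] p 3 by auto
      then have "v = a \<or> v = b" using c(5) path_carrier[OF p(1) v(1)] by blast
      then show ?thesis using v 3 by auto
    next
      fix a' b' assume a: "a' \<in> set p" "b' \<in> set p" "covers D a' b'" "snd a' < h" "h < snd b'"
        and e: "\<And>t. snd a' \<le> t \<Longrightarrow> t \<le> snd b' \<Longrightarrow> pl p t = segx a' b' t"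
      have c': "\<And>c. c \<in> carrier D \<Longrightarrow> le D a' c \<Longrightarrow> le D c b' \<Longrightarrow> c = a' \<or> c = b'"
        using a(3) by (auto simp: covers_iff)
      have "le D a' b" "le D a b'" using path_le[OF p(1)] p a 3 by auto
      have 1: "a' = a \<or> snd a' < snd a"
      proof (cases "snd a \<le> snd a'")
        case True
        then have "le D a a'" using path_le[OF p(1)] p a by auto
        then have "a' = a \<or> a' = b" using c(5) path_carrier[OF p(1) a(1)] \<open>le D a' b\<close> by blast
        then show ?thesis using a 3 by auto
      qed simp
      have 2: "b' = b \<or> snd b < snd b'"
      proof (cases "snd b' \<le> snd b")
        case True
        then have "le D b' b" using path_le[OF p(1)] p a by auto
        then have "b' = a \<or> b' = b" using c(5) path_carrier[OF p(1) a(2)] \<open>le D a b'\<close> by blast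
        then show ?thesis using a 3 by auto
      qed simp
      have "a = a' \<or> a = b'" using c'[OF c(1)] 1 path_le[OF p(1) a(1) p(2)] \<open>le D a b'\<close> le_refl[OF c(1)] by fastforce
      moreover have "b = a' \<or> b = b'" using c'[OF c(2)] 2 path_le[OF p(1) p(3) a(2)] \<open>le D a' b\<close> le_refl[OF c(2)] by fastforce
      ultimately have "a = a'" "b = b'" using a 3 c(4) by auto
      then show ?thesis using e h by auto
    qed
  qed (use path_vertex[OF p(1)] p segx_ends covers_rise[OF ab] in auto)
qed

text \<open>The boundary chains and similarity speak of sides of single edges; this translates them
  into \<open>lft\<close>, by means of a path that contains the edge.\<close>

lemma left_of_edge:
  assumes ab: "covers D a b" and z: "z \<in> carrier D" "snd a \<le> snd z" "snd z \<le> snd b"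
  shows "left_of_line z a b \<longleftrightarrow> lft z a \<or> lft z b" "right_of_line z a b \<longleftrightarrow> lft a z \<or> lft b z"
proof -
  have r: "snd a < snd b" using covers_rise[OF ab] .
  have c: "a \<in> carrier D" "b \<in> carrier D" "le D a b" "\<And>c. c \<in> carrier D \<Longrightarrow> le D a c \<Longrightarrow> le D c b \<Longrightarrow> c = a \<or> c = b"
    using ab by (auto simp: covers_iff)
  obtain p where p: "path p" "a \<in> set p" "b \<in> set p" using exists_path2 c by blast
  have e: "pl p (snd z) = segx a b (snd z)" using edge_on_path[OF ab p z(2,3)] .
  note ll = left_of_line_iff[OF r, of z] right_of_line_iff[OF r, of z]
  show "left_of_line z a b \<longleftrightarrow> lft z a \<or> lft z b" "right_of_line z a b \<longleftrightarrow> lft a z \<or> lft b z"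
  proof -
    consider "z = a \<or> z = b" | "inc z a \<or> inc z b"
    proof (cases "inc z a \<or> inc z b")
      case False
      then have "le D z a \<or> le D a z" "le D z b \<or> le D b z" using z c by (auto simp: inc_def)
      moreover have "z = a" if "le D z a" using less_rise[OF that _ z(1) c(1)] z(2) by auto
      moreover have "z = b" if "le D b z" using less_rise[OF that _ c(2) z(1)] z(3) by auto
      ultimately show ?thesis using that(1) c(4)[OF z(1)] by blast
    qed (use that in auto)
    then show "left_of_line z a b \<longleftrightarrow> lft z a \<or> lft z b" "right_of_line z a b \<longleftrightarrow> lft a z \<or> lft b z"
    proof (atomize(full), cases)
      case 1
      then have "\<not> inc z a" "\<not> inc z b" using c(3) le_refl[OF c(1)] le_refl[OF c(2)] by (auto simp: inc_def)
      then have "\<not> lft z a" "\<not> lft z b" "\<not> lft a z" "\<not> lft b z" using lft_inc inc_sym by blast+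
      moreover have "segx a b (snd z) = fst z" using 1 segx_ends(1)[of a b] segx_ends(2)[OF r] by auto
      ultimately show "(left_of_line z a b \<longleftrightarrow> lft z a \<or> lft z b) \<and> (right_of_line z a b \<longleftrightarrow> lft a z \<or> lft b z)"
        using ll by simp
    next
      case 2
      have "lft z w \<longleftrightarrow> fst z < segx a b (snd z)" "lft w z \<longleftrightarrow> segx a b (snd z) < fst z"
        if "inc z w" "w \<in> {a, b}" for w
        using lft_iff_right[OF that(1) p(1)] lft_iff_left[OF inc_sym[OF that(1)] p(1)] that p e by auto
      moreover have "\<not> lft z w" "\<not> lft w z" if "\<not> inc z w" for w
        using that lft_inc inc_sym by blast+
      ultimately show "(left_of_line z a b \<longleftrightarrow> lft z a \<or> lft z b) \<and> (right_of_line z a b \<longleftrightarrow> lft a z \<or> lft b z)"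
        using ll 2 by (metis insertI1 insertI2)
    qed
  qed
qed

lemma left_of_line_right_of_line:
  "left_of_line b a c \<longleftrightarrow> right_of_line c a b" "left_of_line b c a \<longleftrightarrow> right_of_line c b a"
  by (auto simp: left_of_line_def right_of_line_def algebra_simps)

lemma upper_covers_left:
  assumes "covers D a b" "covers D a c"
  shows "left_of_line b a c \<longleftrightarrow> lft b c"
proof -
  have k: "b \<in> carrier D" "c \<in> carrier D" "snd a < snd b" "snd a < snd c"
     "le D a b" "le D a c" using assms covers_rise by (auto simp: covers_iff)
  then have n: "\<not> lft b a" "\<not> lft a c" using k lft_inc unfolding inc_def by blast+
  show ?thesis
  proof (cases "snd b \<le> snd c")
    case True then show ?thesis using left_of_edge(1)[OF assms(2) k(1)] k n by auto
  next
    case False then show ?thesis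
      using left_of_edge(2)[OF assms(1) k(2)] k n left_of_line_right_of_line(1) by auto
  qed
qed

lemma lower_covers_left:
  assumes "covers D b a" "covers D c a"
  shows "left_of_line b c a \<longleftrightarrow> lft b c"
proof -
  have k: "b \<in> carrier D" "c \<in> carrier D" "snd b < snd a" "snd c < snd a"
     "le D b a" "le D c a" using assms covers_rise by (auto simp: covers_iff)
  then have n: "\<not> lft b a" "\<not> lft a c" using k lft_inc unfolding inc_def by blast+
  show ?thesis
  proof (cases "snd c \<le> snd b")
    case True then show ?thesis using left_of_edge(1)[OF assms(2) k(1)] k n by auto
  next
    case False then show ?thesis
      using left_of_edge(2)[OF assms(1) k(2)] k n left_of_line_right_of_line(2) by auto
  qed
qed

text \<open>
  If \<open>x, y\<close> and \<open>u, v\<close> are incomparable pairs, with \<open>x\<close> left of \<open>y\<close> and \<open>u\<close> left of \<open>v\<close>, then a path through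
  \<open>x, v\<close> and a path through \<open>y, u\<close> must cross, and they can do so only in a common vertex.
\<close>

lemma interpolation:
  assumes c: "{x, y, u, v} \<subseteq> carrier D" and l: "le D x u" "le D x v" "le D y u" "le D y v"
  shows "\<exists>z\<in>carrier D. le D x z \<and> le D y z \<and> le D z u \<and> le D z v"
proof (cases "inc x y \<and> inc u v")
  case False
  have k: "x \<in> carrier D" "y \<in> carrier D" "u \<in> carrier D" "v \<in> carrier D" using c by auto
  then have "le D x y \<or> le D y x \<or> le D u v \<or> le D v u" using False by (auto simp: inc_def)
  then show ?thesis using k l le_refl by metis
next
  case True
  have *: "\<exists>z\<in>carrier D. le D x z \<and> le D y z \<and> le D z u \<and> le D z v"
    if h: "x \<in> carrier D" "y \<in> carrier D" "u \<in> carrier D" "v \<in> carrier D"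
      "le D x u" "le D x v" "le D y u" "le D y v" "lft x y" "lft u v" for x y u v
  proof -
    obtain p where p: "path p" "y \<in> set p" "u \<in> set p" using exists_path2 h by blast
    obtain q where q: "path q" "x \<in> set q" "v \<in> set q" using exists_path2 h by blast
    have 1: "pl q (snd x) < pl p (snd x)"
      using lft_iff_right[OF lft_inc[OF h(9)] p(1,2)] h path_vertex[OF q(1,2)] by simp
    have 2: "pl p (snd v) < pl q (snd v)"
      using lft_iff_left[OF lft_inc[OF h(10)] p(1,3)] h path_vertex[OF q(1,3)] by simp
    obtain z where z: "z \<in> set p" "z \<in> set q" "snd x \<le> snd z" "snd z \<le> snd v"
      using crossing[OF p(1) q(1), of "snd x" "snd v"] 1 2 heights[OF h(1)] heights[OF h(4)] le_rise[OF h(6,1,4)] by auto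
    then have xz: "le D x z" "le D z v" using path_le[OF q(1)] q by auto
    have zc: "z \<in> carrier D" using path_carrier p z by auto
    have nx: "\<not> le D x y" "\<not> le D u v" using lft_inc[OF h(9)] lft_inc[OF h(10)] by (auto simp: inc_def)
    have "\<not> le D z y" using le_trans[OF xz(1), of y] h zc nx by auto
    then have "le D y z" using path_le[OF p(1) z(1) p(2)] path_le[OF p(1) p(2) z(1)] by fastforce
    moreover have "\<not> le D u z" using le_trans[OF _ xz(2), of u] h zc nx by auto
    then have "le D z u" using path_le[OF p(1) z(1) p(3)] path_le[OF p(1) p(3) z(1)] by fastforce
    ultimately show ?thesis using xz zc by auto
  qed
  have k: "x \<in> carrier D" "y \<in> carrier D" "u \<in> carrier D" "v \<in> carrier D" using c by auto
  have "lft x y \<or> lft y x" "lft u v \<or> lft v u" using True lft_total by auto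
  then show ?thesis
    using *[OF k l] *[OF k(1,2,4,3) l(2,1,4,3)] *[OF k(2,1,3,4) l(3,4,1,2)] *[OF k(2,1,4,3) l(4,3,2,1)] by blast
qed

text \<open>The relation \<open>R\<close> is abstract so that \<open>lft\<close> gives the left
  chain and its converse the right one.\<close>

lemma boundary_chain_iff:
  fixes R :: "point \<Rightarrow> point \<Rightarrow> bool" and S :: "point \<Rightarrow> point \<Rightarrow> point \<Rightarrow> bool"
  assumes R_inc: "\<And>x y. R x y \<Longrightarrow> inc x y" and R_total: "\<And>x y. inc x y \<Longrightarrow> R x y \<or> R y x"
    and R_asym: "\<And>x y. R x y \<Longrightarrow> \<not> R y x" and R_trans: "\<And>x y z. R x y \<Longrightarrow> R y z \<Longrightarrow> R x z"
    and S: "\<And>a b z. covers D a b \<Longrightarrow> z \<in> carrier D \<Longrightarrow> snd a \<le> snd z \<Longrightarrow> snd z \<le> snd b \<Longrightarrow> S z a b \<longleftrightarrow> R z a \<or> R z b"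
  shows "pred_on.maxchain (carrier D) (le D) C \<and>
     \<not> (\<exists>p\<in>carrier D. \<exists>a\<in>C. \<exists>b\<in>C. covers D a b \<and> snd a \<le> snd p \<and> snd p \<le> snd b \<and> S p a b) \<longleftrightarrow>
     C = {x\<in>carrier D. \<not> (\<exists>z. R z x)}" (is "?M C \<and> \<not> ?S \<longleftrightarrow> C = ?B")
proof -
  have ch: "pred_on.chain (carrier D) (le D) X \<longleftrightarrow> X \<subseteq> carrier D \<and> (\<forall>x\<in>X. \<forall>y\<in>X. \<not> inc x y)" for X
    using le_refl unfolding pred_on.chain_def inc_def by blast
  have chB: "pred_on.chain (carrier D) (le D) ?B"
    unfolding ch using R_total by blast
  \<comment> \<open>The relation is a strict order on a finite set, so above every non-extreme
    element of it there is an extreme one to which it is related.\<close>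
  have extreme: "y \<in> ?B \<or> (\<exists>z\<in>?B. R z y)" if "y \<in> carrier D" for y
    using that
  proof (induction "card {w\<in>carrier D. R w y}" arbitrary: y rule: less_induct)
    case less
    show ?case
    proof (cases "y \<in> ?B")
      case False
      then obtain z where z: "R z y" using less by auto
      then have zc: "z \<in> carrier D" using R_inc by (auto simp: inc_def)
      have "{w\<in>carrier D. R w z} \<subset> {w\<in>carrier D. R w y}"
        using z zc R_trans R_asym by blast
      then have "card {w\<in>carrier D. R w z} < card {w\<in>carrier D. R w y}"
        using fin by (intro psubset_card_mono) auto
      from less(1)[OF this zc] show ?thesis using z R_trans by blast
    qed simp
  qed
  have mB: "?M ?B"
    unfolding pred_on.maxchain_def
  proof (intro conjI chB notI)
    assume "\<exists>X. pred_on.chain (carrier D) (le D) X \<and> ?B \<subset> X"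
    then obtain X y where X: "X \<subseteq> carrier D" "\<forall>x\<in>X. \<forall>y\<in>X. \<not> inc x y" "?B \<subseteq> X" "y \<in> X" "y \<notin> ?B"
      unfolding ch by blast
    then obtain z where "z \<in> ?B" "R z y" using extreme by blast
    then show False using X R_inc by blast
  qed
  show ?thesis
  proof
    assume "C = ?B"
    moreover have "\<not> (\<exists>p\<in>carrier D. \<exists>a\<in>?B. \<exists>b\<in>?B. covers D a b \<and> snd a \<le> snd p \<and> snd p \<le> snd b \<and> S p a b)"
      using S by blast
    ultimately show "?M C \<and> \<not> ?S" using mB by simp
  next
    assume C: "?M C \<and> \<not> ?S"
    have cC: "C \<subseteq> carrier D" "\<And>x y. x \<in> C \<Longrightarrow> y \<in> C \<Longrightarrow> \<not> inc x y"
      using C ch unfolding pred_on.maxchain_def by blast+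
    have max: "e \<in> C" if "e \<in> carrier D" "\<And>x. x \<in> C \<Longrightarrow> \<not> inc x e" for e
    proof (rule ccontr)
      assume "e \<notin> C"
      then have "C \<subset> insert e C" by blast
      moreover have "pred_on.chain (carrier D) (le D) (insert e C)"
        unfolding ch
      proof (intro conjI ballI)
        have ee: "\<not> inc e e" using le_refl[OF that(1)] by (auto simp: inc_def)
        show "\<not> inc x y" if "x \<in> insert e C" "y \<in> insert e C" for x y
          using that ee cC(2) \<open>\<And>x. x \<in> C \<Longrightarrow> \<not> inc x e\<close> inc_sym by blast
      qed (use cC that in auto)
      ultimately show False using C unfolding pred_on.maxchain_def by blast
    qed
    have cmp: "le D x y" if "x \<in> C" "y \<in> C" "snd x \<le> snd y" for x y
    proof -
      have c: "x \<in> carrier D" "y \<in> carrier D" using that cC by auto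
      have "le D x y \<or> le D y x" using cC(2)[OF that(1,2)] c by (auto simp: inc_def)
      moreover have "x = y" if "le D y x" using less_rise[OF that _ c(2,1)] \<open>snd x \<le> snd y\<close> by fastforce
      ultimately show ?thesis using le_refl[OF c(1)] by auto
    qed
    have "C \<subseteq> ?B"
    proof
      fix c assume c: "c \<in> C"
      show "c \<in> ?B"
      proof (rule ccontr)
        assume "c \<notin> ?B"
        then obtain z where z: "R z c" using c cC by auto
        then have zc: "inc z c" "z \<in> carrier D" using R_inc by (auto simp: inc_def)
        then have zC: "z \<notin> C" using cC(2) c by blast
        have bC: "bt \<in> C" "tp \<in> C" using max[OF bt] max[OF tp] bt_le le_tp cC by (auto simp: inc_def)
        have fC: "finite C" using cC fin finite_subset by blast
        let ?L = "{x\<in>C. snd x \<le> snd z}" and ?U = "{x\<in>C. snd z < snd x}"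
        have "z \<noteq> tp" using zC bC by auto
        then have "snd z < snd tp" using less_rise[OF le_tp[OF zc(2)] _ zc(2) tp] by auto
        then have "bt \<in> ?L" "tp \<in> ?U" using bC heights[OF zc(2)] by auto
        then have LU: "finite (snd ` ?L)" "snd ` ?L \<noteq> {}" "finite (snd ` ?U)" "snd ` ?U \<noteq> {}"
          using fC by (simp, blast, simp, blast)
        \<comment> \<open>The elements \<open>a\<close> and \<open>b\<close> of \<open>C\<close> are
          the nearest ones below and above the height of \<open>z\<close>. Maximality of
          \<open>C\<close> makes them a covering pair, and \<open>z\<close> must be incomparable to
          one of them, hence beyond that edge.\<close>
        obtain a where a: "a \<in> ?L" "snd a = Max (snd ` ?L)" using Max_in[OF LU(1,2)] by (metis (no_types, lifting) imageE)
        obtain b where b: "b \<in> ?U" "snd b = Min (snd ` ?U)" using Min_in[OF LU(3,4)] by (metis (no_types, lifting) imageE)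
        have La: "snd x \<le> snd a" if "x \<in> ?L" for x using that LU(1) a(2) by simp
        have Ub: "snd b \<le> snd x" if "x \<in> ?U" for x using that LU(3) b(2) by simp
        have ab: "a \<in> carrier D" "b \<in> carrier D" "snd a \<le> snd z" "snd z < snd b" "a \<in> C" "b \<in> C"
          using a b cC by auto
        have lab: "le D a b" using cmp ab by auto
        have cov: "covers D a b" unfolding covers_iff
        proof (intro conjI ballI impI)
          show "a \<noteq> b" using ab by auto
          fix e assume e: "e \<in> carrier D" "le D a e \<and> le D e b"
          have "\<not> inc x e" if x: "x \<in> C" for x
          proof (cases "snd x \<le> snd z")
            case True
            then have "le D x a" using La[of x] x cmp ab by auto
            then show ?thesis using le_trans[of x a e] x cC ab e by (auto simp: inc_def)
          next
            case False
            then have "le D b x" using Ub[of x] x cmp ab by auto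
            then show ?thesis using le_trans[of e b x] x cC ab e by (auto simp: inc_def)
          qed
          then have eC: "e \<in> C" using max e by blast
          show "e = a \<or> e = b"
          proof (cases "snd e \<le> snd z")
            case True
            then have "le D e a" using La[of e] eC cmp ab by auto
            then show ?thesis using le_antisym e ab by auto
          next
            case False
            then have "le D b e" using Ub[of e] eC cmp ab by auto
            then show ?thesis using le_antisym e ab by auto
          qed
        qed (use ab lab in auto)
        have "inc z a \<or> inc z b"
        proof (rule ccontr)
          assume n: "\<not> ?thesis"
          have "\<not> le D z a" using less_rise[of z a] zc ab zC by force
          moreover have "\<not> le D b z" using le_rise[of b z] zc ab by force
          ultimately have "le D a z" "le D z b" using n zc ab by (auto simp: inc_def)
          then show False using cov zc(2) zC ab unfolding covers_iff by blast
        qed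
        moreover have "R z w" if "inc z w" "w \<in> C" for w
          using R_total[OF that(1)] R_trans[OF _ z, of w] R_inc[of w c] cC(2)[OF that(2) c] by blast
        ultimately have "R z a \<or> R z b" using ab by blast
        then have "S z a b" using S[OF cov zc(2)] ab by auto
        then show False using C cov ab zc by fastforce
      qed
    qed
    moreover have "\<not> C \<subset> ?B" using C chB unfolding pred_on.maxchain_def by blast
    ultimately show "C = ?B" by blast
  qed
qed

lemma boundary_eq:
  "boundary D = {x\<in>carrier D. \<not> (\<exists>z. lft z x)} \<union> {x\<in>carrier D. \<not> (\<exists>z. lft x z)}"
proof -
  have "left_boundary_chain D C \<longleftrightarrow> C = {x\<in>carrier D. \<not> (\<exists>z. lft z x)}" for C
    unfolding left_boundary_chain_def
    by (rule boundary_chain_iff[where R = lft])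
      (use lft_inc lft_total lft_asym lft_trans left_of_edge(1) in blast)+
  moreover have "right_boundary_chain D C \<longleftrightarrow> C = {x\<in>carrier D. \<not> (\<exists>z. lft x z)}" for C
    unfolding right_boundary_chain_def
    by (rule boundary_chain_iff[where R = "\<lambda>x y. lft y x"])
      (use lft_inc inc_sym lft_total lft_asym lft_trans left_of_edge(2) in blast)+
  ultimately show ?thesis by (simp add: boundary_def)
qed

end


section \<open>Coordinatized diagrams\<close>

lemma join_eqI:
  assumes "partial_order D" "s \<in> carrier D" "x \<in> carrier D" "y \<in> carrier D" "le D x s" "le D y s"
    "\<And>w. w \<in> carrier D \<Longrightarrow> le D x w \<Longrightarrow> le D y w \<Longrightarrow> le D s w"
  shows "join D x y = s" "least D s (Upper D {x, y})"
proof -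
  interpret partial_order D by fact
  show l: "least D s (Upper D {x, y})"
    using assms by (auto simp: least_def Upper_def)
  then show "join D x y = s"
    unfolding join_def Lattice.sup_def using least_unique by (metis (mono_tags, lifting) someI_ex)
qed

lemma meet_eqI:
  assumes "partial_order D" "s \<in> carrier D" "x \<in> carrier D" "y \<in> carrier D" "le D s x" "le D s y"
    "\<And>w. w \<in> carrier D \<Longrightarrow> le D w x \<Longrightarrow> le D w y \<Longrightarrow> le D w s"
  shows "meet D x y = s" "greatest D s (Lower D {x, y})"
proof -
  interpret partial_order D by fact
  show l: "greatest D s (Lower D {x, y})"
    using assms by (auto simp: greatest_def Lower_def)
  then show "meet D x y = s"
    unfolding meet_def Lattice.inf_def using greatest_unique by (metis (mono_tags, lifting) someI_ex)
qed

section \<open>Orders isomorphic to the grid\<close>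

locale order_model = perm_set P T for P T +
  fixes D :: "'a gorder" and \<phi> :: "'a \<Rightarrow> point"
  assumes po: "partial_order D"
    and bij: "bij_betw \<phi> (carrier D) (grid P)"
    and le_iff: "x \<in> carrier D \<Longrightarrow> y \<in> carrier D \<Longrightarrow> le D x y \<longleftrightarrow> \<phi> x \<le> \<phi> y"
begin

lemma phi_grid: "x \<in> carrier D \<Longrightarrow> \<phi> x \<in> grid P"
  using bij by (auto simp: bij_betw_def)

lemma phi_inj: "x \<in> carrier D \<Longrightarrow> y \<in> carrier D \<Longrightarrow> \<phi> x = \<phi> y \<longleftrightarrow> x = y"
  using bij by (auto simp: bij_betw_def inj_on_def)

lemma phi_surj: assumes "z \<in> grid P" obtains x where "x \<in> carrier D" "\<phi> x = z"
proof -
  have "z \<in> \<phi> ` carrier D" using bij assms by (simp add: bij_betw_def)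
  then show thesis using that by (metis imageE)
qed

lemma carrier_finite: "finite (carrier D)"
  using bij finite_grid bij_betw_finite by blast

lemma covers_cov: "covers D a b \<longleftrightarrow> a \<in> carrier D \<and> b \<in> carrier D \<and> cov (\<phi> a) (\<phi> b)"
proof (cases "a \<in> carrier D \<and> b \<in> carrier D")
  case True
  have "(\<forall>c\<in>carrier D. le D a c \<and> le D c b \<longrightarrow> c = a \<or> c = b) \<longleftrightarrow>
    (\<forall>z\<in>grid P. \<phi> a \<le> z \<and> z \<le> \<phi> b \<longrightarrow> z = \<phi> a \<or> z = \<phi> b)"
  proof -
    have "grid P = \<phi> ` carrier D" using bij by (auto simp: bij_betw_def)
    then show ?thesis using True by (simp add: le_iff phi_inj)
  qed
  then show ?thesis using True by (simp add: po_covers[OF po] cov_def le_iff phi_grid phi_inj)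
qed (auto simp: po_covers[OF po])

lemma
  assumes "x \<in> carrier D" "y \<in> carrier D"
  shows join_carrier: "join D x y \<in> carrier D" and phi_join: "\<phi> (join D x y) = pjoin (\<phi> x) (\<phi> y)"
    and join_exists: "\<exists>s. least D s (Upper D {x, y})"
proof -
  have g: "\<phi> x \<in> grid P" "\<phi> y \<in> grid P" using assms phi_grid by auto
  obtain s where s: "s \<in> carrier D" "\<phi> s = pjoin (\<phi> x) (\<phi> y)"
    using phi_surj[OF pjoin_grid[OF g]] by metis
  have c: "le D x s" "le D y s" "\<And>w. w \<in> carrier D \<Longrightarrow> le D x w \<Longrightarrow> le D y w \<Longrightarrow> le D s w"
    using assms s pjoin_ge[OF g] pjoin_least phi_grid by (auto simp: le_iff)
  from join_eqI[OF po s(1) assms c] s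
  show "join D x y \<in> carrier D" "\<phi> (join D x y) = pjoin (\<phi> x) (\<phi> y)"
    "\<exists>s. least D s (Upper D {x, y})" by auto
qed

lemma
  assumes "x \<in> carrier D" "y \<in> carrier D"
  shows meet_carrier: "meet D x y \<in> carrier D" and phi_meet: "\<phi> (meet D x y) = pmin (\<phi> x) (\<phi> y)"
    and meet_exists: "\<exists>s. greatest D s (Lower D {x, y})"
proof -
  have g: "\<phi> x \<in> grid P" "\<phi> y \<in> grid P" using assms phi_grid by auto
  obtain s where s: "s \<in> carrier D" "\<phi> s = pmin (\<phi> x) (\<phi> y)"
    using phi_surj[OF grid_pmin[OF g]] by metis
  have c: "le D s x" "le D s y" "\<And>w. w \<in> carrier D \<Longrightarrow> le D w x \<Longrightarrow> le D w y \<Longrightarrow> le D w s"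
    using assms s by (auto simp: le_iff)
  from meet_eqI[OF po s(1) assms c] s
  show "meet D x y \<in> carrier D" "\<phi> (meet D x y) = pmin (\<phi> x) (\<phi> y)"
    "\<exists>s. greatest D s (Lower D {x, y})" by auto
qed

lemma finite_lattice: "finite_lattice D"
proof -
  interpret partial_order D by (rule po)
  have "lattice D" by unfold_locales (use join_exists meet_exists in auto)
  moreover have "carrier D \<noteq> {}" using phi_surj[OF T_grid] by blast
  ultimately show ?thesis by (simp add: finite_lattice_def carrier_finite)
qed

lemma semimodular: "semimodular D"
  unfolding semimodular_def
proof (intro allI impI)
  fix a b c assume h: "covers D a b \<and> c \<in> carrier D"
  then have c: "a \<in> carrier D" "b \<in> carrier D" "c \<in> carrier D" "cov (\<phi> a) (\<phi> b)" by (auto simp: covers_cov)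
  from semimodular_grid[OF c(4) phi_grid[OF c(3)]]
  show "covers D (join D a c) (join D b c) \<or> join D a c = join D b c"
    using c join_carrier by (simp add: covers_cov phi_join phi_inj[symmetric])
qed

lemma distributive:
  assumes "\<And>v. \<not> middle P v" shows "distributive D"
  unfolding distributive_def
proof (intro ballI)
  fix a b c assume "a \<in> carrier D" "b \<in> carrier D" "c \<in> carrier D"
  then show "meet D a (join D b c) = join D (meet D a b) (meet D a c)"
    by (subst phi_inj[symmetric])
      (simp_all add: meet_carrier join_carrier phi_meet phi_join phi_grid distrib_grid[OF assms])
qed

text \<open>Every element is the join of the least grid element with at least its first coordinate
  and the least one with at least its second coordinate. So each join-irreducible element is of one
  of these kinds. Each kind forms a chain, and among three elements two are of the same
  kind.\<close>

lemma slim: "slim D"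
proof -
  define al where "al z = pinf {u\<in>P. fst z \<le> fst u}" for z :: point
  define be where "be z = pinf {u\<in>P. snd z \<le> snd u}" for z :: point
  have al: "al z \<in> grid P" "fst z \<le> fst (al z)" "\<And>w. w \<in> grid P \<Longrightarrow> fst z \<le> fst w \<Longrightarrow> al z \<le> w"
    if "z \<in> grid P" for z
  proof -
    have n: "{u\<in>P. fst z \<le> fst u} \<noteq> {}" using grid_le_T[OF that] T_in unfolding le_point by blast
    show "al z \<in> grid P" unfolding al_def by (rule pinf_grid) (use n in auto)
    show "al z \<le> w" if "w \<in> grid P" "fst z \<le> fst w" for w
      unfolding al_def using that by (intro le_pinf_grid) (auto simp: le_point)
    show "fst z \<le> fst (al z)"
      by (rule pinf_attained[OF _ n]) (use fin in \<open>auto simp: al_def\<close>)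
  qed
  have be: "be z \<in> grid P" "snd z \<le> snd (be z)" "\<And>w. w \<in> grid P \<Longrightarrow> snd z \<le> snd w \<Longrightarrow> be z \<le> w"
    if "z \<in> grid P" for z
  proof -
    have n: "{u\<in>P. snd z \<le> snd u} \<noteq> {}" using grid_le_T[OF that] T_in unfolding le_point by blast
    show "be z \<in> grid P" unfolding be_def by (rule pinf_grid) (use n in auto)
    show "be z \<le> w" if "w \<in> grid P" "snd z \<le> snd w" for w
      unfolding be_def using that by (intro le_pinf_grid) (auto simp: le_point)
    show "snd z \<le> snd (be z)"
      by (rule pinf_attained[OF _ n]) (use fin in \<open>auto simp: be_def\<close>)
  qed
  have ji: "\<phi> x = al (\<phi> x) \<or> \<phi> x = be (\<phi> x)" if x: "x \<in> Ji D" for x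
  proof -
    have xc: "x \<in> carrier D" using x by (auto simp: Ji_def)
    let ?z = "\<phi> x"
    have z: "?z \<in> grid P" using phi_grid xc by auto
    obtain a where a: "a \<in> carrier D" "\<phi> a = al ?z" using phi_surj[OF al(1)[OF z]] by metis
    obtain b where b: "b \<in> carrier D" "\<phi> b = be ?z" using phi_surj[OF be(1)[OF z]] by metis
    have "pjoin (al ?z) (be ?z) = ?z"
    proof (rule antisym)
      show "pjoin (al ?z) (be ?z) \<le> ?z" using al(3)[OF z z] be(3)[OF z z] z by (intro pjoin_least) auto
      show "?z \<le> pjoin (al ?z) (be ?z)"
        using pjoin_ge[OF al(1)[OF z] be(1)[OF z]] al(2)[OF z] be(2)[OF z] by (auto simp: le_point)
    qed
    then have "\<phi> x = \<phi> (join D a b)" using a b by (simp add: phi_join)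
    then have "x = join D a b" using phi_inj xc join_carrier a b by metis
    then have "x = a \<or> x = b" using x a b by (auto simp: Ji_def)
    then show ?thesis using a b by auto
  qed
  have cmp: "\<phi> x \<le> \<phi> y \<or> \<phi> y \<le> \<phi> x"
    if "x \<in> carrier D" "y \<in> carrier D" "(\<phi> x = al (\<phi> x) \<and> \<phi> y = al (\<phi> y)) \<or> (\<phi> x = be (\<phi> x) \<and> \<phi> y = be (\<phi> y))" for x y
    using that al(3)[OF phi_grid phi_grid, of x y] al(3)[OF phi_grid phi_grid, of y x]
      be(3)[OF phi_grid phi_grid, of x y] be(3)[OF phi_grid phi_grid, of y x] by (metis linear)
  have "\<not> (\<exists>X\<subseteq>Ji D. card X = 3 \<and> antichain D X)"
  proof
    assume "\<exists>X\<subseteq>Ji D. card X = 3 \<and> antichain D X"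
    then obtain x y z where X: "{x, y, z} \<subseteq> Ji D" "x \<noteq> y" "y \<noteq> z" "x \<noteq> z" "antichain D {x, y, z}"
      by (auto simp: card_3_iff)
    then have c: "x \<in> carrier D" "y \<in> carrier D" "z \<in> carrier D" by (auto simp: Ji_def)
    then have n: "\<not> \<phi> x \<le> \<phi> y" "\<not> \<phi> y \<le> \<phi> x" "\<not> \<phi> x \<le> \<phi> z" "\<not> \<phi> z \<le> \<phi> x" "\<not> \<phi> y \<le> \<phi> z" "\<not> \<phi> z \<le> \<phi> y"
      using X by (auto simp: antichain_def le_iff[symmetric])
    show False using ji[of x] ji[of y] ji[of z] X(1) n cmp[of x y] cmp[of x z] cmp[of y z] c by auto
  qed
  then show ?thesis using finite_lattice by (simp add: slim_def)
qed

end

section \<open>Cells and cover-preserving grids in coordinates\<close>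

context perm_set
begin

lemma cov_two:
  assumes "cov z x" "cov z y" "fst y < fst x"
  shows "z \<in> grid P - P" "x = upl P z" "y = upr P z"
proof -
  have z: "z \<in> grid P" "z \<noteq> T" "x = upl P z \<or> x = upr P z" "y = upl P z \<or> y = upr P z"
    using assms by (auto simp: cov_iff)
  show zz: "z \<in> grid P - P" using z upl_upr_P[of z] assms(3) by auto
  then have "fst (upr P z) < fst (upl P z)" using fst_upr upl_gt z by auto
  then show "x = upl P z" "y = upr P z" using z assms(3) by auto
qed

lemma cov_cell:
  assumes z: "z \<in> grid P - P" and w: "cov (upl P z) w" "cov (upr P z) w"
  shows "w = upl P (upr P z)"
proof -
  have zz: "z \<in> grid P" "z \<notin> P" "z \<noteq> T" using z notP_T by auto
  have wg: "w \<in> grid P" "upl P z \<le> w" "upr P z \<le> w" using w by (auto simp: cov_def)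
  have "upl P (upr P z) \<le> w"
    using wg upl_gt[OF zz(1,3)] fst_upr[OF zz(1,2)] by (intro upl_least) (auto simp: le_point)
  moreover have "cov (upr P z) (upl P (upr P z))"
    using upr_grid[OF zz(1,3)] upr_not_T[OF zz(1,2)] by (auto simp: cov_iff)
  then have "upl P (upr P z) \<in> grid P" "upr P z \<le> upl P (upr P z)" "upr P z \<noteq> upl P (upr P z)"
    by (auto simp: cov_def)
  moreover have "\<forall>x\<in>grid P. upr P z \<le> x \<and> x \<le> w \<longrightarrow> x = upr P z \<or> x = w"
    using w(2) by (simp add: cov_def)
  ultimately show ?thesis by metis
qed

text \<open>The top of the cell is the right cover of its left corner, so any other cover is the
  left one; having two different covers, the corner is off \<open>P\<close>.\<close>

lemma cov_left_side:
  assumes z: "z \<in> grid P - P" and u: "cov (upl P z) u" "u \<noteq> upl P (upr P z)"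
  shows "upl P z \<in> grid P - P" "u = upl P (upl P z)"
proof -
  have zz: "z \<in> grid P" "z \<notin> P" "z \<noteq> T" using z notP_T by auto
  have l: "upl P z \<in> grid P" "upl P z \<noteq> T" using upl_grid upl_not_T zz by auto
  have w: "upl P (upr P z) = upr P (upl P z)" using upl_upr_commute zz by auto
  have "u = upl P (upl P z) \<or> u = upr P (upl P z)" using u by (simp add: cov_iff)
  then show "u = upl P (upl P z)" using u w by simp
  then show "upl P z \<in> grid P - P" using l u w upl_upr_P[of "upl P z"] by auto
qed

lemma cov_right_side:
  assumes z: "z \<in> grid P - P" and u: "cov (upr P z) u" "u \<noteq> upl P (upr P z)"
  shows "upr P z \<in> grid P - P" "u = upr P (upr P z)"
proof -
  have zz: "z \<in> grid P" "z \<notin> P" "z \<noteq> T" using z notP_T by auto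
  have l: "upr P z \<in> grid P" "upr P z \<noteq> T" using upr_grid upr_not_T zz by auto
  have "u = upl P (upr P z) \<or> u = upr P (upr P z)" using u by (simp add: cov_iff)
  then show "u = upr P (upr P z)" using u by simp
  then show "upr P z \<in> grid P - P" using l u upl_upr_P[of "upr P z"] by auto
qed

end

lemma covers_restrict:
  assumes "partial_order D" "X \<subseteq> carrier D"
  shows "covers (D\<lparr>carrier := X\<rparr>) a b \<longleftrightarrow> a \<in> X \<and> b \<in> X \<and> le D a b \<and> a \<noteq> b \<and>
    (\<forall>c\<in>X. le D a c \<and> le D c b \<longrightarrow> c = a \<or> c = b)"
proof -
  interpret partial_order D by fact
  show ?thesis by (auto simp: covers_def lless_def eq_is_equal)
qed

lemma cp_grid_transpose: "cp_grid D m n g \<Longrightarrow> cp_grid D n m (\<lambda>(i, j). g (j, i))"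
proof -
  assume g: "cp_grid D m n g"
  have "(\<lambda>(i, j). g (j, i)) ` ({..<n} \<times> {..<m}) = g ` ({..<m} \<times> {..<n})" by force
  then show ?thesis using g unfolding cp_grid_def by auto
qed

context order_model
begin

text \<open>Since all bottoms of cells are off \<open>P\<close>, opposite sides of the cells are
  parallel to the axes except possibly on the two upper sides of the grid. Order, meets and joins
  can then be read off from the coordinates.\<close>

lemma cp_gridI:
  fixes m n :: nat
  assumes mn: "0 < m" "0 < n"
    and g: "\<And>i j. i < m \<Longrightarrow> j < n \<Longrightarrow> g (i, j) \<in> carrier D \<and> \<phi> (g (i, j)) = G i j"
    and U: "\<And>i j. Suc i < m \<Longrightarrow> j < n \<Longrightarrow> G (Suc i) j = upl P (G i j) \<and> G i j \<noteq> T"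
    and V: "\<And>i j. i < m \<Longrightarrow> Suc j < n \<Longrightarrow> G i (Suc j) = upr P (G i j) \<and> G i j \<noteq> T"
    and nP: "\<And>i j. Suc i < m \<Longrightarrow> Suc j < n \<Longrightarrow> G i j \<notin> P"
  shows "cp_grid D m n g"
proof -
  have gr: "G i j \<in> grid P" if "i < m" "j < n" for i j using g[OF that] phi_grid by metis
  have up1: "fst (G i j) < fst (G (Suc i) j)" "snd (G i j) \<le> snd (G (Suc i) j)" if "Suc i < m" "j < n" for i j
    using U[OF that] upl_gt gr[of i j] that by auto
  have up2: "fst (G i j) \<le> fst (G i (Suc j))" "snd (G i j) < snd (G i (Suc j))" if "i < m" "Suc j < n" for i j
    using V[OF that] upr_gt gr[of i j] that by auto
  \<comment> \<open>The last value of \<open>i\<close> is excluded: these elements may be in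
    \<open>P\<close>, from where the right cover leaves the column.\<close>
  have fc: "fst (G i j) = fst (G i 0)" if "Suc i < m" "j < n" for i j
    using that
  proof (induction j)
    case (Suc j)
    then have "fst (G i (Suc j)) = fst (G i j)" using V[of i j] nP[of i j] fst_upr gr[of i j] by auto
    then show ?case using Suc by auto
  qed simp
  have sc: "snd (G i j) = snd (G 0 j)" if "i < m" "Suc j < n" for i j
    using that
  proof (induction i)
    case (Suc i)
    then have "snd (G (Suc i) j) = snd (G i j)" using U[of i j] nP[of i j] snd_upl gr[of i j] by auto
    then show ?case using Suc by auto
  qed simp
  have mono1: "G i j \<le> G k j \<and> (i < k \<longrightarrow> fst (G i j) < fst (G k j))" if "i \<le> k" "k < m" "j < n" for i j k
    using that
  proof (induction k rule: dec_induct)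
    case (step k) then show ?case using up1[of k j] by (auto simp: le_point)
  qed simp
  have mono2: "G i j \<le> G i l \<and> (j < l \<longrightarrow> snd (G i j) < snd (G i l))" if "j \<le> l" "i < m" "l < n" for i j l
    using that
  proof (induction l rule: dec_induct)
    case (step l) then show ?case using up2[of i l] by (auto simp: le_point)
  qed simp
  have mono: "G i j \<le> G k l" if "i \<le> k" "j \<le> l" "k < m" "l < n" for i j k l
    using mono1[of i k j] mono2[of j l k] that by (meson le_less_trans order_trans)
  have ord: "G i j \<le> G k l \<longleftrightarrow> i \<le> k \<and> j \<le> l" if b: "i < m" "j < n" "k < m" "l < n" for i j k l
  proof
    assume le: "G i j \<le> G k l"
    show "i \<le> k \<and> j \<le> l"
    proof (rule ccontr)
      assume "\<not> ?thesis"
      then consider "k < i" | "l < j" by linarith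
      then show False
      proof cases
        case 1
        then have "fst (G k l) < fst (G i 0)" using fc[of k l] mono1[of k i 0] b mn by auto
        then show False using le mono2[of 0 j i] b by (auto simp: le_point)
      next
        case 2
        then have "snd (G k l) < snd (G 0 j)" using sc[of k l] mono2[of l j 0] b mn by auto
        then show False using le mono1[of 0 i j] b by (auto simp: le_point)
      qed
    qed
  qed (use mono b in auto)
  have meet: "pmin (G i j) (G k l) = G (min i k) (min j l)" if b: "i < m" "j < n" "k < m" "l < n" for i j k l
  proof -
    have *: "pmin (G i j) (G k l) = G i l" if "i < k" "l < j" "j < n" "k < m" for i j k l
    proof -
      have "fst (G i j) = fst (G i l)" "snd (G k l) = snd (G i l)"
        using fc[of i j] fc[of i l] sc[of k l] sc[of i l] that by auto
      moreover have "G i l \<le> G i j" "G i l \<le> G k l" using mono that by auto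
      ultimately show ?thesis by (auto simp: pmin_def le_point prod_eq_iff min_def)
    qed
    have comm: "pmin x y = pmin y x" for x y :: point by (simp add: pmin_def min.commute)
    have abs: "pmin x y = x" if "x \<le> y" for x y :: point using that by (auto simp: pmin_def le_point prod_eq_iff)
    consider "i \<le> k" "j \<le> l" | "k \<le> i" "l \<le> j" | "i < k" "l < j" | "k < i" "j < l" by linarith
    then show ?thesis
    proof cases
      case 1 then show ?thesis using abs[OF mono[of i k j l]] b by (simp add: min_absorb1)
    next
      case 2 then show ?thesis using abs[OF mono[of k i l j]] b comm by (simp add: min_absorb2)
    next
      case 3 then show ?thesis using *[of i k l j] b by (simp add: min_def)
    next
      case 4 then show ?thesis using *[of k i j l] b comm[of "G i j"] by (simp add: min_def)
    qed
  qed
  have join: "pjoin (G i j) (G k l) = G (max i k) (max j l)" if b: "i < m" "j < n" "k < m" "l < n" for i j k l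
  proof (rule antisym)
    show "pjoin (G i j) (G k l) \<le> G (max i k) (max j l)"
      using b mono gr by (intro pjoin_least) auto
    let ?w = "pjoin (G i j) (G k l)"
    have w: "?w \<in> grid P" "G i j \<le> ?w" "G k l \<le> ?w" using pjoin_grid pjoin_ge gr b by auto
    \<comment> \<open>Starting from \<open>G i j\<close>, one goes up by left covers. Before index
      \<open>k\<close> the abscissa stays below that of \<open>G k l\<close>, hence below that of
      \<open>w\<close>, so minimality of the left cover applies at each step.\<close>
    have *: "G k j \<le> w" if h: "i < k" "l < j" "j < n" "k < m" and w: "w \<in> grid P" "G i j \<le> w" "G k l \<le> w" for i j k l w
    proof -
      have "G i' j \<le> w" if "i \<le> i'" "i' \<le> k" for i'
        using that
      proof (induction i' rule: dec_induct)
        case (step i')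
        have "fst (G i' j) < fst (G k l)"
          using fc[of i' j] fc[of i' l] mono1[of i' k l] step h by auto
        then have "fst (G i' j) < fst w" "snd (G i' j) \<le> snd w" using w step by (auto simp: le_point)
        then show ?case using upl_least[OF w(1)] U[of i' j] step h by auto
      qed (use w in simp)
      then show ?thesis using h by auto
    qed
    consider "i \<le> k" "j \<le> l" | "k \<le> i" "l \<le> j" | "i < k" "l < j" | "k < i" "j < l" by linarith
    then show "G (max i k) (max j l) \<le> ?w"
    proof cases
      case 1 then show ?thesis using w by (simp add: max_absorb2)
    next
      case 2 then show ?thesis using w by (simp add: max_absorb1)
    next
      case 3 then show ?thesis using *[of i k l j ?w] b w by (simp add: max_def)
    next
      case 4 then show ?thesis using *[of k i j l ?w] b w by (simp add: max_def)
    qed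
  qed
  let ?X = "g ` ({..<m} \<times> {..<n})"
  have XC: "?X \<subseteq> carrier D" using g by auto
  have leg: "le D (g (i, j)) (g (k, l)) \<longleftrightarrow> i \<le> k \<and> j \<le> l" if "i < m" "j < n" "k < m" "l < n" for i j k l
    using ord[OF that] g[of i j] g[of k l] that le_iff by auto
  have geq: "x = g (i, j)" if "x \<in> carrier D" "\<phi> x = G i j" "i < m" "j < n" for x i j
    using g[of i j] that phi_inj by metis
  have "cover_preserving_sublattice D ?X"
    unfolding cover_preserving_sublattice_def
  proof (intro conjI ballI allI impI)
    show "?X \<noteq> {}" using mn by auto
    fix x y assume "x \<in> ?X" "y \<in> ?X"
    then obtain i j k l where x: "x = g (i, j)" "y = g (k, l)" "i < m" "j < n" "k < m" "l < n" by auto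
    then have c: "x \<in> carrier D" "y \<in> carrier D" "\<phi> x = G i j" "\<phi> y = G k l" using g by auto
    have "join D x y = g (max i k, max j l)"
      using x c by (intro geq) (simp_all add: join_carrier phi_join join)
    then show "join D x y \<in> ?X" using x by auto
    have "meet D x y = g (min i k, min j l)"
      using x c by (intro geq) (simp_all add: meet_carrier phi_meet meet)
    then show "meet D x y \<in> ?X" using x by auto
  next
    fix x y assume cv: "covers (D\<lparr>carrier := ?X\<rparr>) x y"
    then have h: "x \<in> ?X" "y \<in> ?X" "le D x y" "x \<noteq> y" "\<And>c. c \<in> ?X \<Longrightarrow> le D x c \<Longrightarrow> le D c y \<Longrightarrow> c = x \<or> c = y"
      unfolding covers_restrict[OF po XC] by blast+
    then obtain i j k l where x: "x = g (i, j)" "y = g (k, l)" "i < m" "j < n" "k < m" "l < n" by auto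
    then have ik: "i \<le> k" "j \<le> l" using h(3) leg by auto
    have gi: "a = c \<and> b = d" if "g (a, b) = g (c, d)" "a < m" "b < n" "c < m" "d < n" for a b c d
      using leg[of a b c d] leg[of c d a b] that leg[of a b a b] by auto
    show "covers D x y"
    proof (cases "i < k")
      case True
      then have "g (Suc i, j) = x \<or> g (Suc i, j) = y"
        using h(5)[of "g (Suc i, j)"] x ik leg[of i j "Suc i" j] leg[of "Suc i" j k l] by auto
      then have "y = g (Suc i, j)" using gi[of "Suc i" j i j] x True by auto
      then have "\<phi> y = upl P (\<phi> x)" "\<phi> x \<noteq> T" using g[of i j] g[of "Suc i" j] U[of i j] x True by auto
      then show ?thesis using g x gr by (simp add: covers_cov cov_iff)
    next
      case False
      then have jl: "j < l" "i = k" using ik x h(4) by (auto simp: less_le)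
      then have "g (i, Suc j) = x \<or> g (i, Suc j) = y"
        using h(5)[of "g (i, Suc j)"] x ik leg[of i j i "Suc j"] leg[of i "Suc j" k l] by auto
      then have "y = g (i, Suc j)" using gi[of i "Suc j" i j] x jl by auto
      then have "\<phi> y = upr P (\<phi> x)" "\<phi> x \<noteq> T" using g[of i j] g[of i "Suc j"] V[of i j] x jl by auto
      then show ?thesis using g x gr by (simp add: covers_cov cov_iff)
    qed
  qed (use g in auto)
  then show ?thesis unfolding cp_grid_def using leg by blast
qed

lemma cp_grid_cov:
  assumes g: "cp_grid D m n g"
  shows "i < m \<Longrightarrow> j < n \<Longrightarrow> g (i, j) \<in> carrier D"
    and "Suc i < m \<Longrightarrow> j < n \<Longrightarrow> cov (\<phi> (g (i, j))) (\<phi> (g (Suc i, j)))"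
    and "i < m \<Longrightarrow> Suc j < n \<Longrightarrow> cov (\<phi> (g (i, j))) (\<phi> (g (i, Suc j)))"
    and "i < m \<Longrightarrow> j < n \<Longrightarrow> k < m \<Longrightarrow> l < n \<Longrightarrow> \<phi> (g (i, j)) = \<phi> (g (k, l)) \<longleftrightarrow> i = k \<and> j = l"
proof -
  let ?X = "g ` ({..<m} \<times> {..<n})"
  have X: "?X \<subseteq> carrier D" "\<And>x y. covers (D\<lparr>carrier := ?X\<rparr>) x y \<Longrightarrow> covers D x y"
    and le: "\<And>i j k l. i < m \<Longrightarrow> j < n \<Longrightarrow> k < m \<Longrightarrow> l < n \<Longrightarrow> le D (g (i, j)) (g (k, l)) \<longleftrightarrow> i \<le> k \<and> j \<le> l"
    using g unfolding cp_grid_def cover_preserving_sublattice_def by blast+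
  show c: "g (i, j) \<in> carrier D" if "i < m" "j < n" for i j using X(1) that by auto
  have eq: "g (i, j) = g (k, l) \<longleftrightarrow> i = k \<and> j = l" if "i < m" "j < n" "k < m" "l < n" for i j k l
    using le[OF that] le[OF that(3,4,1,2)] le[OF that(1,2,1,2)] by auto
  show "\<phi> (g (i, j)) = \<phi> (g (k, l)) \<longleftrightarrow> i = k \<and> j = l" if "i < m" "j < n" "k < m" "l < n"
    using eq[OF that] phi_inj c that by auto
  have *: "covers D (g (i, j)) (g (k, l))" if b: "i < m" "j < n" "k < m" "l < n" and s: "k = Suc i \<and> l = j \<or> k = i \<and> l = Suc j" for i j k l
  proof (rule X(2), subst covers_restrict[OF po X(1)], intro conjI ballI impI)
    show "le D (g (i, j)) (g (k, l))" using le[OF b] s by auto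
    show "g (i, j) \<noteq> g (k, l)" using eq[OF b] s by auto
    fix c assume c: "c \<in> ?X" "le D (g (i, j)) c \<and> le D c (g (k, l))"
    then obtain a b' where ab: "c = g (a, b')" "a < m" "b' < n" by auto
    then have "i \<le> a \<and> j \<le> b' \<and> a \<le> k \<and> b' \<le> l" using le c(2) b by simp
    then have "a = i \<and> b' = j \<or> a = k \<and> b' = l" using s by auto
    then show "c = g (i, j) \<or> c = g (k, l)" using ab(1) by metis
  qed (use b in simp_all)
  show "cov (\<phi> (g (i, j))) (\<phi> (g (Suc i, j)))" if "Suc i < m" "j < n"
    using *[of i j "Suc i" j] that by (simp add: covers_cov)
  show "cov (\<phi> (g (i, j))) (\<phi> (g (i, Suc j)))" if "i < m" "Suc j < n"
    using *[of i j i "Suc j"] that by (simp add: covers_cov)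
qed

end

text \<open>The first two conditions are what similarity sees besides the order; the third is what
  the ends of wings refer to.\<close>

locale diagram_model = order_model P T D \<phi> for P T and D :: diagram and \<phi> +
  assumes upper_left: "covers D a b \<Longrightarrow> covers D a c \<Longrightarrow>
      left_of_line b a c \<longleftrightarrow> fst (\<phi> c) < fst (\<phi> b) \<and> snd (\<phi> b) < snd (\<phi> c)"
    and lower_left: "covers D b a \<Longrightarrow> covers D c a \<Longrightarrow>
      left_of_line b c a \<longleftrightarrow> fst (\<phi> c) < fst (\<phi> b) \<and> snd (\<phi> b) < snd (\<phi> c)"
    and boundary: "boundary D = {x\<in>carrier D. on_left P (\<phi> x) \<or> on_right P (\<phi> x)}"

text \<open>Following one coordinatization by the inverse of the other preserves everything that is
  read off from coordinates; so \<open>P\<close> determines a diagram up to similarity.\<close>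

lemma models_similar:
  assumes "diagram_model P T D \<phi>" "diagram_model P T E \<psi>" shows "similar D E"
proof -
  interpret D: diagram_model P T D \<phi> by fact
  interpret E: diagram_model P T E \<psi> by fact
  define f where "f = inv_into (carrier E) \<psi> \<circ> \<phi>"
  have bij: "bij_betw f (carrier D) (carrier E)"
    unfolding f_def using D.bij bij_betw_inv_into[OF E.bij] bij_betw_trans by blast
  have f: "f x \<in> carrier E" "\<psi> (f x) = \<phi> x" if "x \<in> carrier D" for x
    using bij that E.bij D.phi_grid[OF that] by (auto simp: bij_betw_def f_def f_inv_into_f)
  have cov: "covers E (f a) (f b) \<and> \<psi> (f a) = \<phi> a \<and> \<psi> (f b) = \<phi> b" if "covers D a b" for a b
    using that by (auto simp: D.covers_cov E.covers_cov f)
  show ?thesis unfolding similar_def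
  proof (intro exI[of _ f] conjI bij ballI allI impI)
    show "le D x y = le E (f x) (f y)" if "x \<in> carrier D" "y \<in> carrier D" for x y
      using that f by (simp add: D.le_iff E.le_iff)
    show "left_of_line b a c = left_of_line (f b) (f a) (f c)" if "covers D a b \<and> covers D a c" for a b c
      using D.upper_left[of a b c] E.upper_left[of "f a" "f b" "f c"] that cov[of a b] cov[of a c] by auto
    show "left_of_line b c a = left_of_line (f b) (f c) (f a)" if "covers D b a \<and> covers D c a" for a b c
      using D.lower_left[of b a c] E.lower_left[of "f b" "f a" "f c"] that cov[of b a] cov[of c a] by auto
  qed
qed

context diagram_model
begin

definition phi3 :: "triple \<Rightarrow> triple" where
  "phi3 X = (\<phi> (bot_elem X), \<phi> (mid_elem X), \<phi> (top_elem X))"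

lemma phi3_simps [simp]: "bot_elem (phi3 X) = \<phi> (bot_elem X)" "mid_elem (phi3 X) = \<phi> (mid_elem X)"
    "top_elem (phi3 X) = \<phi> (top_elem X)" "phi3 (x, y, z) = (\<phi> x, \<phi> y, \<phi> z)"
  by (auto simp: phi3_def bot_elem_def mid_elem_def top_elem_def)

lemma elems_simp: "elems (x, y, z) = {x, y, z}"
  by (auto simp: elems_def bot_elem_def mid_elem_def top_elem_def)

lemma triple_sel: "bot_elem (x, y, z) = x" "mid_elem (x, y, z) = y" "top_elem (x, y, z) = z"
  by (auto simp: bot_elem_def mid_elem_def top_elem_def)

text \<open>The orientation decides which upper cover of the bottom is the left one. From there on
  the six elements are forced, one cell at a time, because distinct elements of the subgrid have
  distinct coordinates.\<close>

lemma next_left_imp: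
  assumes "next_left D X A"
  shows "elems X \<subseteq> carrier D" "elems A \<subseteq> carrier D" "next_l P (phi3 X) (phi3 A)"
proof -
  have *: "elems X \<subseteq> carrier D \<and> elems A \<subseteq> carrier D \<and> next_l P (phi3 X) (phi3 A)"
    using assms unfolding next_left_def
  proof
    assume h: "opposite_sides D A X \<and> left_of_line (bot_elem X) (bot_elem A) (mid_elem A)"
    then obtain g where g: "cp_grid D 3 2 g" and A: "A = (g (0, 0), g (1, 0), g (2, 0))"
      and X: "X = (g (0, 1), g (1, 1), g (2, 1))" by (auto simp: opposite_sides_def)
    have c: "\<And>i j. i < 3 \<Longrightarrow> j < 2 \<Longrightarrow> g (i, j) \<in> carrier D"
      and u: "\<And>i j. Suc i < 3 \<Longrightarrow> j < 2 \<Longrightarrow> cov (\<phi> (g (i, j))) (\<phi> (g (Suc i, j)))"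
      and v: "\<And>i j. i < 3 \<Longrightarrow> Suc j < 2 \<Longrightarrow> cov (\<phi> (g (i, j))) (\<phi> (g (i, Suc j)))"
      and ne: "\<And>i j k l. i < 3 \<Longrightarrow> j < 2 \<Longrightarrow> k < 3 \<Longrightarrow> l < 2 \<Longrightarrow> \<phi> (g (i, j)) = \<phi> (g (k, l)) \<longleftrightarrow> i = k \<and> j = l"
      using cp_grid_cov[OF g] by auto
    have s: "cov (\<phi> (g (0, 0))) (\<phi> (g (0, 1)))" "cov (\<phi> (g (0, 0))) (\<phi> (g (1, 0)))"
      "cov (\<phi> (g (0, 1))) (\<phi> (g (1, 1)))" "cov (\<phi> (g (1, 0))) (\<phi> (g (1, 1)))"
      "cov (\<phi> (g (1, 0))) (\<phi> (g (2, 0)))" "cov (\<phi> (g (1, 1))) (\<phi> (g (2, 1)))" "cov (\<phi> (g (2, 0))) (\<phi> (g (2, 1)))"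
      using u[of 0 0] u[of 0 1] u[of 1 0] u[of 1 1] v[of 0 0] v[of 1 0] v[of 2 0] by (simp_all add: numeral_2_eq_2)
    have "left_of_line (g (0, 1)) (g (0, 0)) (g (1, 0))" using h A X by (simp add: triple_sel)
    then have "fst (\<phi> (g (1, 0))) < fst (\<phi> (g (0, 1)))"
      using upper_left s(1,2) c by (simp add: covers_cov)
    note z = cov_two[OF s(1,2) this]
    have w: "\<phi> (g (1, 1)) = upl P (upr P (\<phi> (g (0, 0))))" using cov_cell[OF z(1)] s(3,4) z(2,3) by simp
    have t: "\<phi> (g (1, 0)) \<in> grid P - P" "\<phi> (g (2, 0)) = upr P (\<phi> (g (1, 0)))"
      using cov_right_side[OF z(1), of "\<phi> (g (2, 0))"] s(5) z(3) ne[of 2 0 1 1] w by auto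
    have w': "\<phi> (g (2, 1)) = upl P (upr P (\<phi> (g (1, 0))))"
      using cov_cell[OF t(1)] s(6,7) t(2) w z(3) by simp
    have "next_l P (phi3 X) (phi3 A)"
      unfolding next_l_def
      by (rule disjI1, rule bexI[of _ "\<phi> (g (0, 0))"]) (use z t w w' in \<open>simp_all add: A X\<close>)
    then show ?thesis using c by (simp add: A X elems_simp)
  next
    assume h: "opposite_sides D X A \<and> left_of_line (mid_elem X) (bot_elem X) (bot_elem A)"
    then obtain g where g: "cp_grid D 3 2 g" and X: "X = (g (0, 0), g (1, 0), g (2, 0))"
      and A: "A = (g (0, 1), g (1, 1), g (2, 1))" by (auto simp: opposite_sides_def)
    have c: "\<And>i j. i < 3 \<Longrightarrow> j < 2 \<Longrightarrow> g (i, j) \<in> carrier D"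
      and u: "\<And>i j. Suc i < 3 \<Longrightarrow> j < 2 \<Longrightarrow> cov (\<phi> (g (i, j))) (\<phi> (g (Suc i, j)))"
      and v: "\<And>i j. i < 3 \<Longrightarrow> Suc j < 2 \<Longrightarrow> cov (\<phi> (g (i, j))) (\<phi> (g (i, Suc j)))"
      and ne: "\<And>i j k l. i < 3 \<Longrightarrow> j < 2 \<Longrightarrow> k < 3 \<Longrightarrow> l < 2 \<Longrightarrow> \<phi> (g (i, j)) = \<phi> (g (k, l)) \<longleftrightarrow> i = k \<and> j = l"
      using cp_grid_cov[OF g] by auto
    have s: "cov (\<phi> (g (0, 0))) (\<phi> (g (1, 0)))" "cov (\<phi> (g (0, 0))) (\<phi> (g (0, 1)))"
      "cov (\<phi> (g (1, 0))) (\<phi> (g (1, 1)))" "cov (\<phi> (g (0, 1))) (\<phi> (g (1, 1)))"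
      "cov (\<phi> (g (1, 0))) (\<phi> (g (2, 0)))" "cov (\<phi> (g (2, 0))) (\<phi> (g (2, 1)))" "cov (\<phi> (g (1, 1))) (\<phi> (g (2, 1)))"
      using u[of 0 0] u[of 0 1] u[of 1 0] u[of 1 1] v[of 0 0] v[of 1 0] v[of 2 0] by (simp_all add: numeral_2_eq_2)
    have "left_of_line (g (1, 0)) (g (0, 0)) (g (0, 1))" using h A X by (simp add: triple_sel)
    then have "fst (\<phi> (g (0, 1))) < fst (\<phi> (g (1, 0)))"
      using upper_left s(1,2) c by (simp add: covers_cov)
    note z = cov_two[OF s(1,2) this]
    have zz: "\<phi> (g (0, 0)) \<in> grid P" "\<phi> (g (0, 0)) \<notin> P" using z(1) by auto
    have w: "\<phi> (g (1, 1)) = upl P (upr P (\<phi> (g (0, 0))))" using cov_cell[OF z(1)] s(3,4) z(2,3) by simp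
    have t: "\<phi> (g (1, 0)) \<in> grid P - P" "\<phi> (g (2, 0)) = upl P (\<phi> (g (1, 0)))"
      using cov_left_side[OF z(1), of "\<phi> (g (2, 0))"] s(5) z(2) ne[of 2 0 1 1] w by auto
    have w2: "\<phi> (g (1, 1)) = upr P (\<phi> (g (1, 0)))" using w upl_upr_commute[OF zz] z(2) by simp
    have "\<phi> (g (2, 1)) = upl P (upr P (\<phi> (g (1, 0))))"
      using cov_cell[OF t(1)] s(6,7) t(2) w2 by simp
    then have w': "\<phi> (g (2, 1)) = upr P (upl P (\<phi> (g (1, 0))))" using upl_upr_commute t(1) by simp
    have "next_l P (phi3 X) (phi3 A)"
      unfolding next_l_def
      by (rule disjI2, rule bexI[of _ "\<phi> (g (0, 0))"]) (use z t w2 w' in \<open>simp_all add: A X\<close>)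
    then show ?thesis using c by (simp add: A X elems_simp)
  qed
  then show "elems X \<subseteq> carrier D" "elems A \<subseteq> carrier D" "next_l P (phi3 X) (phi3 A)" by auto
qed

lemma next_left_if:
  assumes c: "elems X \<subseteq> carrier D" "elems A \<subseteq> carrier D" and n: "next_l P (phi3 X) (phi3 A)"
  shows "next_left D X A"
proof -
  obtain x0 x1 x2 a0 a1 a2 where XA: "X = (x0, x1, x2)" "A = (a0, a1, a2)" by (metis prod.collapse)
  have xc: "x0 \<in> carrier D" "x1 \<in> carrier D" "x2 \<in> carrier D" "a0 \<in> carrier D" "a1 \<in> carrier D" "a2 \<in> carrier D"
    using c by (auto simp: XA elems_simp)
  define V where "V = upr P" define U where "U = upl P"
  from n[unfolded next_l_def, folded V_def U_def] consider
    (up) b where "b \<in> grid P" "b \<notin> P" "V b \<notin> P" "phi3 A = (b, V b, V (V b))" "phi3 X = (U b, U (V b), U (V (V b)))" |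
    (down) b where "b \<in> grid P" "b \<notin> P" "U b \<notin> P" "phi3 X = (b, U b, U (U b))" "phi3 A = (V b, V (U b), V (U (U b)))"
    by blast
  then show ?thesis
  proof cases
    case up
    define g where "g = (\<lambda>(i, j). if j = (0::nat) then (if i = (0::nat) then a0 else x0)
      else if j = 1 then (if i = 0 then a1 else x1) else (if i = 0 then a2 else x2))"
    define G where "G i j = (if i = (0::nat) then (V ^^ j) b else U ((V ^^ j) b))" for i j :: nat
    have nT: "b \<noteq> T" "V b \<noteq> T" using up T_in by auto
    have Vg: "V b \<in> grid P" using upr_grid up(1) nT by (simp add: V_def)
    have UV: "U (V b) = V (U b)" "U (V (V b)) = V (U (V b))"
      using upl_upr_commute[OF up(1,2)] upl_upr_commute[OF Vg[unfolded V_def]] up(3) by (auto simp: V_def U_def)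
    have Ug: "U b \<noteq> T" "U (V b) \<noteq> T" "V (V b) \<noteq> T"
      using upl_not_T[OF up(1,2)] upl_not_T[OF Vg] upr_not_T[OF Vg] up(3) by (auto simp: V_def U_def)
    have ph: "\<phi> a0 = b" "\<phi> a1 = V b" "\<phi> a2 = V (V b)" "\<phi> x0 = U b" "\<phi> x1 = U (V b)" "\<phi> x2 = U (V (V b))"
      using up(4,5) by (auto simp: XA)
    have "cp_grid D 2 3 g"
    proof (rule cp_gridI[where G = G])
      fix i j :: nat
      show "i < 2 \<Longrightarrow> j < 3 \<Longrightarrow> g (i, j) \<in> carrier D \<and> \<phi> (g (i, j)) = G i j"
        using xc ph by (auto simp: g_def G_def numeral_2_eq_2 numeral_3_eq_3 less_Suc_eq)
      show "Suc i < 2 \<Longrightarrow> j < 3 \<Longrightarrow> G (Suc i) j = upl P (G i j) \<and> G i j \<noteq> T"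
        using nT Ug by (auto simp: G_def numeral_2_eq_2 numeral_3_eq_3 less_Suc_eq U_def)
      show "i < 2 \<Longrightarrow> Suc j < 3 \<Longrightarrow> G i (Suc j) = upr P (G i j) \<and> G i j \<noteq> T"
        using nT Ug UV by (auto simp: G_def numeral_2_eq_2 numeral_3_eq_3 less_Suc_eq V_def)
      show "Suc i < 2 \<Longrightarrow> Suc j < 3 \<Longrightarrow> G i j \<notin> P"
        using up by (auto simp: G_def numeral_2_eq_2 numeral_3_eq_3 less_Suc_eq)
    qed auto
    \<comment> \<open>The chains run along right covers here, whereas \<open>opposite_sides\<close>
      wants them along the first index.\<close>
    from cp_grid_transpose[OF this] have "opposite_sides D A X"
      unfolding opposite_sides_def
      by (intro exI[of _ "\<lambda>(i, j). g (j, i)"] conjI) (auto simp: g_def XA)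
    moreover have "left_of_line x0 a0 a1"
    proof -
      have "covers D a0 x0" "covers D a0 a1" using xc ph up nT by (auto simp: covers_cov cov_iff U_def V_def)
      then show ?thesis
        using upper_left ph upl_gt[OF up(1) nT(1)] upr_gt[OF up(1) nT(1)] fst_upr[OF up(1,2)] snd_upl[OF up(1,2)]
        by (auto simp: U_def V_def)
    qed
    ultimately show ?thesis unfolding next_left_def by (simp add: XA triple_sel)
  next
    case down
    define g where "g = (\<lambda>(i, j). if i = (0::nat) then (if j = (0::nat) then x0 else a0)
      else if i = 1 then (if j = 0 then x1 else a1) else (if j = 0 then x2 else a2))"
    define G where "G i j = (if j = (0::nat) then (U ^^ i) b else V ((U ^^ i) b))" for i j :: nat
    have nT: "b \<noteq> T" "U b \<noteq> T" using down T_in by auto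
    have Ug: "U b \<in> grid P" using upl_grid down(1) nT by (simp add: U_def)
    have UV: "U (V b) = V (U b)" "U (V (U b)) = V (U (U b))"
      using upl_upr_commute[OF down(1,2)] upl_upr_commute[OF Ug[unfolded U_def]] down(3) by (auto simp: V_def U_def)
    have Vg: "V b \<noteq> T" "V (U b) \<noteq> T" "U (U b) \<noteq> T"
      using upr_not_T[OF down(1,2)] upl_not_T[OF Ug] upr_not_T[OF Ug] down(3) by (auto simp: V_def U_def)
    have ph: "\<phi> x0 = b" "\<phi> x1 = U b" "\<phi> x2 = U (U b)" "\<phi> a0 = V b" "\<phi> a1 = V (U b)" "\<phi> a2 = V (U (U b))"
      using down(4,5) by (auto simp: XA)
    have "cp_grid D 3 2 g"
    proof (rule cp_gridI[where G = G])
      fix i j :: nat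
      show "i < 3 \<Longrightarrow> j < 2 \<Longrightarrow> g (i, j) \<in> carrier D \<and> \<phi> (g (i, j)) = G i j"
        using xc ph by (auto simp: g_def G_def numeral_2_eq_2 numeral_3_eq_3 less_Suc_eq)
      show "Suc i < 3 \<Longrightarrow> j < 2 \<Longrightarrow> G (Suc i) j = upl P (G i j) \<and> G i j \<noteq> T"
        using nT Vg UV by (auto simp: G_def numeral_2_eq_2 numeral_3_eq_3 less_Suc_eq U_def)
      show "i < 3 \<Longrightarrow> Suc j < 2 \<Longrightarrow> G i (Suc j) = upr P (G i j) \<and> G i j \<noteq> T"
        using nT Vg by (auto simp: G_def numeral_2_eq_2 numeral_3_eq_3 less_Suc_eq V_def)
      show "Suc i < 3 \<Longrightarrow> Suc j < 2 \<Longrightarrow> G i j \<notin> P"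
        using down by (auto simp: G_def numeral_2_eq_2 numeral_3_eq_3 less_Suc_eq)
    qed auto
    then have "opposite_sides D X A"
      unfolding opposite_sides_def by (intro exI[of _ g] conjI) (auto simp: g_def XA)
    moreover have "left_of_line x1 x0 a0"
    proof -
      have "covers D x0 x1" "covers D x0 a0" using xc ph down nT by (auto simp: covers_cov cov_iff U_def V_def)
      then show ?thesis
        using upper_left ph upl_gt[OF down(1) nT(1)] upr_gt[OF down(1) nT(1)] fst_upr[OF down(1,2)] snd_upl[OF down(1,2)]
        by (auto simp: U_def V_def)
    qed
    ultimately show ?thesis unfolding next_left_def by (simp add: XA triple_sel)
  qed
qed

end


section \<open>Schemes in coordinatized diagrams\<close>

text \<open>A step to the left requires the middle or the bottom of the chain to be the right cover
  of an element off \<open>P\<close>, and the left cover of that element lies to the left.\<close>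

lemma (in perm_set) on_left_no_next:
  assumes "on_left P (bot_elem X)" "on_left P (mid_elem X)" shows "\<not> next_l P Y X"
proof
  have sep: "\<not> on_left P (upr P b)" if "b \<in> grid P - P" for b
  proof -
    have b: "b \<in> grid P" "b \<notin> P" "b \<noteq> T" using that notP_T by auto
    show ?thesis unfolding on_left_def not_not
      by (rule bexI[of _ "upl P b"])
        (use fst_upr[OF b(1,2)] snd_upl[OF b(1,2)] upl_gt[OF b(1,3)] upr_gt[OF b(1,3)] upl_grid[OF b(1,3)] in auto)
  qed
  assume "next_l P Y X"
  then consider b where "b \<in> grid P - P" "mid_elem X = upr P b" | c where "c \<in> grid P - P" "bot_elem X = upr P c"
    unfolding next_l_def by (auto simp: mid_elem_def bot_elem_def)
  then show False using sep assms by cases auto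
qed

context diagram_model
begin

lemma left_wing_eq: "left_wing D A = {X. (next_left D)\<^sup>*\<^sup>* X A}"
proof -
  have "(consecutive D)\<^sup>*\<^sup>* A X" if "(next_left D)\<^sup>*\<^sup>* X A" for X
    using that
  proof (induction rule: converse_rtranclp_induct)
    case (step y z)
    then have "consecutive D z y" by (auto simp: consecutive_def next_left_def)
    then show ?case using step by auto
  qed auto
  then show ?thesis by (auto simp: left_wing_def trajectory_def)
qed

lemma right_wing_eq: "right_wing D A = {X. (next_left D)\<^sup>*\<^sup>* A X}"
proof -
  have "(consecutive D)\<^sup>*\<^sup>* A X" if "(next_left D)\<^sup>*\<^sup>* A X" for X
    using that
  proof (induction rule: rtranclp_induct)
    case (step y z)
    then have "consecutive D y z" by (auto simp: consecutive_def next_left_def)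
    then show ?case using step by auto
  qed auto
  then show ?thesis by (auto simp: right_wing_def trajectory_def)
qed

lemma lift_triple:
  assumes "bot_elem Z \<in> grid P" "mid_elem Z \<in> grid P" "top_elem Z \<in> grid P"
  obtains X where "elems X \<subseteq> carrier D" "phi3 X = Z"
proof -
  obtain x where x: "x \<in> carrier D" "\<phi> x = bot_elem Z" using phi_surj[OF assms(1)] by metis
  obtain y where y: "y \<in> carrier D" "\<phi> y = mid_elem Z" using phi_surj[OF assms(2)] by metis
  obtain z where z: "z \<in> carrier D" "\<phi> z = top_elem Z" using phi_surj[OF assms(3)] by metis
  show thesis
    by (rule that[of "(x, y, z)"])
      (use x y z in \<open>auto simp: elems_simp bot_elem_def mid_elem_def top_elem_def\<close>)
qed

lemma next_l_grid:
  assumes "next_l P X A"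
  shows "bot_elem X \<in> grid P \<and> mid_elem X \<in> grid P \<and> top_elem X \<in> grid P"
    "bot_elem A \<in> grid P \<and> mid_elem A \<in> grid P \<and> top_elem A \<in> grid P"
proof -
  have *: "upl P z \<in> grid P \<and> upl P z \<noteq> T \<and> upr P z \<in> grid P \<and> upr P z \<noteq> T" if "z \<in> grid P" "z \<notin> P" for z
    using that notP_T upl_grid upr_grid upl_not_T upr_not_T by auto
  have 1: "bot_elem X \<in> grid P \<and> mid_elem X \<in> grid P \<and> top_elem X \<in> grid P \<and>
    bot_elem A \<in> grid P \<and> mid_elem A \<in> grid P \<and> top_elem A \<in> grid P"
    using assms unfolding next_l_def
  proof (elim disjE bexE conjE)
    fix b assume b: "b \<in> grid P - P" "upr P b \<notin> P" and XA: "A = (b, upr P b, upr P (upr P b))"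
      "X = (upl P b, upl P (upr P b), upl P (upr P (upr P b)))"
    have m: "upr P b \<in> grid P" using *[of b] b by auto
    have "upr P (upr P b) \<in> grid P" "upr P (upr P b) \<noteq> T" using *[OF m b(2)] by auto
    then show ?thesis using *[of b] *[OF m b(2)] upl_grid b by (simp add: XA triple_sel)
  next
    fix c assume c: "c \<in> grid P - P" "upl P c \<notin> P" and XA: "X = (c, upl P c, upl P (upl P c))"
      "A = (upr P c, upr P (upl P c), upr P (upl P (upl P c)))"
    have m: "upl P c \<in> grid P" using *[of c] c by auto
    have "upl P (upl P c) \<in> grid P" "upl P (upl P c) \<noteq> T" using *[OF m c(2)] by auto
    then show ?thesis using *[of c] *[OF m c(2)] upr_grid c by (simp add: XA triple_sel)
  qed
  then show "bot_elem X \<in> grid P \<and> mid_elem X \<in> grid P \<and> top_elem X \<in> grid P"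
    "bot_elem A \<in> grid P \<and> mid_elem A \<in> grid P \<and> top_elem A \<in> grid P" by auto
qed

text \<open>The map \<open>\<phi>\<close> is controlled only on the carrier, so the fact that all
  elements of the chains belong to it is carried through the induction.\<close>

lemma left_wing_image:
  assumes A: "elems A \<subseteq> carrier D"
  shows "phi3 ` left_wing D A = {Z. (next_l P)\<^sup>*\<^sup>* Z (phi3 A)}" "X \<in> left_wing D A \<Longrightarrow> elems X \<subseteq> carrier D"
proof -
  have 1: "elems X \<subseteq> carrier D \<and> (next_l P)\<^sup>*\<^sup>* (phi3 X) (phi3 A)" if "(next_left D)\<^sup>*\<^sup>* X A" for X
    using that
  proof (induction rule: converse_rtranclp_induct)
    case (step y z)
    then show ?case using next_left_imp[OF step(1)] by (meson converse_rtranclp_into_rtranclp)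
  qed (use A in auto)
  have 2: "\<exists>X. elems X \<subseteq> carrier D \<and> phi3 X = Z \<and> (next_left D)\<^sup>*\<^sup>* X A" if "(next_l P)\<^sup>*\<^sup>* Z (phi3 A)" for Z
    using that
  proof (induction rule: converse_rtranclp_induct)
    case (step y z)
    then obtain X where X: "elems X \<subseteq> carrier D" "phi3 X = z" "(next_left D)\<^sup>*\<^sup>* X A" by auto
    obtain Y where Y: "elems Y \<subseteq> carrier D" "phi3 Y = y" using lift_triple next_l_grid(1)[OF step(1)] by metis
    have "next_left D Y X" using next_left_if X Y step(1) by auto
    then show ?case using X Y by (intro exI[of _ Y]) (auto intro: converse_rtranclp_into_rtranclp)
  qed (use A in blast)
  show "phi3 ` left_wing D A = {Z. (next_l P)\<^sup>*\<^sup>* Z (phi3 A)}"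
    unfolding left_wing_eq using 1 2 by blast
  show "X \<in> left_wing D A \<Longrightarrow> elems X \<subseteq> carrier D" using 1 by (auto simp: left_wing_eq)
qed

lemma right_wing_image:
  assumes A: "elems A \<subseteq> carrier D"
  shows "phi3 ` right_wing D A = {Z. (next_l P)\<^sup>*\<^sup>* (phi3 A) Z}" "X \<in> right_wing D A \<Longrightarrow> elems X \<subseteq> carrier D"
proof -
  have 1: "elems X \<subseteq> carrier D \<and> (next_l P)\<^sup>*\<^sup>* (phi3 A) (phi3 X)" if "(next_left D)\<^sup>*\<^sup>* A X" for X
    using that
  proof (induction rule: rtranclp_induct)
    case (step y z)
    then show ?case using next_left_imp[OF step(2)] by (meson rtranclp.rtrancl_into_rtrancl)
  qed (use A in auto)
  have 2: "\<exists>X. elems X \<subseteq> carrier D \<and> phi3 X = Z \<and> (next_left D)\<^sup>*\<^sup>* A X" if "(next_l P)\<^sup>*\<^sup>* (phi3 A) Z" for Z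
    using that
  proof (induction rule: rtranclp_induct)
    case (step y z)
    then obtain X where X: "elems X \<subseteq> carrier D" "phi3 X = y" "(next_left D)\<^sup>*\<^sup>* A X" by auto
    obtain Y where Y: "elems Y \<subseteq> carrier D" "phi3 Y = z" using lift_triple next_l_grid(2)[OF step(2)] by metis
    have "next_left D X Y" using next_left_if X Y step(2) by auto
    then show ?case using X Y by (intro exI[of _ Y]) (auto intro: rtranclp.rtrancl_into_rtrancl)
  qed (use A in blast)
  show "phi3 ` right_wing D A = {Z. (next_l P)\<^sup>*\<^sup>* (phi3 A) Z}"
    unfolding right_wing_eq using 1 2 by blast
  show "X \<in> right_wing D A \<Longrightarrow> elems X \<subseteq> carrier D" using 1 by (auto simp: right_wing_eq)
qed

lemma elems_bd: "elems X \<subseteq> carrier D \<Longrightarrow> elems X \<subseteq> boundary D \<longleftrightarrow>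
   (\<forall>z\<in>{bot_elem (phi3 X), mid_elem (phi3 X), top_elem (phi3 X)}. on_left P z \<or> on_right P z)"
  by (auto simp: elems_def boundary)

end

section \<open>Schemes and their deleted elements\<close>

locale scheme_base = diagram_model P T D \<phi> for P T D \<phi> +
  fixes g :: "nat \<times> nat \<Rightarrow> point"
  assumes cp: "cp_grid D 3 3 g" and orient: "left_of_line (g (1, 0)) (g (0, 0)) (g (0, 1))"
begin

definition e :: point where "e = \<phi> (g (1, 0))"
definition f :: point where "f = \<phi> (g (0, 1))"
definition a :: point where "a = \<phi> (g (1, 1))"
definition k :: point where "k = (SOME u. u \<in> P \<and> snd u = snd a)"
definition c :: point where "c = (SOME u. u \<in> P \<and> fst u = fst a)"

lemma g_carrier: "i < 3 \<Longrightarrow> j < 3 \<Longrightarrow> g (i, j) \<in> carrier D"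
  using cp_grid_cov(1)[OF cp] .

text \<open>The orientation fixes the bottom cell, and each further cell is determined by two of its
  sides. The anchor is off \<open>P\<close> because it has two different upper covers in the
  scheme.\<close>

lemma scheme_coords:
  shows "e \<in> grid P - P" "f \<in> grid P - P" "a \<in> grid P - P" "upr P e = a" "upl P f = a"
    "\<phi> (g (2, 0)) = upl P e" "\<phi> (g (2, 1)) = upl P a" "\<phi> (g (2, 2)) = upr P (upl P a)"
    "\<phi> (g (0, 2)) = upr P f" "\<phi> (g (1, 2)) = upr P a"
proof -
  have u: "\<And>i j. Suc i < 3 \<Longrightarrow> j < 3 \<Longrightarrow> cov (\<phi> (g (i, j))) (\<phi> (g (Suc i, j)))"
    and v: "\<And>i j. i < 3 \<Longrightarrow> Suc j < 3 \<Longrightarrow> cov (\<phi> (g (i, j))) (\<phi> (g (i, Suc j)))"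
    and ne: "\<And>i j k l. i < 3 \<Longrightarrow> j < 3 \<Longrightarrow> k < 3 \<Longrightarrow> l < 3 \<Longrightarrow> \<phi> (g (i, j)) = \<phi> (g (k, l)) \<longleftrightarrow> i = k \<and> j = l"
    using cp_grid_cov[OF cp] by auto
  have su: "cov (\<phi> (g (0, 0))) e" "cov f a" "cov (\<phi> (g (0, 2))) (\<phi> (g (1, 2)))"
     "cov e (\<phi> (g (2, 0)))" "cov a (\<phi> (g (2, 1)))" "cov (\<phi> (g (1, 2))) (\<phi> (g (2, 2)))"
    using u[of 0 0] u[of 0 1] u[of 0 2] u[of 1 0] u[of 1 1] u[of 1 2] by (simp_all add: e_def f_def a_def numeral_2_eq_2)
  have sv: "cov (\<phi> (g (0, 0))) f" "cov e a" "cov (\<phi> (g (2, 0))) (\<phi> (g (2, 1)))"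
     "cov f (\<phi> (g (0, 2)))" "cov a (\<phi> (g (1, 2)))" "cov (\<phi> (g (2, 1))) (\<phi> (g (2, 2)))"
    using v[of 0 0] v[of 1 0] v[of 2 0] v[of 0 1] v[of 1 1] v[of 2 1] by (simp_all add: e_def f_def a_def numeral_2_eq_2)
  have "fst f < fst e"
    using upper_left orient su(1) sv(1) g_carrier by (simp add: covers_cov e_def f_def)
  note z = cov_two[OF su(1) sv(1) this]
  let ?z = "\<phi> (g (0, 0))"
  have zz: "?z \<in> grid P" "?z \<notin> P" using z(1) by auto
  have a: "a = upl P (upr P ?z)" using cov_cell[OF z(1)] su(2) sv(2) z(2,3) by simp
  have a': "a = upr P (upl P ?z)" using a upl_upr_commute[OF zz] by simp
  show ae: "upr P e = a" "upl P f = a" using a a' z by auto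
  have e2: "e \<in> grid P - P \<and> \<phi> (g (2, 0)) = upl P e"
    using cov_left_side[OF z(1), of "\<phi> (g (2, 0))"] su(4) z(2) ne[of 2 0 1 1] a by (auto simp: a_def)
  have f2: "f \<in> grid P - P \<and> \<phi> (g (0, 2)) = upr P f"
    using cov_right_side[OF z(1), of "\<phi> (g (0, 2))"] sv(4) z(3) ne[of 0 2 1 1] a by (auto simp: a_def)
  show ef: "e \<in> grid P - P" "f \<in> grid P - P" "\<phi> (g (2, 0)) = upl P e" "\<phi> (g (0, 2)) = upr P f"
    using e2 f2 by auto
  show g21: "\<phi> (g (2, 1)) = upl P a" using cov_cell[OF ef(1), of "\<phi> (g (2, 1))"] su(5) sv(3) ef ae by simp
  have "\<phi> (g (1, 2)) = upl P (upr P f)" using cov_cell[OF ef(2), of "\<phi> (g (1, 2))"] sv(5) su(3) ef ae by simp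
  then show g12: "\<phi> (g (1, 2)) = upr P a" using upl_upr_commute[of f] ef(2) ae by simp
  have "upl P a \<noteq> upr P a" using ne[of 2 1 1 2] g21 g12 by simp
  then show ag: "a \<in> grid P - P" using upl_upr_P[of a] sv(5) by (auto simp: cov_def)
  show "\<phi> (g (2, 2)) = upr P (upl P a)"
    using cov_cell[OF ag, of "\<phi> (g (2, 2))"] su(6) sv(6) g21 g12 upl_upr_commute[of a] ag by simp
qed

lemma k: "k \<in> P" "snd k = snd a" and c: "c \<in> P" "fst c = fst a"
proof -
  have "a \<in> grid P" using scheme_coords by auto
  then have "\<exists>u. u \<in> P \<and> snd u = snd a" "\<exists>u. u \<in> P \<and> fst u = fst a" by (auto simp: grid_def)
  then show "k \<in> P" "snd k = snd a" "c \<in> P" "fst c = fst a"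
    unfolding k_def c_def by (metis (mono_tags, lifting) someI_ex)+
qed

sublocale left: left_scheme P T e k
  by unfold_locales (use scheme_coords k in auto)

text \<open>The right wing is a left wing of the reflected grid; \<open>f\<close> replaces
  \<open>e\<close>, and the point \<open>c\<close> of the column of the anchor replaces
  \<open>k\<close>.\<close>

sublocale right: left_scheme "prod.swap ` P" "prod.swap T" "prod.swap f" "prod.swap c"
proof (intro left_scheme.intro left_scheme_axioms.intro)
  show "perm_set (prod.swap ` P) (prod.swap T)" by (rule perm_set_swap) unfold_locales
qed (use scheme_coords c in \<open>simp_all add: grid_swap upr_swap\<close>)

lemma left_start: "phi3 (upper_left g) = left.start" "elems (upper_left g) \<subseteq> carrier D"
  using scheme_coords g_carrier by (auto simp: upper_left_def left.start_def elems_simp)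

lemma right_start: "phi3 (upper_right g) = swap3 right.start" "elems (upper_right g) \<subseteq> carrier D"
  using scheme_coords g_carrier upl_upr_commute[of a]
  by (auto simp: upper_right_def right.start_def elems_simp swap3_def triple_sel upl_swap upr_swap)

definition Lm :: "point set" where "Lm = mid_elem ` left.wing"
definition Rm :: "point set" where "Rm = prod.swap ` mid_elem ` right.wing"

lemma left_wing_img: "phi3 ` left_wing D (upper_left g) = left.wing"
  using left_wing_image(1)[OF left_start(2)] by (simp add: left_start(1) left.wing_def)

lemma right_wing_img: "phi3 ` right_wing D (upper_right g) = swap3 ` right.wing"
proof -
  have "{Z. (next_l P)\<^sup>*\<^sup>* (swap3 right.start) Z} = swap3 ` right.wing"
  proof -
    have "(next_l P)\<^sup>*\<^sup>* (swap3 right.start) Z \<longleftrightarrow> swap3 Z \<in> right.wing" for Z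
      using next_l_swap_rtranclp[of P Z "swap3 right.start"] by (simp add: right.wing_def)
    then show ?thesis by (force simp: image_iff)
  qed
  then show ?thesis using right_wing_image(1)[OF right_start(2)] by (simp add: right_start(1))
qed

lemma Lm_left: "Lm \<subseteq> left_mids P a"
  using left.wing_mids scheme_coords by (simp add: Lm_def)

lemma Rm_right: "Rm \<subseteq> right_mids P a"
proof -
  have "mid_elem ` right.wing \<subseteq> prod.swap ` right_mids P a"
    using right.wing_mids scheme_coords by (simp add: upr_swap left_mids_swap)
  then show ?thesis by (auto simp: Rm_def)
qed

lemma a_not_mid: "a \<notin> Lm" "a \<notin> Rm"
  using Lm_left Rm_right left_mids_bounds[of a a] right_mids_bounds[of a a] scheme_coords(3) by auto

lemma resect_image: "\<phi> ` carrier (resect D g) = grid P - (Lm \<union> Rm)"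
proof -
  have L: "\<phi> ` mid_elem ` left_wing D (upper_left g) = Lm"
  proof -
    have "\<phi> ` mid_elem ` left_wing D (upper_left g) = mid_elem ` phi3 ` left_wing D (upper_left g)"
      by (simp add: image_image)
    then show ?thesis by (simp add: left_wing_img Lm_def)
  qed
  have R: "\<phi> ` mid_elem ` right_wing D (upper_right g) = Rm"
  proof -
    have "\<phi> ` mid_elem ` right_wing D (upper_right g) = mid_elem ` phi3 ` right_wing D (upper_right g)"
      by (simp add: image_image)
    moreover have "mid_elem ` swap3 ` W = prod.swap ` mid_elem ` W" for W
      by (auto simp: image_image swap3_def mid_elem_def)
    ultimately show ?thesis by (simp add: right_wing_img Rm_def)
  qed
  have sub: "mid_elem ` (left_wing D (upper_left g) \<union> right_wing D (upper_right g)) \<subseteq> carrier D"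
    using left_wing_image(2)[OF left_start(2)] right_wing_image(2)[OF right_start(2)]
    by (auto simp: elems_def)
  have anch: "\<phi> (anchor g) = a" "anchor g \<in> carrier D" using g_carrier by (auto simp: anchor_def a_def)
  let ?M = "mid_elem ` (left_wing D (upper_left g) \<union> right_wing D (upper_right g))"
  have M: "\<phi> ` ?M = Lm \<union> Rm" using L R by (simp add: image_Un)
  have "anchor g \<notin> ?M"
  proof
    assume "anchor g \<in> ?M"
    from imageI[OF this, of \<phi>] show False using M a_not_mid anch(1) by simp
  qed
  then have "carrier (resect D g) = carrier D - ?M"
    by (auto simp: resect_def interior_elements_def)
  moreover have "\<phi> ` (carrier D - ?M) = \<phi> ` carrier D - \<phi> ` ?M"
    using bij sub by (intro inj_on_image_set_diff) (auto simp: bij_betw_def)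
  ultimately show ?thesis using M bij by (simp add: bij_betw_def)
qed

lemma resect_carrier: "carrier (resect D g) \<subseteq> carrier D" "le (resect D g) = le D" "eq (resect D g) = eq D"
  by (auto simp: resect_def)

lemma resect_po: "partial_order (resect D g)"
proof -
  interpret partial_order D by (rule po)
  have "weak_partial_order (D\<lparr>carrier := carrier (resect D g)\<rparr>)"
    by (rule weak_partial_order_subset[OF weak_partial_order_axioms resect_carrier(1)])
  moreover have "D\<lparr>carrier := carrier (resect D g)\<rparr> = resect D g" by (simp add: resect_def)
  ultimately show ?thesis
    using eq_is_equal by (simp add: partial_order_def partial_order_axioms_def resect_def)
qed

lemma resect_model:
  assumes "Lm = left_mids P a" "Rm = right_mids P a"
  shows "order_model (insert a (P - {k, c})) T (resect D g) \<phi>"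
proof (intro order_model.intro order_model_axioms.intro)
  have ag: "a \<in> grid P" "a \<notin> P" using scheme_coords by auto
  show "perm_set (insert a (P - {k, c})) T" using perm_set_resect[OF ag k c] .
  show "partial_order (resect D g)" by (rule resect_po)
  have "\<phi> ` carrier (resect D g) = grid (insert a (P - {k, c}))"
    using resect_image assms grid_resect[OF ag k c] by simp
  then show "bij_betw \<phi> (carrier (resect D g)) (grid (insert a (P - {k, c})))"
    using bij resect_carrier(1) unfolding bij_betw_def by (meson inj_on_subset)
  show "le (resect D g) x y \<longleftrightarrow> \<phi> x \<le> \<phi> y" if "x \<in> carrier (resect D g)" "y \<in> carrier (resect D g)" for x y
    using that le_iff[of x y] resect_carrier(1) unfolding resect_carrier(2) by blast
qed

text \<open>The bottom and the top of the grid survive the deletion, so the resected diagram is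
  planar and bounded, and the crossing argument applies to it.\<close>

lemma planar_interpolation:
  assumes "planar_hasse_diagram (resect D g)"
    and G: "{x, y, u, v} \<subseteq> grid P - (Lm \<union> Rm)" and l: "x \<le> u" "x \<le> v" "y \<le> u" "y \<le> v"
  shows "\<exists>z\<in>grid P - (Lm \<union> Rm). x \<le> z \<and> y \<le> z \<and> z \<le> u \<and> z \<le> v"
proof -
  have ag: "a \<in> grid P" "a \<notin> P" "a \<noteq> T" using scheme_coords notP_T by auto
  have out: "w \<in> grid P - (Lm \<union> Rm)" if "w \<in> grid P" "w \<le> a \<or> a \<le> w \<and> snd a < snd w \<and> fst a < fst w" for w
    using that Lm_left Rm_right left_mids_bounds[OF ag(1,2), of w] right_mids_bounds[OF ag(1,2), of w]
    by (auto simp: le_point)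
  define bo where "bo = pinf P"
  have bo: "bo \<in> grid P" "\<And>w. w \<in> grid P \<Longrightarrow> bo \<le> w"
    unfolding bo_def using T_in by (auto intro: pinf_grid le_pinf_grid)
  have T: "T \<in> grid P - (Lm \<union> Rm)"
    using out[OF T_grid] grid_le_T[OF ag(1)] grid_fst_T[OF ag(1,3)] grid_snd_T[OF ag(1,3)] by auto
  have bo': "bo \<in> grid P - (Lm \<union> Rm)" using out[OF bo(1)] bo(2)[OF ag(1)] by auto
  note im = resect_image[symmetric]
  obtain b t where bt: "b \<in> carrier (resect D g)" "\<phi> b = bo" "t \<in> carrier (resect D g)" "\<phi> t = T"
    using T bo' unfolding im by (metis imageE)
  have le: "le (resect D g) x y \<longleftrightarrow> \<phi> x \<le> \<phi> y" if "x \<in> carrier (resect D g)" "y \<in> carrier (resect D g)" for x y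
    using that le_iff[of x y] resect_carrier(1) unfolding resect_carrier(2) by blast
  interpret R: planar_bounded "resect D g" b t
  proof
    show "planar_hasse_diagram (resect D g)" by fact
    fix x assume x: "x \<in> carrier (resect D g)"
    then have "\<phi> x \<in> grid P" using resect_carrier phi_grid by blast
    then show "le (resect D g) b x" "le (resect D g) x t" using le x bt bo grid_le_T by auto
  qed (use bt in auto)
  obtain x' y' u' v' where p: "{x', y', u', v'} \<subseteq> carrier (resect D g)" "\<phi> x' = x" "\<phi> y' = y" "\<phi> u' = u" "\<phi> v' = v"
    using G unfolding im by (auto simp: image_iff)
  from R.interpolation[OF p(1)] l p obtain z where "z \<in> carrier (resect D g)" "le (resect D g) x' z" "le (resect D g) y' z"
     "le (resect D g) z u'" "le (resect D g) z v'" by (auto simp: le)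
  then show ?thesis unfolding im using p by (intro bexI[of _ "\<phi> z"]) (auto simp: le)
qed

end

lemma swap_image_eq: "prod.swap ` A = prod.swap ` B \<Longrightarrow> A = B"
  by (subst (asm) inj_image_eq_iff) (simp_all add: inj_def prod_eq_iff)

context scheme_base
begin

lemma swap_diff: "prod.swap ` (A - B) = prod.swap ` A - prod.swap ` B"
  by (intro image_set_diff) (simp add: inj_def prod_eq_iff)

lemma right_mids_swap: "right_mids (prod.swap ` P) (prod.swap a) = prod.swap ` left_mids P a"
proof -
  have "left_mids (prod.swap ` prod.swap ` P) (prod.swap (prod.swap a)) = prod.swap ` right_mids (prod.swap ` P) (prod.swap a)"
    by (rule left_mids_swap)
  then show ?thesis by (simp add: image_image)
qed

lemma mids_right_wing: "mid_elem ` right.wing = prod.swap ` Rm"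
  by (simp add: Rm_def image_image)

lemma right_anchor: "upr (prod.swap ` P) (prod.swap f) = prod.swap a"
  using scheme_coords by (simp add: upr_swap)

text \<open>For each wing, only the inclusion of the other wing in its expected set is used, so the
  two sides can be settled one after the other without circularity.\<close>

lemma C3_scheme_mids:
  assumes "C3_scheme D g" and planar: "planar_hasse_diagram (resect D g)"
  shows "Lm = left_mids P a" "Rm = right_mids P a"
proof -
  have ends: "left_wing_terminates_on_boundary D (upper_left g)" "right_wing_terminates_on_boundary D (upper_right g)"
    using assms(1) by (auto simp: C3_scheme_def)
  obtain X where X: "X \<in> left_wing D (upper_left g)" "elems X \<subseteq> boundary D"
    using ends(1) by (auto simp: left_wing_terminates_on_boundary_def)
  have Xb: "on_left P (mid_elem (phi3 X)) \<or> on_right P (mid_elem (phi3 X))"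
    using elems_bd[of X] X left_wing_image(2)[OF left_start(2)] by auto
  have Xw: "phi3 X \<in> left.wing" using X(1) left_wing_img by auto
  obtain Y where Y: "Y \<in> right_wing D (upper_right g)" "elems Y \<subseteq> boundary D"
    using ends(2) by (auto simp: right_wing_terminates_on_boundary_def)
  have Yb: "on_left P (mid_elem (phi3 Y)) \<or> on_right P (mid_elem (phi3 Y))"
    using elems_bd[of Y] Y right_wing_image(2)[OF right_start(2)] by auto
  have "phi3 Y \<in> swap3 ` right.wing" using Y(1) right_wing_img by auto
  then obtain Z where Z: "Z \<in> right.wing" "phi3 Y = swap3 Z" by auto
  have Zm: "mid_elem Z = prod.swap (mid_elem (phi3 Y))" unfolding Z(2) by (simp add: swap3_def mid_elem_def)
  have ua: "upr P e = a" using scheme_coords by simp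
  have "mid_elem ` left.wing = left_mids P (upr P e)"
  proof (rule left.mid_on_boundary_covers[OF Xw Xb])
    show "Rm \<subseteq> right_mids P (upr P e)" using Rm_right ua by simp
    show "\<exists>z\<in>grid P - (mid_elem ` left.wing \<union> Rm). x \<le> z \<and> y \<le> z \<and> z \<le> u \<and> z \<le> v"
      if "{x, y, u, v} \<subseteq> grid P - (mid_elem ` left.wing \<union> Rm)" "x \<le> u" "x \<le> v" "y \<le> u" "y \<le> v" for x y u v
      using planar_interpolation[OF planar, of x y u v] that by (simp only: Lm_def)
  qed
  then show "Lm = left_mids P a" by (simp add: Lm_def ua)
  have "mid_elem ` right.wing = left_mids (prod.swap ` P) (upr (prod.swap ` P) (prod.swap f))"
  proof (rule right.mid_on_boundary_covers[OF Z(1)])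
    show "on_left (prod.swap ` P) (mid_elem Z) \<or> on_right (prod.swap ` P) (mid_elem Z)"
      using Yb by (simp add: Zm on_left_swap on_right_swap disj_commute)
    show "prod.swap ` Lm \<subseteq> right_mids (prod.swap ` P) (upr (prod.swap ` P) (prod.swap f))"
      using Lm_left by (auto simp: right_anchor right_mids_swap)
    have G: "grid (prod.swap ` P) - (mid_elem ` right.wing \<union> prod.swap ` Lm) = prod.swap ` (grid P - (Lm \<union> Rm))"
      by (simp add: grid_swap mids_right_wing swap_diff image_Un Un_commute)
    fix x y u v
    assume h: "{x, y, u, v} \<subseteq> grid (prod.swap ` P) - (mid_elem ` right.wing \<union> prod.swap ` Lm)" "x \<le> u" "x \<le> v" "y \<le> u" "y \<le> v"
    have sl: "prod.swap p \<le> prod.swap q \<longleftrightarrow> p \<le> q" for p q :: point by (auto simp: le_point)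
    have "{prod.swap x, prod.swap y, prod.swap u, prod.swap v} \<subseteq> grid P - (Lm \<union> Rm)"
      using h(1) unfolding G by auto
    then obtain z where z: "z \<in> grid P - (Lm \<union> Rm)" "prod.swap x \<le> z" "prod.swap y \<le> z" "z \<le> prod.swap u" "z \<le> prod.swap v"
      using planar_interpolation[OF planar, of "prod.swap x" "prod.swap y" "prod.swap u" "prod.swap v"] h by (auto simp: sl)
    then show "\<exists>z\<in>grid (prod.swap ` P) - (mid_elem ` right.wing \<union> prod.swap ` Lm). x \<le> z \<and> y \<le> z \<and> z \<le> u \<and> z \<le> v"
      unfolding G by (intro bexI[of _ "prod.swap z"]) (auto simp: le_point)
  qed
  then have "prod.swap ` Rm = prod.swap ` right_mids P a" by (simp add: mids_right_wing right_anchor left_mids_swap)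
  then show "Rm = right_mids P a" by (rule swap_image_eq)
qed

text \<open>This is the direction for building schemes: a chain of the wing entirely on the proper
  boundary both stops the wing and shows that the wing has passed through the row and the
  column.\<close>

lemma ends_scheme:
  assumes L: "\<exists>X\<in>left.wing. on_left P (bot_elem X) \<and> on_left P (mid_elem X) \<and> on_left P (top_elem X)"
    and R: "\<exists>X\<in>right.wing. on_left (prod.swap ` P) (bot_elem X) \<and> on_left (prod.swap ` P) (mid_elem X) \<and> on_left (prod.swap ` P) (top_elem X)"
  shows "C3_scheme D g" "Lm = left_mids P a" "Rm = right_mids P a"
proof -
  have ua: "upr P e = a" using scheme_coords by simp
  obtain X where X: "X \<in> left.wing" "on_left P (bot_elem X)" "on_left P (mid_elem X)" "on_left P (top_elem X)"
    using L by blast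
  show "Lm = left_mids P a" using left.wing_covers[OF X(1,3)] X(4) by (simp add: Lm_def ua)
  obtain Y where Y: "Y \<in> right.wing" "on_left (prod.swap ` P) (bot_elem Y)"
    "on_left (prod.swap ` P) (mid_elem Y)" "on_left (prod.swap ` P) (top_elem Y)"
    using R by blast
  have "prod.swap ` Rm = prod.swap ` right_mids P a"
    using right.wing_covers[OF Y(1,3)] Y(4) by (simp add: mids_right_wing right_anchor left_mids_swap)
  then show "Rm = right_mids P a" by (rule swap_image_eq)
  obtain X' where X': "X' \<in> left_wing D (upper_left g)" "phi3 X' = X" using X(1) left_wing_img by (metis imageE)
  have X'c: "elems X' \<subseteq> carrier D" using X'(1) left_wing_image(2)[OF left_start(2)] by auto
  have "\<not> next_left D W X'" for W
    using next_left_imp(3)[of W X'] on_left_no_next[OF X(2,3), of "phi3 W"] X'(2) by auto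
  moreover have "elems X' \<subseteq> boundary D" using elems_bd[OF X'c] X X' by simp
  ultimately have l: "left_wing_terminates_on_boundary D (upper_left g)"
    unfolding left_wing_terminates_on_boundary_def using X'(1) by blast
  have "swap3 Y \<in> phi3 ` right_wing D (upper_right g)" using right_wing_img Y(1) by auto
  then obtain Y' where Y': "Y' \<in> right_wing D (upper_right g)" "phi3 Y' = swap3 Y" by (metis imageE)
  have Y'c: "elems Y' \<subseteq> carrier D" using Y'(1) right_wing_image(2)[OF right_start(2)] by auto
  have "\<not> next_left D Y' W" for W
  proof
    assume "next_left D Y' W"
    then have "next_l (prod.swap ` P) (swap3 (phi3 W)) (swap3 (swap3 Y))"
      using next_left_imp(3)[of Y' W] next_l_swap_imp Y'(2) by metis
    then show False using right.on_left_no_next[OF Y(2,3)] by simp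
  qed
  moreover have "elems Y' \<subseteq> boundary D"
  proof -
    have "on_right P (prod.swap z)" if "on_left (prod.swap ` P) z" for z
      using on_left_swap[of P "prod.swap z"] that by simp
    then show ?thesis using elems_bd[OF Y'c] Y Y'(2) by (simp add: swap3_def triple_sel)
  qed
  ultimately have "right_wing_terminates_on_boundary D (upper_right g)"
    unfolding right_wing_terminates_on_boundary_def using Y'(1) by blast
  then show "C3_scheme D g" using l cp orient by (simp add: C3_scheme_def)
qed

end

section \<open>Left-right order and coordinates\<close>

lemma planar_diagram_model:
  assumes "planar_bounded D bt tp" "order_model P T D \<phi>"
    and l: "\<And>x y. x \<in> carrier D \<Longrightarrow> y \<in> carrier D \<Longrightarrow> planar_bounded.lft D bt tp x y \<longleftrightarrow> fst (\<phi> y) < fst (\<phi> x) \<and> snd (\<phi> x) < snd (\<phi> y)"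
  shows "diagram_model P T D \<phi>"
proof -
  interpret pb: planar_bounded D bt tp by fact
  interpret om: order_model P T D \<phi> by fact
  show ?thesis
  proof
    show "left_of_line b a c \<longleftrightarrow> fst (\<phi> c) < fst (\<phi> b) \<and> snd (\<phi> b) < snd (\<phi> c)"
      if "covers D a b" "covers D a c" for a b c
      using pb.upper_covers_left[OF that] l that by (simp add: om.covers_cov)
    show "left_of_line b c a \<longleftrightarrow> fst (\<phi> c) < fst (\<phi> b) \<and> snd (\<phi> b) < snd (\<phi> c)"
      if "covers D b a" "covers D c a" for a b c
      using pb.lower_covers_left[OF that] l that by (simp add: om.covers_cov)
    have im: "grid P = \<phi> ` carrier D" using om.bij by (simp add: bij_betw_def)
    have lc: "z \<in> carrier D \<and> x \<in> carrier D" if "pb.lft z x" for z x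
      using pb.lft_inc[OF that] by (simp add: pb.inc_def)
    have "(\<not> (\<exists>z. pb.lft z x)) \<longleftrightarrow> on_left P (\<phi> x)" "(\<not> (\<exists>z. pb.lft x z)) \<longleftrightarrow> on_right P (\<phi> x)"
      if "x \<in> carrier D" for x
    proof -
      have "(\<exists>z. pb.lft z x) \<longleftrightarrow> (\<exists>z\<in>carrier D. pb.lft z x)" "(\<exists>z. pb.lft x z) \<longleftrightarrow> (\<exists>z\<in>carrier D. pb.lft x z)"
        using lc by blast+
      then show "(\<not> (\<exists>z. pb.lft z x)) \<longleftrightarrow> on_left P (\<phi> x)" "(\<not> (\<exists>z. pb.lft x z)) \<longleftrightarrow> on_right P (\<phi> x)"
        using that l by (simp_all add: on_left_def on_right_def im)
    qed
    then show "boundary D = {x\<in>carrier D. on_left P (\<phi> x) \<or> on_right P (\<phi> x)}"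
      unfolding pb.boundary_eq by blast
  qed
qed

text \<open>The orientation of two upper covers spreads to every incomparable pair: covers of the
  meet of \<open>x\<close> and \<open>y\<close> are chosen below \<open>x\<close> and
  \<open>y\<close>. Moving up to \<open>x\<close> and \<open>y\<close> keeps both the relation
  \<open>lft\<close> and the comparison of coordinates.\<close>

lemma planar_model_lft:
  assumes "planar_bounded D bt tp" "order_model P T D \<phi>"
    and l: "\<And>a b c. covers D a b \<Longrightarrow> covers D a c \<Longrightarrow> left_of_line b a c \<longleftrightarrow> fst (\<phi> c) < fst (\<phi> b) \<and> snd (\<phi> b) < snd (\<phi> c)"
    and xy: "x \<in> carrier D" "y \<in> carrier D"
  shows "planar_bounded.lft D bt tp x y \<longleftrightarrow> fst (\<phi> y) < fst (\<phi> x) \<and> snd (\<phi> x) < snd (\<phi> y)"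
proof -
  interpret pb: planar_bounded D bt tp by fact
  interpret om: order_model P T D \<phi> by fact
  have *: "pb.lft x y \<or> fst (\<phi> x) < fst (\<phi> y) \<and> snd (\<phi> y) < snd (\<phi> x) \<and> pb.lft y x" if "pb.inc x y" for x y
  proof -
    have xy: "x \<in> carrier D" "y \<in> carrier D" "\<not> le D x y" "\<not> le D y x" using that by (auto simp: pb.inc_def)
    define w where "w = meet D x y"
    have w: "w \<in> carrier D" "\<phi> w = pmin (\<phi> x) (\<phi> y)" using om.meet_carrier om.phi_meet xy by (auto simp: w_def)
    then have wl: "le D w x" "le D w y" using xy by (simp_all add: om.le_iff)
    then have wx: "le D w x" "w \<noteq> x" "le D w y" "w \<noteq> y" using xy by auto
    obtain x' where x': "covers D w x'" "le D x' x" using pb.exists_cover wx w xy by blast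
    obtain y' where y': "covers D w y'" "le D y' y" using pb.exists_cover wx w xy by blast
    have c: "x' \<in> carrier D" "y' \<in> carrier D" "w \<noteq> x'" "w \<noteq> y'" "le D w x'" "le D w y'"
      using x' y' by (auto simp: pb.covers_iff)
    have below: "z = w" if "z \<in> carrier D" "le D w z" "le D z x" "le D z y" for z
    proof -
      have "\<phi> z \<le> \<phi> w" using that xy om.le_iff w by simp
      then show ?thesis using that w om.le_iff om.phi_inj by (meson antisym)
    qed
    have n1: "\<not> le D x' y" "\<not> le D y' x" using below[of x'] below[of y'] c x' y' by auto
    have i1: "pb.inc x' y" using n1 xy c pb.le_trans[of y x' x] x' by (auto simp: pb.inc_def)
    have i2: "pb.inc x' y'" using n1 xy c pb.le_trans[of x' y' y] pb.le_trans[of y' x' x] x' y' by (auto simp: pb.inc_def)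
    have lxy: "pb.lft x' y' \<Longrightarrow> pb.lft x y"
      using pb.lft_move_right[OF _ i1, of y'] pb.lft_move_left[OF _ that, of x'] x' y' by blast
    have i3: "pb.inc y' x" using n1 xy c pb.le_trans[of x y' y] y' by (auto simp: pb.inc_def)
    have lyx: "pb.lft y' x' \<Longrightarrow> pb.lft y x"
      using pb.lft_move_right[OF _ i3, of x'] pb.lft_move_left[OF _ pb.inc_sym[OF that], of y'] x' y' by blast
    show ?thesis
    proof (cases "pb.lft x' y'")
      case True then show ?thesis using lxy by simp
    next
      case False
      then have lf: "pb.lft y' x'" using pb.lft_total[OF i2] by simp
      then have co: "fst (\<phi> x') < fst (\<phi> y')" "snd (\<phi> y') < snd (\<phi> x')"
        using l[OF y'(1) x'(1)] pb.upper_covers_left[OF y'(1) x'(1)] by auto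
      have "\<phi> x' \<le> \<phi> x" "\<phi> y' \<le> \<phi> y" "\<phi> w \<le> \<phi> x'" "\<phi> w \<le> \<phi> y'"
        using x' y' c xy w om.le_iff by auto
      moreover have "\<not> \<phi> x \<le> \<phi> y" "\<not> \<phi> y \<le> \<phi> x" using xy om.le_iff by auto
      ultimately have "fst (\<phi> x) < fst (\<phi> y) \<and> snd (\<phi> y) < snd (\<phi> x)"
        using co w(2) by (auto simp: le_point pmin_def min_def split: if_splits)
      then show ?thesis using lyx lf by simp
    qed
  qed
  show ?thesis
  proof (cases "pb.inc x y")
    case True
    have "\<not> pb.lft x y \<Longrightarrow> fst (\<phi> x) < fst (\<phi> y)" using *[OF True] by auto
    moreover have "pb.lft x y \<Longrightarrow> fst (\<phi> y) < fst (\<phi> x) \<and> snd (\<phi> x) < snd (\<phi> y)"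
      using *[OF pb.inc_sym[OF True]] pb.lft_asym by blast
    ultimately show ?thesis by force
  next
    case False
    then have "\<phi> x \<le> \<phi> y \<or> \<phi> y \<le> \<phi> x" using xy om.le_iff by (auto simp: pb.inc_def)
    moreover have "\<not> pb.lft x y" using False pb.lft_inc by blast
    ultimately show ?thesis by (auto simp: le_point)
  qed
qed


section \<open>Coordinatization of slim semimodular diagrams\<close>

locale slim_planar = planar_bounded D bt tp for D bt tp +
  assumes lat: "lattice D" and sl: "slim D" and sm: "semimodular D"
begin

lemma join_facts:
  assumes "x \<in> carrier D" "y \<in> carrier D"
  shows "join D x y \<in> carrier D" "le D x (join D x y)" "le D y (join D x y)"
    "\<And>w. w \<in> carrier D \<Longrightarrow> le D x w \<Longrightarrow> le D y w \<Longrightarrow> le D (join D x y) w"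
proof -
  interpret lattice D by (rule lat)
  show "join D x y \<in> carrier D" "le D x (join D x y)" "le D y (join D x y)"
    using assms join_closed join_left join_right by auto
  show "\<And>w. w \<in> carrier D \<Longrightarrow> le D x w \<Longrightarrow> le D y w \<Longrightarrow> le D (join D x y) w"
    using assms join_le by auto
qed

lemma meet_facts:
  assumes "x \<in> carrier D" "y \<in> carrier D"
  shows "meet D x y \<in> carrier D" "le D (meet D x y) x" "le D (meet D x y) y"
    "\<And>w. w \<in> carrier D \<Longrightarrow> le D w x \<Longrightarrow> le D w y \<Longrightarrow> le D w (meet D x y)"
proof -
  interpret lattice D by (rule lat)
  show "meet D x y \<in> carrier D" "le D (meet D x y) x" "le D (meet D x y) y"
    using assms meet_closed meet_left meet_right by auto
  show "\<And>w. w \<in> carrier D \<Longrightarrow> le D w x \<Longrightarrow> le D w y \<Longrightarrow> le D w (meet D x y)"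
    using assms meet_le by auto
qed

lemma bottom_least: "y \<in> carrier D \<Longrightarrow> le D (bottom D) y"
proof -
  assume y: "y \<in> carrier D"
  have "least D bt (carrier D)" using bt bt_le by (auto simp: least_def)
  then have "least D (bottom D) (carrier D)" unfolding bottom_def by (rule someI)
  then show ?thesis using y by (auto simp: least_def)
qed

text \<open>A minimal element below \<open>x\<close> but not below \<open>y\<close> works: proper
  joinands of it would be below \<open>y\<close>, and so would their join.\<close>

lemma exists_Ji:
  assumes "x \<in> carrier D" "y \<in> carrier D" "\<not> le D x y"
  shows "\<exists>j\<in>Ji D. le D j x \<and> \<not> le D j y"
proof -
  let ?S = "{z\<in>carrier D. le D z x \<and> \<not> le D z y}"
  have "x \<in> ?S" using assms le_refl by auto
  then obtain j where j: "j \<in> ?S" "\<forall>z\<in>?S. le D z j \<longrightarrow> z = j" using exists_minimal[of ?S] by blast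
  have "j \<in> Ji D" unfolding Ji_def
  proof (intro CollectI conjI ballI impI)
    show "j \<in> carrier D" "j \<noteq> bottom D" using j bottom_least[OF assms(2)] by auto
    fix a b assume ab: "a \<in> carrier D" "b \<in> carrier D" "j = join D a b"
    have jc: "j \<in> carrier D" using j by auto
    have aj: "le D a j" "le D b j" using join_facts[OF ab(1,2)] ab by auto
    then have ax: "le D a x" "le D b x" using le_trans j assms ab by blast+
    show "j = a \<or> j = b"
    proof (rule ccontr)
      assume n: "\<not> (j = a \<or> j = b)"
      have "le D w y" if w: "w \<in> carrier D" "le D w x" "le D w j" "w \<noteq> j" for w
      proof (rule ccontr)
        assume "\<not> le D w y"
        then have "w \<in> ?S" using w by simp
        from j(2)[rule_format, OF this w(3)] w(4) show False by simp
      qed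
      from this[OF ab(1) ax(1) aj(1)] this[OF ab(2) ax(2) aj(2)]
      have "le D a y" "le D b y" using n by blast+
      then have "le D j y" using join_facts(4)[OF ab(1,2) assms(2)] ab(3) by simp
      then show False using j by simp
    qed
  qed
  then show ?thesis using j by blast
qed

definition LB :: "point set" where "LB = {x\<in>carrier D. \<not> (\<exists>z. lft z x)}"
definition RB :: "point set" where "RB = {x\<in>carrier D. \<not> (\<exists>z. lft x z)}"

text \<open>An element off both boundaries has something to its left and to its right. Passing to
  join-irreducible elements below those, but not below \<open>x\<close>, keeps the sides and gives a
  three-element antichain.\<close>

lemma Ji_boundary: "Ji D \<subseteq> LB \<union> RB"
proof
  fix x assume x: "x \<in> Ji D"
  then have xc: "x \<in> carrier D" by (auto simp: Ji_def)
  show "x \<in> LB \<union> RB"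
  proof (rule ccontr)
    assume "\<not> ?thesis"
    then obtain p q where pq: "lft p x" "lft x q" using xc by (auto simp: LB_def RB_def)
    have c: "p \<in> carrier D" "q \<in> carrier D" "\<not> le D p x" "\<not> le D x p" "\<not> le D q x" "\<not> le D x q"
      using lft_inc[OF pq(1)] lft_inc[OF pq(2)] by (auto simp: inc_def)
    obtain p' where p': "p' \<in> Ji D" "le D p' p" "\<not> le D p' x" using exists_Ji[OF c(1) xc c(3)] by blast
    obtain q' where q': "q' \<in> Ji D" "le D q' q" "\<not> le D q' x" using exists_Ji[OF c(2) xc c(5)] by blast
    have c': "p' \<in> carrier D" "q' \<in> carrier D" using p' q' by (auto simp: Ji_def)
    have i: "inc p' x" "inc x q'"
      using c c' p' q' xc le_trans[of x p' p] le_trans[of x q' q] by (auto simp: inc_def)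
    have l: "lft p' x" "lft x q'" using lft_move_left[OF pq(1) i(1)] lft_move_right[OF pq(2) i(2)] p' q' by auto
    have i2: "inc p' q'" using lft_inc[OF lft_trans[OF l]] .
    have "card {p', x, q'} = 3" using i i2 le_refl[OF xc] le_refl[OF c'(1)] by (auto simp: inc_def card_insert_if)
    moreover have "antichain D {p', x, q'}"
      using i i2 xc c' unfolding antichain_def inc_def by auto
    moreover have "{p', x, q'} \<subseteq> Ji D" using p' q' x by simp
    ultimately have "\<exists>X\<subseteq>Ji D. card X = 3 \<and> antichain D X" by (intro exI[of _ "{p', x, q'}"] conjI)
    then show False using sl by (simp add: slim_def)
  qed
qed

lemma LB_props: "LB \<subseteq> carrier D" "\<And>x y. x \<in> LB \<Longrightarrow> y \<in> LB \<Longrightarrow> le D x y \<or> le D y x"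
  "\<And>y. y \<in> carrier D \<Longrightarrow> (\<And>x. x \<in> LB \<Longrightarrow> le D x y \<or> le D y x) \<Longrightarrow> y \<in> LB"
  and RB_props: "RB \<subseteq> carrier D" "\<And>x y. x \<in> RB \<Longrightarrow> y \<in> RB \<Longrightarrow> le D x y \<or> le D y x"
  "\<And>y. y \<in> carrier D \<Longrightarrow> (\<And>x. x \<in> RB \<Longrightarrow> le D x y \<or> le D y x) \<Longrightarrow> y \<in> RB"
proof -
  have mc: "K \<subseteq> carrier D \<and> (\<forall>x\<in>K. \<forall>y\<in>K. le D x y \<or> le D y x) \<and>
      (\<forall>y\<in>carrier D. (\<forall>x\<in>K. le D x y \<or> le D y x) \<longrightarrow> y \<in> K)"
    if "pred_on.maxchain (carrier D) (le D) K" for K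
  proof -
    have K: "K \<subseteq> carrier D" "\<forall>x\<in>K. \<forall>y\<in>K. le D x y \<or> le D y x"
      using that le_refl unfolding pred_on.maxchain_def pred_on.chain_def by blast+
    moreover have "y \<in> K" if y: "y \<in> carrier D" "\<forall>x\<in>K. le D x y \<or> le D y x" for y
    proof (rule ccontr)
      assume "y \<notin> K"
      moreover have "pred_on.chain (carrier D) (le D) (insert y K)"
        using K y unfolding pred_on.chain_def by blast
      ultimately show False
        using \<open>pred_on.maxchain (carrier D) (le D) K\<close> unfolding pred_on.maxchain_def by blast
    qed
    ultimately show ?thesis by blast
  qed
  have L: "pred_on.maxchain (carrier D) (le D) LB"
    by (rule conjunct1[OF iffD2[OF boundary_chain_iff[where R = lft and S = left_of_line]]])
      (use lft_inc lft_total lft_asym lft_trans left_of_edge(1) LB_def in blast)+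
  have R: "pred_on.maxchain (carrier D) (le D) RB"
    by (rule conjunct1[OF iffD2[OF boundary_chain_iff[where R = "\<lambda>x y. lft y x" and S = right_of_line]]])
      (use lft_inc inc_sym lft_total lft_asym lft_trans left_of_edge(2) RB_def in blast)+
  show "LB \<subseteq> carrier D" "\<And>x y. x \<in> LB \<Longrightarrow> y \<in> LB \<Longrightarrow> le D x y \<or> le D y x"
    "\<And>y. y \<in> carrier D \<Longrightarrow> (\<And>x. x \<in> LB \<Longrightarrow> le D x y \<or> le D y x) \<Longrightarrow> y \<in> LB" using mc[OF L] by blast+
  show "RB \<subseteq> carrier D" "\<And>x y. x \<in> RB \<Longrightarrow> y \<in> RB \<Longrightarrow> le D x y \<or> le D y x"
    "\<And>y. y \<in> carrier D \<Longrightarrow> (\<And>x. x \<in> RB \<Longrightarrow> le D x y \<or> le D y x) \<Longrightarrow> y \<in> RB" using mc[OF R] by blast+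
qed

definition below :: "point set \<Rightarrow> point \<Rightarrow> point set" where
  "below K x = {c\<in>K. le D c x}"

definition maxch :: "point set \<Rightarrow> bool" where
  "maxch K \<longleftrightarrow> K \<subseteq> carrier D \<and> (\<forall>x\<in>K. \<forall>y\<in>K. le D x y \<or> le D y x) \<and>
    (\<forall>y\<in>carrier D. (\<forall>x\<in>K. le D x y \<or> le D y x) \<longrightarrow> y \<in> K)"

lemma maxch_LB: "maxch LB" and maxch_RB: "maxch RB"
  unfolding maxch_def using LB_props RB_props by blast+

text \<open>Both sets are initial segments of the chain \<open>K\<close>, so their sizes contain the
  same information as the sets.\<close>

lemma below_nested:
  assumes K: "maxch K" and c: "x \<in> carrier D" "y \<in> carrier D"
  shows "below K x \<subseteq> below K y \<or> below K y \<subseteq> below K x"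
proof (rule ccontr)
  assume "\<not> ?thesis"
  then obtain u v where uv: "u \<in> K" "le D u x" "\<not> le D u y" "v \<in> K" "le D v y" "\<not> le D v x"
    by (auto simp: below_def)
  then have "u \<in> carrier D" "v \<in> carrier D" "le D u v \<or> le D v u" using K by (auto simp: maxch_def)
  then show False using uv le_trans c by blast
qed

lemma finite_below: "maxch K \<Longrightarrow> finite (below K x)"
  using fin finite_subset by (fastforce simp: below_def maxch_def)

lemma card_below_le:
  assumes K: "maxch K" and c: "x \<in> carrier D" "y \<in> carrier D"
  shows "card (below K x) \<le> card (below K y) \<longleftrightarrow> below K x \<subseteq> below K y"
  using below_nested[OF assms] card_mono[OF finite_below[OF K]] card_seteq[OF finite_below[OF K]] by blast

lemma below_mono:
  "maxch K \<Longrightarrow> le D x y \<Longrightarrow> x \<in> carrier D \<Longrightarrow> y \<in> carrier D \<Longrightarrow> below K x \<subseteq> below K y"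
  using le_trans unfolding below_def maxch_def by blast

lemma below_meet:
  assumes K: "maxch K" and c: "x \<in> carrier D" "y \<in> carrier D"
  shows "card (below K (meet D x y)) = min (card (below K x)) (card (below K y))"
proof -
  note m = meet_facts[OF c]
  have "below K (meet D x y) = below K x \<inter> below K y"
  proof
    show "below K (meet D x y) \<subseteq> below K x \<inter> below K y" using below_mono[OF K] m c by blast
    show "below K x \<inter> below K y \<subseteq> below K (meet D x y)" using m(4) K unfolding below_def maxch_def by blast
  qed
  moreover have "below K x \<inter> below K y = below K x \<or> below K x \<inter> below K y = below K y"
    using below_nested[OF assms] by blast
  ultimately show ?thesis
    using card_mono[OF finite_below[OF K], of "below K x \<inter> below K y"] by (metis inf_le1 inf_le2 min.absorb1 min.absorb2)
qed

definition \<phi> :: "point \<Rightarrow> point" where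
  "\<phi> x = (real (card (below LB x)), real (card (below RB x)))"

lemma phi_fst: "x \<in> carrier D \<Longrightarrow> y \<in> carrier D \<Longrightarrow> fst (\<phi> x) \<le> fst (\<phi> y) \<longleftrightarrow> below LB x \<subseteq> below LB y"
  by (simp add: \<phi>_def card_below_le maxch_LB)

lemma phi_snd: "x \<in> carrier D \<Longrightarrow> y \<in> carrier D \<Longrightarrow> snd (\<phi> x) \<le> snd (\<phi> y) \<longleftrightarrow> below RB x \<subseteq> below RB y"
  by (simp add: \<phi>_def card_below_le maxch_RB)

lemma phi_le: assumes c: "x \<in> carrier D" "y \<in> carrier D" shows "le D x y \<longleftrightarrow> \<phi> x \<le> \<phi> y"
proof
  assume "le D x y"
  then show "\<phi> x \<le> \<phi> y" using below_mono maxch_LB maxch_RB c by (simp add: le_point phi_fst phi_snd)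
next
  assume "\<phi> x \<le> \<phi> y"
  then have b: "below LB x \<subseteq> below LB y" "below RB x \<subseteq> below RB y" using c by (simp_all add: le_point phi_fst phi_snd)
  show "le D x y"
  proof (rule ccontr)
    assume "\<not> ?thesis"
    then obtain j where "j \<in> Ji D" "le D j x" "\<not> le D j y" using exists_Ji c by blast
    then show False using Ji_boundary b unfolding below_def by blast
  qed
qed

lemma phi_inj: "x \<in> carrier D \<Longrightarrow> y \<in> carrier D \<Longrightarrow> \<phi> x = \<phi> y \<Longrightarrow> x = y"
  using phi_le[of x y] phi_le[of y x] le_antisym by auto

lemma phi_meet: "x \<in> carrier D \<Longrightarrow> y \<in> carrier D \<Longrightarrow> \<phi> (meet D x y) = pmin (\<phi> x) (\<phi> y)"
  by (simp add: \<phi>_def pmin_def below_meet maxch_LB maxch_RB of_nat_min)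

text \<open>A join-irreducible element below \<open>x\<close> but not below \<open>y\<close> is
  still to the left of \<open>y\<close>, so it is not on the right boundary. Hence it belongs to the
  left one and is counted for \<open>x\<close> but not for \<open>y\<close>. The second claim is
  symmetric.\<close>

lemma lft_phi_imp:
  assumes "lft x y" shows "fst (\<phi> y) < fst (\<phi> x)" "snd (\<phi> x) < snd (\<phi> y)"
proof -
  have c: "x \<in> carrier D" "y \<in> carrier D" "\<not> le D x y" "\<not> le D y x" using lft_inc[OF assms] by (auto simp: inc_def)
  show "fst (\<phi> y) < fst (\<phi> x)"
  proof (rule ccontr)
    assume "\<not> ?thesis"
    then have s: "below LB x \<subseteq> below LB y" using phi_fst c by (simp add: not_less)
    obtain j where j: "j \<in> Ji D" "le D j x" "\<not> le D j y" using exists_Ji c by blast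
    have jc: "j \<in> carrier D" using j by (auto simp: Ji_def)
    have "j \<in> RB" using Ji_boundary j s unfolding below_def by blast
    moreover have "inc j y" using j jc c le_trans[of y j x] by (auto simp: inc_def)
    then have "lft j y" using lft_move_left[OF assms] j by blast
    ultimately show False unfolding RB_def by blast
  qed
  show "snd (\<phi> x) < snd (\<phi> y)"
  proof (rule ccontr)
    assume "\<not> ?thesis"
    then have s: "below RB y \<subseteq> below RB x" using phi_snd c by (simp add: not_less)
    obtain j where j: "j \<in> Ji D" "le D j y" "\<not> le D j x" using exists_Ji c by blast
    have jc: "j \<in> carrier D" using j by (auto simp: Ji_def)
    have "j \<in> LB" using Ji_boundary j s unfolding below_def by blast
    moreover have "inc x j" using j jc c le_trans[of x j y] by (auto simp: inc_def)
    then have "lft x j" using lft_move_right[OF assms] j by blast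
    ultimately show False unfolding LB_def by blast
  qed
qed

lemma lft_phi:
  assumes c: "x \<in> carrier D" "y \<in> carrier D"
  shows "lft x y \<longleftrightarrow> fst (\<phi> y) < fst (\<phi> x) \<and> snd (\<phi> x) < snd (\<phi> y)"
proof
  assume h: "fst (\<phi> y) < fst (\<phi> x) \<and> snd (\<phi> x) < snd (\<phi> y)"
  then have "inc x y" using c by (auto simp: inc_def phi_le le_point)
  moreover have "\<not> lft y x" using lft_phi_imp[of y x] h by force
  ultimately show "lft x y" using lft_total by blast
qed (use lft_phi_imp in blast)

definition mi :: "point \<Rightarrow> bool" where
  "mi z \<longleftrightarrow> z \<in> carrier D \<and> (\<forall>w w'. covers D z w \<and> covers D z w' \<longrightarrow> w = w')"

text \<open>Let \<open>d\<close> be the last element of \<open>K\<close> below \<open>z\<close> and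
  \<open>c\<close> the next one, so \<open>c\<close> covers \<open>d\<close>. By semimodularity the
  join of \<open>c\<close> and \<open>z\<close> covers \<open>z\<close>; as \<open>z\<close> has
  only one upper cover, \<open>c\<close> is below that cover and is counted there in
  addition.\<close>

lemma mi_below_strict:
  assumes K: "maxch K" and z: "mi z" "z' \<in> carrier D" "le D z z'" "z \<noteq> z'"
  shows "below K z \<noteq> below K z'"
proof
  assume e: "below K z = below K z'"
  have zc: "z \<in> carrier D" using z by (auto simp: mi_def)
  obtain w where w: "covers D z w" "le D w z'" using exists_cover z zc by blast
  then have wc: "w \<in> carrier D" "le D z w" by (auto simp: covers_iff)
  have bw: "below K w = below K z" using below_mono[OF K] w wc z zc e by blast
  have tpK: "tp \<in> K" "bt \<in> K" using K le_tp bt_le tp bt unfolding maxch_def by blast+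
  have cmp: "le D x y \<or> le D y x" "x \<in> carrier D" if "x \<in> K" "y \<in> K" for x y using K that by (auto simp: maxch_def)
  let ?S = "{c\<in>K. \<not> le D c z}"
  have "\<not> le D tp z" using le_trans[OF z(3) le_tp[OF z(2)]] le_antisym[of tp z] le_tp tp zc z le_antisym le_trans by metis
  then have "tp \<in> ?S" using tpK by auto
  then obtain c where c: "c \<in> ?S" "\<forall>y\<in>?S. le D y c \<longrightarrow> y = c"
    using exists_minimal[of ?S] K unfolding maxch_def by blast
  have cc: "c \<in> carrier D" "c \<in> K" "\<not> le D c z" using c K by (auto simp: maxch_def)
  have "bt \<in> below K z" using tpK bt_le[OF zc] by (simp add: below_def)
  then have fB: "finite (snd ` below K z)" "snd ` below K z \<noteq> {}"
    using finite_below[OF K] by (simp, blast)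
  obtain d where d: "d \<in> below K z" "snd d = Max (snd ` below K z)" using Max_in[OF fB] by (metis (no_types, lifting) imageE)
  have dK: "d \<in> K" "le D d z" "d \<in> carrier D" using d K by (auto simp: below_def maxch_def)
  have dmax: "le D x d" if "x \<in> below K z" for x
  proof -
    have "snd x \<le> snd d" using that fB d(2) by simp
    moreover have x: "x \<in> K" "x \<in> carrier D" using that K by (auto simp: below_def maxch_def)
    ultimately have "\<not> (le D d x \<and> x \<noteq> d)" using less_rise[of d x] dK by auto
    then show ?thesis using cmp[OF x(1) dK(1)] le_refl[OF dK(3)] by auto
  qed
  have dc: "le D d c" using cmp[OF dK(1) cc(2)] le_trans[of c d z] cc dK zc by blast
  have "covers D d c" unfolding covers_iff
  proof (intro conjI ballI impI)
    show "d \<noteq> c" using dK cc by auto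
    fix x assume x: "x \<in> carrier D" "le D d x \<and> le D x c"
    have "le D y x \<or> le D x y" if y: "y \<in> K" for y
    proof (cases "le D y z")
      case True
      then have "le D y d" using dmax y by (auto simp: below_def)
      then show ?thesis using le_trans[of y d x] x dK cmp(2)[OF y y] by blast
    next
      case False
      then have "le D c y" using c(2) y cmp[OF y cc(2)] le_refl[OF cc(1)] by blast
      then show ?thesis using le_trans[of x c y] x cc cmp(2)[OF y y] by blast
    qed
    then have xK: "x \<in> K" using K x unfolding maxch_def by blast
    show "x = d \<or> x = c"
    proof (cases "le D x z")
      case True
      then have "le D x d" using dmax xK by (auto simp: below_def)
      then show ?thesis using le_antisym x dK by blast
    next
      case False then show ?thesis using c(2) xK x by blast
    qed
  qed (use dK cc dc in auto)
  then have "covers D (join D d z) (join D c z) \<or> join D d z = join D c z"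
    using sm zc unfolding semimodular_def by blast
  moreover have "join D d z = z"
    using join_facts[OF dK(3) zc] dK(2) le_refl[OF zc] zc le_antisym by blast
  moreover have jc: "le D c (join D c z)" "join D c z \<in> carrier D" using join_facts[OF cc(1) zc] by auto
  ultimately have "covers D z (join D c z)" using cc(3) by auto
  then have "join D c z = w" using w(1) z(1) unfolding mi_def by blast
  then have "c \<in> below K w" using jc cc by (auto simp: below_def)
  then show False using bw cc by (auto simp: below_def)
qed

definition P :: "point set" where "P = \<phi> ` {z. mi z}"

lemma perm_P: "perm_set P (\<phi> tp)"
proof
  have sub: "{z. mi z} \<subseteq> carrier D" by (auto simp: mi_def)
  show "finite P" unfolding P_def using sub fin finite_subset by blast
  have eq: "x = y" if h: "mi x" "mi y" "below K x = below K y" "maxch K" "fst (\<phi> x) = fst (\<phi> y) \<or> snd (\<phi> x) = snd (\<phi> y)" for x y K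
  proof -
    have c: "x \<in> carrier D" "y \<in> carrier D" using h by (auto simp: mi_def)
    have "\<phi> x \<le> \<phi> y \<or> \<phi> y \<le> \<phi> x" using h(5) linear by (auto simp: le_point)
    then have "le D x y \<or> le D y x" using phi_le c by blast
    then show ?thesis using mi_below_strict[OF h(4) h(1) c(2)] mi_below_strict[OF h(4) h(2) c(1)] h(3) by auto
  qed
  show "inj_on fst P"
  proof (rule inj_onI)
    fix u v assume uv: "u \<in> P" "v \<in> P" "fst u = fst v"
    then obtain x y where h: "mi x" "mi y" "u = \<phi> x" "v = \<phi> y" by (auto simp: P_def)
    then have c: "x \<in> carrier D" "y \<in> carrier D" by (auto simp: mi_def)
    then have "below LB x = below LB y" using phi_fst[OF c] phi_fst[OF c(2,1)] uv(3) h by auto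
    then show "u = v" using eq[OF h(1,2) _ maxch_LB] uv(3) h by blast
  qed
  show "inj_on snd P"
  proof (rule inj_onI)
    fix u v assume uv: "u \<in> P" "v \<in> P" "snd u = snd v"
    then obtain x y where h: "mi x" "mi y" "u = \<phi> x" "v = \<phi> y" by (auto simp: P_def)
    then have c: "x \<in> carrier D" "y \<in> carrier D" by (auto simp: mi_def)
    then have "below RB x = below RB y" using phi_snd[OF c] phi_snd[OF c(2,1)] uv(3) h by auto
    then show "u = v" using eq[OF h(1,2) _ maxch_RB] uv(3) h by blast
  qed
  have "\<not> covers D tp w" for w using le_antisym[of tp w] le_tp[of w] tp unfolding covers_iff by blast
  then have "mi tp" using tp by (simp add: mi_def)
  then show "\<phi> tp \<in> P" by (simp add: P_def)
  show "u \<le> \<phi> tp" if "u \<in> P" for u using that phi_le[OF _ tp] le_tp by (auto simp: P_def mi_def)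
qed

lemma grid_P: "grid P = \<phi> ` carrier D"
proof (intro equalityI subsetI)
  fix z assume "z \<in> grid P"
  then obtain u v where uv: "u \<in> P" "fst u = fst z" "snd z \<le> snd u" "v \<in> P" "snd v = snd z" "fst z \<le> fst v"
    by (auto simp: grid_def)
  then obtain x y where xy: "x \<in> carrier D" "y \<in> carrier D" "u = \<phi> x" "v = \<phi> y" by (auto simp: P_def mi_def)
  have "z = pmin u v" using uv by (auto simp: pmin_def prod_eq_iff)
  then show "z \<in> \<phi> ` carrier D" using phi_meet[OF xy(1,2)] meet_facts(1)[OF xy(1,2)] xy(3,4) by (metis image_eqI)
next
  fix z assume "z \<in> \<phi> ` carrier D"
  then obtain x where x: "x \<in> carrier D" "z = \<phi> x" by auto
  have meet_cov: "meet D w w' = m" if h: "covers D m w" "covers D m w'" "w \<noteq> w'" for m w w'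
  proof -
    have c: "m \<in> carrier D" "w \<in> carrier D" "w' \<in> carrier D" "le D m w" "le D m w'" using h by (auto simp: covers_iff)
    note f = meet_facts[OF c(2,3)]
    have "meet D w w' = m \<or> meet D w w' = w" "meet D w w' = m \<or> meet D w w' = w'"
      using h(1,2) f c unfolding covers_iff by blast+
    then show ?thesis using h(3) by auto
  qed
  \<comment> \<open>The function \<open>h\<close> stands for either coordinate. Among the elements
    above \<open>x\<close> with the same value of \<open>h\<close>, a highest one is
    meet-irreducible: otherwise it is the meet of two upper covers, and one of these would have the
    same value.\<close>
  have ex: "\<exists>y. mi y \<and> le D x y \<and> h (\<phi> y) = h (\<phi> x)"
    if h: "\<And>u v. h (pmin u v) = h u \<or> h (pmin u v) = h v" for h :: "point \<Rightarrow> real"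
  proof -
    let ?S = "{y\<in>carrier D. le D x y \<and> h (\<phi> y) = h (\<phi> x)}"
    have "x \<in> ?S" using x(1) le_refl by simp
    then have "finite ?S" "?S \<noteq> {}" using fin by (simp, blast)
    from exists_max[OF this, of snd] obtain y where y: "y \<in> ?S" "\<forall>w\<in>?S. snd w \<le> snd y" by blast
    have "mi y" unfolding mi_def
    proof (intro conjI allI impI)
      fix w w' assume ww: "covers D y w \<and> covers D y w'"
      show "w = w'"
      proof (rule ccontr)
        assume n: "w \<noteq> w'"
        have c: "w \<in> carrier D" "w' \<in> carrier D" "le D y w" "le D y w'" using ww by (auto simp: covers_iff)
        have "\<phi> y = pmin (\<phi> w) (\<phi> w')" using meet_cov[of y w w'] ww n phi_meet[OF c(1,2)] by simp
        then have "h (\<phi> w) = h (\<phi> x) \<or> h (\<phi> w') = h (\<phi> x)" using h[of "\<phi> w" "\<phi> w'"] y by auto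
        moreover have "le D x w" "le D x w'" using le_trans x y c by blast+
        ultimately have "w \<in> ?S \<or> w' \<in> ?S" using c by auto
        then have "snd w \<le> snd y \<or> snd w' \<le> snd y" using bspec[OF y(2), of w] bspec[OF y(2), of w'] by blast
        then show False using covers_rise[of y w] covers_rise[of y w'] ww by auto
      qed
    qed (use y in auto)
    then show ?thesis using y(1) by (intro exI[of _ y]) simp
  qed
  have "\<exists>y. mi y \<and> le D x y \<and> fst (\<phi> y) = fst (\<phi> x)" "\<exists>y. mi y \<and> le D x y \<and> snd (\<phi> y) = snd (\<phi> x)"
    by (rule ex, simp add: pmin_def min_def)+
  then obtain y y' where y: "mi y" "le D x y" "fst (\<phi> y) = fst (\<phi> x)"
    and y': "mi y'" "le D x y'" "snd (\<phi> y') = snd (\<phi> x)" by blast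
  have "\<phi> x \<le> \<phi> y" "\<phi> x \<le> \<phi> y'" using y y' x phi_le by (auto simp: mi_def)
  then show "z \<in> grid P"
    using y y' x(2) by (intro gridI[of "\<phi> y" _ "\<phi> y'"]) (auto simp: P_def le_point)
qed

lemma slim_model: "diagram_model P (\<phi> tp) D \<phi>"
proof (rule planar_diagram_model)
  show "planar_bounded D bt tp" by unfold_locales
  show "order_model P (\<phi> tp) D \<phi>"
  proof (intro order_model.intro order_model_axioms.intro perm_P po)
    show "bij_betw \<phi> (carrier D) (grid P)" using phi_inj grid_P by (auto simp: bij_betw_def inj_on_def)
  qed (rule phi_le)
qed (rule lft_phi)

end

lemma slim_semimodular_model:
  assumes "slim_semimodular_diagram D"
  shows "\<exists>P T \<phi>. diagram_model P T D \<phi>"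
proof -
  have d: "planar_hasse_diagram D" "slim D" "semimodular D" "lattice D" "finite (carrier D)" "carrier D \<noteq> {}"
    using assms by (auto simp: slim_semimodular_diagram_def planar_lattice_diagram_def finite_lattice_def)
  interpret lattice D by (rule d(4))
  interpret fp: finite_poset D by (rule finite_poset.intro) (use d in \<open>auto simp: planar_hasse_diagram_def\<close>)
  have "\<exists>b\<in>carrier D. \<forall>x\<in>carrier D. le D b x"
  proof -
    obtain b where b: "b \<in> carrier D" "\<forall>z\<in>carrier D. le D z b \<longrightarrow> z = b" using fp.exists_minimal[of "carrier D"] d by auto
    have "le D b x" if x: "x \<in> carrier D" for x
      using b(2) meet_closed[OF b(1) x] meet_left[OF b(1) x] meet_right[OF b(1) x] by metis
    then show ?thesis using b(1) by blast
  qed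
  then obtain b where b: "b \<in> carrier D" "\<And>x. x \<in> carrier D \<Longrightarrow> le D b x" by blast
  have "\<exists>t\<in>carrier D. \<forall>x\<in>carrier D. le D x t"
  proof -
    have "\<exists>t\<in>carrier D. \<forall>x\<in>S. le D x t" if "finite S" "S \<subseteq> carrier D" for S
      using that
    proof (induction S)
      case (insert x S)
      then obtain t where t: "t \<in> carrier D" "\<forall>x\<in>S. le D x t" by auto
      have x: "x \<in> carrier D" using insert by auto
      show ?case
      proof (intro bexI[of _ "join D x t"] ballI)
        show "join D x t \<in> carrier D" using x t by auto
        fix y assume "y \<in> insert x S"
        then show "le D y (join D x t)"
          using join_left[OF x t(1)] join_right[OF x t(1)] join_closed[OF x t(1)] fp.le_trans[of y t "join D x t"] t insert.prems by auto
      qed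
    qed (use d in auto)
    then show ?thesis using d by blast
  qed
  then obtain t where t: "t \<in> carrier D" "\<And>x. x \<in> carrier D \<Longrightarrow> le D x t" by blast
  interpret slim_planar D b t
    by unfold_locales (use d b t in \<open>auto simp: lattice_def\<close>)
  show ?thesis using slim_model by blast
qed


section \<open>Drawing by dominance\<close>

definition rot :: "point \<Rightarrow> point" where
  "rot z = ((snd z - fst z) / 2, (fst z + snd z) / 2)"

definition unrot :: "point \<Rightarrow> point" where
  "unrot p = (snd p - fst p, snd p + fst p)"

lemma rot_unrot [simp]: "rot (unrot p) = p" "unrot (rot z) = z"
  by (auto simp: rot_def unrot_def prod_eq_iff field_simps)

definition dom_diagram :: "point set \<Rightarrow> diagram" where
  "dom_diagram S = \<lparr>carrier = rot ` S, eq = (=), le = (\<lambda>x y. unrot x \<le> unrot y)\<rparr>"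

lemma dom_simps [simp]: "carrier (dom_diagram S) = rot ` S" "le (dom_diagram S) x y \<longleftrightarrow> unrot x \<le> unrot y"
  "eq (dom_diagram S) = (=)"
  by (auto simp: dom_diagram_def)

lemma unrot_inj: "unrot x = unrot y \<longleftrightarrow> x = y"
  by (metis rot_unrot(1))

lemma rot_eq_iff: "rot p = z \<longleftrightarrow> p = unrot z"
  by (metis rot_unrot)

lemma dom_po: "partial_order (dom_diagram S)"
  by unfold_locales (auto simp: dom_diagram_def unrot_inj)

lemma dom_covers:
  "covers (dom_diagram S) x y \<longleftrightarrow> unrot x \<in> S \<and> unrot y \<in> S \<and> unrot x \<le> unrot y \<and> x \<noteq> y \<and>
    (\<forall>z\<in>S. unrot x \<le> z \<and> z \<le> unrot y \<longrightarrow> z = unrot x \<or> z = unrot y)"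
proof -
  have "w \<in> rot ` S \<longleftrightarrow> unrot w \<in> S" for w by (metis image_iff rot_unrot)
  moreover have "(\<forall>c\<in>rot ` S. unrot x \<le> unrot c \<and> unrot c \<le> unrot y \<longrightarrow> c = x \<or> c = y) \<longleftrightarrow>
    (\<forall>z\<in>S. unrot x \<le> z \<and> z \<le> unrot y \<longrightarrow> z = unrot x \<or> z = unrot y)"
    by (simp add: rot_eq_iff)
  ultimately show ?thesis by (simp add: po_covers[OF dom_po])
qed

lemma unrot_segment:
  assumes "x \<in> open_segment a b"
  obtains u where "0 < u" "u < 1" "unrot x = unrot a + u *\<^sub>R (unrot b - unrot a)" "a \<noteq> b"
proof -
  obtain u where u: "0 < u" "u < 1" "x = (1 - u) *\<^sub>R a + u *\<^sub>R b" "a \<noteq> b"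
    using assms by (auto simp: in_segment)
  have "unrot x = unrot a + u *\<^sub>R (unrot b - unrot a)"
    unfolding u(3) by (simp add: unrot_def prod_eq_iff algebra_simps)
  then show thesis using that u by blast
qed

lemma between_segment:
  fixes p q x :: point
  assumes u: "0 < u" "u < 1" and x: "x = p + u *\<^sub>R (q - p)" and pq: "p \<le> q" "p \<noteq> q"
  shows "p \<le> x" "x \<le> q" "p \<noteq> x" "x \<noteq> q"
proof -
  have d: "0 \<le> fst q - fst p" "0 \<le> snd q - snd p" using pq by (auto simp: le_point)
  have "u * (fst q - fst p) \<le> 1 * (fst q - fst p)" "u * (snd q - snd p) \<le> 1 * (snd q - snd p)"
    using u d by (intro mult_right_mono; simp)+
  moreover have "0 \<le> u * (fst q - fst p)" "0 \<le> u * (snd q - snd p)" using u d by auto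
  ultimately show "p \<le> x" "x \<le> q" by (auto simp: x le_point)
  show "p \<noteq> x" using u pq by (simp add: x)
  show "x \<noteq> q"
  proof
    assume "x = q"
    then have "(1 - u) *\<^sub>R (q - p) = 0" by (auto simp: x algebra_simps)
    then show False using u pq by auto
  qed
qed

text \<open>The two vectors differ by a positive factor, and comparing this factor with 1 decides
  which end point is lower.\<close>

lemma same_direction:
  fixes p q r :: point
  assumes u: "0 < u" "0 < v" and e: "u *\<^sub>R (q - p) = v *\<^sub>R (r - p)" and pq: "p \<le> q" "p \<le> r"
  shows "q \<le> r \<or> r \<le> q"
proof -
  have "q - p = (v / u) *\<^sub>R (r - p)" using arg_cong[OF e, of "\<lambda>z. (1 / u) *\<^sub>R z"] u by simp
  then have f: "fst q - fst p = (v / u) * (fst r - fst p)" "snd q - snd p = (v / u) * (snd r - snd p)"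
    by (auto simp: prod_eq_iff)
  have d: "0 \<le> fst r - fst p" "0 \<le> snd r - snd p" using pq by (auto simp: le_point)
  show ?thesis
  proof (cases "v / u \<le> 1")
    case True
    then have "(v / u) * (fst r - fst p) \<le> 1 * (fst r - fst p)" "(v / u) * (snd r - snd p) \<le> 1 * (snd r - snd p)"
      using d by (intro mult_right_mono; simp)+
    then show ?thesis using f by (auto simp: le_point)
  next
    case False
    then have "1 * (fst r - fst p) \<le> (v / u) * (fst r - fst p)" "1 * (snd r - snd p) \<le> (v / u) * (snd r - snd p)"
      using d by (intro mult_right_mono; simp)+
    then show ?thesis using f by (auto simp: le_point)
  qed
qed

text \<open>
  A common point of the open edges \<open>a b\<close> and \<open>c d\<close> lies above \<open>a, c\<close> and below \<open>b, d\<close>, so the meet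
  of \<open>b\<close> and \<open>d\<close> lies on both edges; hence the edges share an end and have the same direction.
\<close>

lemma dom_planar:
  assumes S: "finite S" "S \<noteq> {}" "\<And>x y. x \<in> S \<Longrightarrow> y \<in> S \<Longrightarrow> pmin x y \<in> S"
  shows "planar_hasse_diagram (dom_diagram S)"
  unfolding planar_hasse_diagram_def
proof (intro conjI allI impI)
  show "partial_order (dom_diagram S)" by (rule dom_po)
  show "finite (carrier (dom_diagram S))" "carrier (dom_diagram S) \<noteq> {}" using S by auto
next
  fix a b assume c: "covers (dom_diagram S) a b"
  then have "unrot a \<le> unrot b" "unrot a \<noteq> unrot b" by (auto simp: dom_covers unrot_inj)
  then show "snd a < snd b" by (auto simp: unrot_def le_point prod_eq_iff)
  show "open_segment a b \<inter> carrier (dom_diagram S) = {}"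
  proof (rule ccontr)
    assume "\<not> ?thesis"
    then obtain x where "x \<in> open_segment a b" "x \<in> carrier (dom_diagram S)" by blast
    then have x: "x \<in> open_segment a b" "unrot x \<in> S" by auto
    obtain u where u: "0 < u" "u < 1" "unrot x = unrot a + u *\<^sub>R (unrot b - unrot a)" "a \<noteq> b"
      using unrot_segment[OF x(1)] .
    have "unrot a \<le> unrot b" "unrot a \<noteq> unrot b" using c by (auto simp: dom_covers unrot_inj)
    from between_segment[OF u(1,2,3) this] show False using c x(2) unfolding dom_covers by metis
  qed
next
  fix a b c d
  assume h: "covers (dom_diagram S) a b \<and> covers (dom_diagram S) c d \<and> (a, b) \<noteq> (c, d)"
  show "open_segment a b \<inter> open_segment c d = {}"
  proof (rule ccontr)
    assume "\<not> ?thesis"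
    then obtain x where x: "x \<in> open_segment a b" "x \<in> open_segment c d" by blast
    define A B C E X where "A = unrot a" "B = unrot b" "C = unrot c" "E = unrot d" "X = unrot x"
    note defs = this
    obtain u where u: "0 < u" "u < 1" "X = A + u *\<^sub>R (B - A)" using unrot_segment[OF x(1)] unfolding defs by metis
    obtain v where v: "0 < v" "v < 1" "X = C + v *\<^sub>R (E - C)" using unrot_segment[OF x(2)] unfolding defs by metis
    have ab: "A \<in> S" "B \<in> S" "A \<le> B" "A \<noteq> B" "\<And>z. z \<in> S \<Longrightarrow> A \<le> z \<Longrightarrow> z \<le> B \<Longrightarrow> z = A \<or> z = B"
      and cd: "C \<in> S" "E \<in> S" "C \<le> E" "C \<noteq> E" "\<And>z. z \<in> S \<Longrightarrow> C \<le> z \<Longrightarrow> z \<le> E \<Longrightarrow> z = C \<or> z = E"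
      and ne: "\<not> (A = C \<and> B = E)"
      using h unfolding dom_covers defs by (auto simp: unrot_inj)
    note X1 = between_segment[OF u ab(3,4)] and X2 = between_segment[OF v cd(3,4)]
    define w where "w = pmin B E"
    have wS: "w \<in> S" using S(3) ab cd by (simp add: w_def)
    have "A \<le> E" "C \<le> B" using X1 X2 order_trans by blast+
    then have "A \<le> w" "w \<le> B" "C \<le> w" "w \<le> E" using ab cd by (auto simp: w_def)
    then have w: "w = A \<or> w = B" "w = C \<or> w = E" using ab(5)[OF wS] cd(5)[OF wS] by blast+
    show False
    proof (cases "w = A")
      case True
      show False
      proof (cases "w = C")
        case C: True
        have "u *\<^sub>R (B - A) = v *\<^sub>R (E - A)" using u(3) v(3) True C by auto
        then have "B \<le> E \<or> E \<le> B" using same_direction[OF u(1) v(1)] ab(3) cd(3) True C by metis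
        then have "B = E" using ab(5)[OF cd(2)] cd(5)[OF ab(2)] ab(3,4) cd(3,4) True C by metis
        then show False using ne True C by auto
      next
        case False
        then have "E = A" using w True by auto
        then show False using X1 X2 by auto
      qed
    next
      case False
      then have wB: "w = B" using w by auto
      show False
      proof (cases "w = C")
        case True
        then show False using wB X1 X2 by auto
      next
        case False
        then have BE: "B = E" using w wB by auto
        \<comment> \<open>The edges now share their upper end; negating all points makes it a common
          lower end.\<close>
        have "(1 - u) *\<^sub>R (A - B) = (1 - v) *\<^sub>R (C - B)"
          using u(3) v(3) unfolding BE by (auto simp: algebra_simps)
        then have e: "(1 - u) *\<^sub>R ((- A) - (- B)) = (1 - v) *\<^sub>R ((- C) - (- B))" by (simp add: algebra_simps)
        have neg: "p \<le> q \<longleftrightarrow> - q \<le> - p" for p q :: point by (auto simp: le_point)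
        have "- A \<le> - C \<or> - C \<le> - A"
          using same_direction[OF _ _ e] u v ab(3) cd(3) BE neg by auto
        then have "A \<le> C \<or> C \<le> A" using neg by auto
        then have "A = C" using ab(5)[OF cd(1)] cd(5)[OF ab(1)] ab(3,4) cd(3,4) BE by metis
        then show False using ne BE by auto
      qed
    qed
  qed
qed

context perm_set
begin

lemma dom_order_model: "order_model P T (dom_diagram (grid P)) unrot"
proof (intro order_model.intro order_model_axioms.intro)
  show "perm_set P T" by unfold_locales
  show "bij_betw unrot (carrier (dom_diagram (grid P))) (grid P)"
    by (auto simp: bij_betw_def inj_on_def image_image unrot_inj)
qed (auto simp: dom_po)

lemma dom_grid_planar: "planar_hasse_diagram (dom_diagram (grid P))"
  by (rule dom_planar) (use finite_grid T_grid grid_pmin in auto)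

lemma dom_model: "diagram_model P T (dom_diagram (grid P)) unrot"
proof -
  let ?D = "dom_diagram (grid P)"
  interpret om: order_model P T ?D unrot by (rule dom_order_model)
  define bo where "bo = pinf P"
  have bo: "bo \<in> grid P" "\<And>w. w \<in> grid P \<Longrightarrow> bo \<le> w"
    unfolding bo_def using T_in by (auto intro: pinf_grid le_pinf_grid)
  have pb: "planar_bounded ?D (rot bo) (rot T)"
    by unfold_locales (use dom_grid_planar bo T_grid grid_le_T in auto)
  have left: "left_of_line b a c \<longleftrightarrow> fst (unrot c) < fst (unrot b) \<and> snd (unrot b) < snd (unrot c)"
    if cv: "covers ?D a b" "covers ?D a c" for a b c
  proof -
    \<comment> \<open>In unrotated coordinates relative to \<open>a\<close>, being to the left
      becomes the determinant condition \<open>q * s < p * t\<close>. Distinct upper covers are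
      incomparable, and this decides the sign.\<close>
    define p q s t where "p = fst (unrot b) - fst (unrot a)" "q = snd (unrot b) - snd (unrot a)"
      "s = fst (unrot c) - fst (unrot a)" "t = snd (unrot c) - snd (unrot a)"
    note d = this
    have nn: "0 \<le> p" "0 \<le> q" "0 \<le> s" "0 \<le> t" using cv unfolding d dom_covers le_point by auto
    have l: "left_of_line b a c \<longleftrightarrow> q * s < p * t"
    proof -
      have e: "2 * (fst b - fst a) = q - p" "2 * (snd b - snd a) = p + q"
        "2 * (fst c - fst a) = t - s" "2 * (snd c - snd a) = s + t"
        by (auto simp: d unrot_def)
      have double: "4 * (x * y) = (2 * x) * (2 * y)" for x y :: real by simp
      have "4 * ((fst b - fst a) * (snd c - snd a)) = (q - p) * (s + t)"
        "4 * ((fst c - fst a) * (snd b - snd a)) = (t - s) * (p + q)"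
        unfolding double e by (rule refl)+
      then have "left_of_line b a c \<longleftrightarrow> (q - p) * (s + t) < (t - s) * (p + q)"
        unfolding left_of_line_def by linarith
      then show ?thesis by (auto simp: algebra_simps)
    qed
    have inco: "b = c \<or> \<not> unrot b \<le> unrot c \<and> \<not> unrot c \<le> unrot b"
      using cv unfolding dom_covers by (metis unrot_inj)
    show ?thesis
    proof (cases "b = c")
      case True then show ?thesis by (simp add: left_of_line_def)
    next
      case False
      then consider "s < p" "q < t" | "p < s" "t < q"
        using inco unfolding le_point d by linarith
      then show ?thesis
      proof cases
        case 1
        have "q * s \<le> t * s" using 1 nn by (intro mult_right_mono) auto
        also have "\<dots> < t * p" using 1 nn by (intro mult_strict_left_mono) auto
        finally show ?thesis using l 1 by (auto simp: d mult.commute)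
      next
        case 2
        have "p * t \<le> s * t" using 2 nn by (intro mult_right_mono) auto
        also have "\<dots> \<le> s * q" using 2 nn by (intro mult_left_mono) auto
        finally have "\<not> left_of_line b a c" using l by (simp add: mult.commute)
        then show ?thesis using 2 by (auto simp: d)
      qed
    qed
  qed
  show ?thesis
    by (rule planar_diagram_model[OF pb dom_order_model planar_model_lft[OF pb dom_order_model left]])
qed

lemma dom_slim_semimodular: "slim_semimodular_diagram (dom_diagram (grid P))"
proof -
  interpret om: order_model P T "dom_diagram (grid P)" unrot by (rule dom_order_model)
  show ?thesis using om.slim om.semimodular om.finite_lattice dom_grid_planar
    by (simp add: slim_semimodular_diagram_def planar_lattice_diagram_def)
qed

lemma dom_slim_distributive:
  assumes "\<And>v. \<not> middle P v" shows "slim_distributive_diagram (dom_diagram (grid P))"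
proof -
  interpret om: order_model P T "dom_diagram (grid P)" unrot by (rule dom_order_model)
  show ?thesis using om.slim om.distributive[OF assms] om.finite_lattice dom_grid_planar
    by (simp add: slim_distributive_diagram_def planar_lattice_diagram_def)
qed

end

section \<open>Splitting as the inverse of a resection, and the characterization\<close>

lemma similar_refl: "similar D D"
  unfolding similar_def by (intro exI[of _ id]) auto

text \<open>Deleting points from a dominance drawing leaves the dominance drawing of the remaining
  ones. So the diagram serves as its own similar copy in \<open>resection_step\<close>, and
  planarity of the result comes from the new point set.\<close>

lemma (in anchored) anchored_resection:
  "resection_step (dom_diagram (grid P)) (dom_diagram (grid (insert a (P - {k, b}))))"
proof -
  let ?D = "dom_diagram (grid P)"
  interpret dm: diagram_model P T ?D unrot by (rule dom_model)
  define G where "G i j = ((upl P ^^ i) ((upr P ^^ j) base))" for i j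
  define g where "g = (\<lambda>(i, j). rot (G i j))"
  have gP: "base \<in> grid P" "e \<in> grid P" "f \<in> grid P" "a \<in> grid P" "base \<notin> P" "e \<notin> P" "f \<notin> P" "a \<notin> P"
    using base_grid e_grid f_grid a_grid base_P e_P f_P a_P by auto
  have nT: "base \<noteq> T" "e \<noteq> T" "f \<noteq> T" "a \<noteq> T" using gP T_in by auto
  have G0: "G 0 0 = base" "G (Suc 0) 0 = e" "G 0 (Suc 0) = f" "G (Suc 0) (Suc 0) = a"
    "G (Suc (Suc 0)) 0 = upl P e" "G 0 (Suc (Suc 0)) = upr P f" "G (Suc (Suc 0)) (Suc 0) = upl P a"
    by (auto simp: G_def upl_base upr_base upl_f)
  have G12: "G (Suc 0) (Suc (Suc 0)) = upr P a"
    using upl_upr_commute[OF gP(3,7)] by (simp add: G_def upr_base upl_f)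
  have G22: "G (Suc (Suc 0)) (Suc (Suc 0)) = upl P (upr P a)"
    using upl_upr_commute[OF gP(3,7)] by (simp add: G_def upr_base upl_f)
  have e2: "upr P (upl P e) = upl P a" using upl_upr_commute[OF gP(2,6)] upr_e by simp
  have f2: "upl P (upr P f) = upr P a" using upl_upr_commute[OF gP(3,7)] upl_f by simp
  have a2: "upr P (upl P a) = upl P (upr P a)" using upl_upr_commute[OF gP(4,8)] by simp
  have T2: "upl P e \<noteq> T" "upr P f \<noteq> T" "upl P a \<noteq> T" "upr P a \<noteq> T"
    using upl_not_T upr_not_T gP by auto
  have Gg: "upl P e \<in> grid P" "upr P f \<in> grid P" "upl P a \<in> grid P" "upr P a \<in> grid P" "upl P (upr P a) \<in> grid P"
    using upl_grid upr_grid gP nT T2 by auto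
  note Gs = G0 G12 G22
  have cp: "cp_grid ?D 3 3 g"
  proof (rule dm.cp_gridI[where G = G])
    fix i j :: nat
    show "i < 3 \<Longrightarrow> j < 3 \<Longrightarrow> g (i, j) \<in> carrier ?D \<and> unrot (g (i, j)) = G i j"
      using gP Gg by (auto simp: g_def numeral_3_eq_3 less_Suc_eq Gs)
    show "Suc i < 3 \<Longrightarrow> j < 3 \<Longrightarrow> G (Suc i) j = upl P (G i j) \<and> G i j \<noteq> T"
      using nT T2 by (auto simp: numeral_3_eq_3 less_Suc_eq Gs upl_base upl_f f2)
    show "i < 3 \<Longrightarrow> Suc j < 3 \<Longrightarrow> G i (Suc j) = upr P (G i j) \<and> G i j \<noteq> T"
      using nT T2 by (auto simp: numeral_3_eq_3 less_Suc_eq Gs upr_base upr_e e2 a2)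
    show "Suc i < 3 \<Longrightarrow> Suc j < 3 \<Longrightarrow> G i j \<notin> P"
      using gP by (auto simp: numeral_3_eq_3 less_Suc_eq Gs)
  qed auto
  have ug: "unrot (g (0, 0)) = base" "unrot (g (1, 0)) = e" "unrot (g (0, 1)) = f" "unrot (g (1, 1)) = a"
    by (auto simp: g_def Gs)
  have "covers ?D (g (0, 0)) (g (1, 0))" "covers ?D (g (0, 0)) (g (0, 1))"
    using gP nT ug upl_base upr_base by (auto simp: dm.covers_cov cov_iff g_def Gs)
  then have orient: "left_of_line (g (1, 0)) (g (0, 0)) (g (0, 1))"
    using dm.upper_left fst_ord snd_ord ug by (auto simp: e_def f_def)
  interpret sb: scheme_base P T ?D unrot g by unfold_locales (use cp orient in auto)
  have s: "sb.e = e" "sb.f = f" "sb.a = a" by (simp_all only: sb.e_def sb.f_def sb.a_def ug)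
  have sk: "sb.k = k" using sb.k s k_P k_row eq_snd by metis
  have sc: "sb.c = b" using sb.c s b_P b_col eq_fst by metis
  interpret sw: anchored "prod.swap ` P" "prod.swap T" "prod.swap a" "prod.swap k" "prod.swap b" "prod.swap d" "prod.swap c"
    by (rule anchored_swap)
  have swf: "sw.e = prod.swap f" by (simp add: sw.e_def f_def)
  have "sb.left.wing = left.wing" by (simp add: s)
  moreover have "sb.right.wing = sw.left.wing" by (simp add: s swf)
  ultimately have ends: "C3_scheme ?D g" "sb.Lm = left_mids P a" "sb.Rm = right_mids P a"
    using sb.ends_scheme left_end sw.left_end by (simp_all add: s)
  have "unrot ` carrier (resect ?D g) = grid (insert a (P - {k, b}))"
    using sb.resect_image ends grid_resect[OF gP(4,8) k_P k_row b_P b_col] by simp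
  then have "rot ` unrot ` carrier (resect ?D g) = rot ` grid (insert a (P - {k, b}))" by simp
  then have car: "carrier (resect ?D g) = rot ` grid (insert a (P - {k, b}))" by (simp add: image_image)
  have res: "resect ?D g = dom_diagram (grid (insert a (P - {k, b})))"
  proof -
    have "resect ?D g = ?D\<lparr>carrier := carrier (resect ?D g)\<rparr>" by (simp add: resect_def)
    then show ?thesis unfolding car by (simp add: dom_diagram_def)
  qed
  interpret P': perm_set "insert a (P - {k, b})" T by (rule perm_set_resect[OF gP(4,8) k_P k_row b_P b_col])
  show ?thesis
    unfolding resection_step_def
    by (rule exI[of _ ?D], rule exI[of _ g])
      (simp add: similar_refl dom_slim_semimodular ends(1) res P'.dom_grid_planar)
qed

lemma dom_obtained:
  assumes "perm_set P T"
  shows "\<exists>D0. slim_distributive_diagram D0 \<and> resection_step\<^sup>*\<^sup>* D0 (dom_diagram (grid P))"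
  using assms
proof (induction "weight P" arbitrary: P rule: less_induct)
  case less
  interpret perm_set P T by (rule less.prems)
  show ?case
  proof (cases "\<exists>v. middle P v")
    case False
    then show ?thesis using dom_slim_distributive by blast
  next
    case True
    then obtain Q a b k c d where Q: "anchored Q T a b k c d" "P = insert a (Q - {k, b})" "weight Q < weight P"
      using split_middle by blast
    interpret Q: anchored Q T a b k c d by (rule Q(1))
    have "perm_set Q T" by unfold_locales
    from less.hyps[OF Q(3) this] obtain D0 where D0: "slim_distributive_diagram D0" "resection_step\<^sup>*\<^sup>* D0 (dom_diagram (grid Q))"
      by blast
    moreover have "resection_step (dom_diagram (grid Q)) (dom_diagram (grid P))"
      using Q.anchored_resection Q(2) by simp
    ultimately show ?thesis by (meson rtranclp.rtrancl_into_rtrancl)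
  qed
qed

text \<open>An element \<open>z\<close> between the two joins is the join of \<open>c\<close> and
  the meet of \<open>z\<close> with \<open>b\<close>. This meet lies between \<open>a\<close> and
  \<open>b\<close>, so it is one of them.\<close>

lemma distributive_imp_semimodular:
  assumes "lattice D" "distributive D" shows "semimodular D"
  unfolding semimodular_def
proof (intro allI impI)
  fix a b c assume h: "covers D a b \<and> c \<in> carrier D"
  interpret lattice D by fact
  have po: "partial_order D" by unfold_locales
  have ab: "a \<in> carrier D" "b \<in> carrier D" "c \<in> carrier D" "le D a b" "a \<noteq> b"
    "\<And>x. x \<in> carrier D \<Longrightarrow> le D a x \<Longrightarrow> le D x b \<Longrightarrow> x = a \<or> x = b"
    using h by (auto simp: po_covers[OF po])
  let ?x = "join D a c" and ?y = "join D b c"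
  have xy: "?x \<in> carrier D" "?y \<in> carrier D" using ab by auto
  have bc: "le D b ?y" "le D c ?y" "le D a ?x" "le D c ?x" using ab join_left join_right by auto
  have ay: "le D a ?y" using le_trans[OF ab(4) bc(1)] ab xy by auto
  have lexy: "le D ?x ?y" using join_le[OF ay bc(2)] ab xy by auto
  have "z = ?x \<or> z = ?y" if z: "z \<in> carrier D" "le D ?x z" "le D z ?y" for z
  proof -
    have cz: "le D c z" "le D a z" using le_trans[OF bc(4) z(2)] le_trans[OF bc(3) z(2)] ab xy z by auto
    have "z = meet D z ?y" using z xy meet_le[OF le_refl z(3)] meet_left le_antisym meet_closed by metis
    also have "\<dots> = join D (meet D z b) (meet D z c)" using assms(2) z ab unfolding distributive_def by blast
    also have "meet D z c = c" using cz z ab meet_le[OF cz(1) le_refl] meet_right le_antisym meet_closed by metis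
    finally have e: "z = join D (meet D z b) c" .
    have "le D a (meet D z b)" using meet_le[OF cz(2) ab(4)] z ab by auto
    moreover have "le D (meet D z b) b" "meet D z b \<in> carrier D" using meet_right z ab by auto
    ultimately have "meet D z b = a \<or> meet D z b = b" using ab(6) by blast
    then show ?thesis using e by metis
  qed
  then show "covers D ?x ?y \<or> ?x = ?y" using xy lexy by (auto simp: po_covers[OF po])
qed

lemma resection_step_model:
  assumes "resection_step D D'"
  shows "\<exists>P T \<phi>. order_model P T D' \<phi>"
proof -
  obtain E g where h: "slim_semimodular_diagram E" "C3_scheme E g" "D' = resect E g" "planar_hasse_diagram D'"
    using assms unfolding resection_step_def by blast
  obtain P T \<phi> where "diagram_model P T E \<phi>" using slim_semimodular_model[OF h(1)] by blast
  then interpret diagram_model P T E \<phi> .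
  interpret scheme_base P T E \<phi> g by unfold_locales (use h(2) in \<open>auto simp: C3_scheme_def\<close>)
  have "planar_hasse_diagram (resect E g)" using h(3,4) by simp
  from resect_model[OF C3_scheme_mids[OF h(2) this]] show ?thesis using h(3) by blast
qed

text \<open>Each step contains a slim semimodular diagram by definition, so the last step alone
  gives the coordinates. The empty sequence is the case of a distributive diagram.\<close>

lemma resections_model:
  assumes "resection_step\<^sup>*\<^sup>* D\<^sub>0 D" "slim_distributive_diagram D\<^sub>0"
  shows "\<exists>P T \<phi>. order_model P T D \<phi>"
  using assms(1)
proof (cases rule: rtranclp.cases)
  case rtrancl_refl
  have "slim_semimodular_diagram D"
    using assms(2) distributive_imp_semimodular[of D] rtrancl_refl
    by (auto simp: slim_distributive_diagram_def slim_semimodular_diagram_def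
        planar_lattice_diagram_def finite_lattice_def)
  then show ?thesis using slim_semimodular_model diagram_model.axioms(1) by blast
next
  case (rtrancl_into_rtrancl E)
  then show ?thesis using resection_step_model by blast
qed

lemma similar_model:
  assumes "similar E D" "order_model P T E \<phi>" "partial_order D"
  shows "\<exists>\<psi>. order_model P T D \<psi>"
proof -
  interpret E: order_model P T E \<phi> by fact
  obtain h where h: "bij_betw h (carrier E) (carrier D)"
    "\<And>x y. x \<in> carrier E \<Longrightarrow> y \<in> carrier E \<Longrightarrow> le E x y \<longleftrightarrow> le D (h x) (h y)"
    using assms(1) unfolding similar_def by blast
  let ?i = "inv_into (carrier E) h"
  have i: "?i x \<in> carrier E" "h (?i x) = x" if "x \<in> carrier D" for x
    using that h(1) by (auto simp: bij_betw_def inv_into_into f_inv_into_f)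
  have "order_model P T D (\<phi> \<circ> ?i)"
  proof (intro order_model.intro order_model_axioms.intro)
    show "perm_set P T" by unfold_locales
    show "bij_betw (\<phi> \<circ> ?i) (carrier D) (grid P)"
      using bij_betw_trans[OF bij_betw_inv_into[OF h(1)] E.bij] .
    show "le D x y \<longleftrightarrow> (\<phi> \<circ> ?i) x \<le> (\<phi> \<circ> ?i) y" if "x \<in> carrier D" "y \<in> carrier D" for x y
      using h(2)[OF i(1)[OF that(1)] i(1)[OF that(2)]] E.le_iff i that by simp
  qed (rule assms(3))
  then show ?thesis by blast
qed

theorem theorem1:
  fixes D :: diagram
  assumes "planar_lattice_diagram D"
  shows "slim_semimodular_diagram D \<longleftrightarrow>
    (\<exists>D\<^sub>0. slim_distributive_diagram D\<^sub>0 \<and> obtained_by_resections D\<^sub>0 D)"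
proof
  assume "slim_semimodular_diagram D"
  then obtain P T \<phi> where m: "diagram_model P T D \<phi>" using slim_semimodular_model by blast
  then have p: "perm_set P T" using diagram_model.axioms(1) order_model.axioms(1) by blast
  then obtain D\<^sub>0 where "slim_distributive_diagram D\<^sub>0" "resection_step\<^sup>*\<^sup>* D\<^sub>0 (dom_diagram (grid P))"
    using dom_obtained by blast
  then show "\<exists>D\<^sub>0. slim_distributive_diagram D\<^sub>0 \<and> obtained_by_resections D\<^sub>0 D"
    using models_similar[OF perm_set.dom_model[OF p] m] unfolding obtained_by_resections_def by blast
next
  assume "\<exists>D\<^sub>0. slim_distributive_diagram D\<^sub>0 \<and> obtained_by_resections D\<^sub>0 D"
  then obtain P T \<phi> E where "order_model P T E \<phi>" "similar E D"
    unfolding obtained_by_resections_def by (meson resections_model)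
  moreover have "partial_order D"
    using assms by (simp add: planar_lattice_diagram_def planar_hasse_diagram_def)
  ultimately obtain \<psi> where "order_model P T D \<psi>" using similar_model by blast
  \<comment> \<open>Similarity has carried over the order; planarity of \<open>D\<close> is the
    hypothesis, and every order isomorphic to a grid is slim and semimodular.\<close>
  then show "slim_semimodular_diagram D"
    using assms order_model.slim order_model.semimodular
    unfolding slim_semimodular_diagram_def by blast
qed

end
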